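(* Let $(M,g')$ be a closed, connected Riemannian manifold of dimension $m\ge 0$, let $B$ be the closed ball of radius $2$ centered at $0$ in $\mathbb{R}^n$, $n\geq 4$, and let $g$ be a Riemannian metric on $B$ satisfying conditions (G1)-(G4) stated in the context, with corresponding irrational geodesic foliation $\mathcal{F}$ of the Clifford torus $\mathbb{T}^2\subset B$. Let $\tilde M=M\times B$ with the product metric $\tilde g=g'\oplus g$. Let $$\tilde{\mathcal{F}}=\{T_pM\times T_q\mathcal{F}\mid (p,q)\in M\times\mathbb{T}^2\}\subset G_{m+1}(\tilde M),$$ let $\pi:G_{m+1}(\tilde M)\to\tilde M$ be the bundle projection (which maps $\tilde{\mathcal{F}}$ bijectively onto $M\times\mathbb{T}^2$), and let $V_0=\big((\pi|_{\tilde{\mathcal{F}}})^{-1}\big)_\#\operatorname{vol}_{M\times\mathbb{T}^2}$ be the pushforward of the Riemannian volume measure of $M\times\mathbb{T}^2$ normalized to total mass one. Then the $(m+1)$-varifold $V_0$ is not rectifiable.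
   Context: Let $g_0$ be the Euclidean metric. The Clifford torus is $\mathbb{T}^2=\{\frac1{\sqrt2}(\sin\varphi,\cos\varphi,\sin\theta,\cos\theta)\mid\varphi,\theta\in[0,2\pi]\}\subset S^3\subset\mathbb{R}^4$; for $n\ge5$ it is regarded as a subset of $S^{n-1}\subset\mathbb{R}^n$ via $\mathbb{R}^4=\mathbb{R}^4\times\{0\}\subset\mathbb{R}^n$. A geodesic foliation of $\mathbb{T}^2$ is the image of a family of all parallel lines of a given slope in $\mathbb{R}^2$ under the covering $(\varphi,\theta)\mapsto\frac1{\sqrt2}(\sin\varphi,\cos\varphi,\sin\theta,\cos\theta)$; it is irrational if the slope is irrational. For $q\in\mathbb{T}^2$, $T_q\mathcal{F}$ denotes the tangent line at $q$ to the leaf of $\mathcal F$ through $q$. Conditions on $g$: (G1) The metric induced by $g$ on $\mathbb{T}^2$ is the flat one induced by $g_0$. (G2) The Euclidean distance to zero $d:B\to[0,2]$ is a convex distance function with respect to $g$, i.e. $|\operatorname{grad} d|_g=1$ where $d$ is smooth (on $B\setminus\{0\}$), and $d$ is convex along all $g$-geodesics. (G3) There exists an irrational geodesic foliation $\mathcal{F}$ of $\mathbb{T}^2$ such that the $g$-Hessian $\nabla^2(d^2)|_x$ is positive definite for all $x\in B\setminus\mathbb{T}^2$, and for $x\in\mathbb{T}^2$ the nullspace of $\nabla^2(d^2)|_x$ coincides with the tangent line to $\mathcal{F}$ at $x$. (G4) The second fundamental form, with respect to $g$, of $\mathbb{T}^2$ as a submanifold of the Euclidean unit sphere $S^{n-1}=d^{-1}(1)$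 vanishes on the vectors tangent to $\mathcal{F}$ (i.e. $h(v,v)=0$ for $v$ tangent to $\mathcal{F}$). A $k$-varifold in $\tilde M$ is a finite (nonnegative) Borel measure $V$ on the total space of the Grassmann bundle $G_{k}(\tilde M)$ of unoriented $k$-dimensional subspaces of tangent spaces of $\tilde M$. It is rectifiable if there are a countably $k$-rectifiable, $\mathcal{H}^k$-measurable set $E\subset\tilde M$ and a positive $\mathcal{H}^k$-integrable function $\theta$ on $E$ such that $\int\varphi\,dV=\int_E\varphi(T_xE)\,\theta(x)\,d\mathcal{H}^k(x)$ for all continuous compactly supported $\varphi$ on $G_k(\tilde M)$, where $T_xE$ is the approximate tangent space. *)

theory Defs
  imports "HOL-Analysis.Analysis" "HOL-Library.Function_Algebras"
begin

section \<open>Smooth maps on subsets of Euclidean spaces\<close>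

text \<open>\<open>Ck_on k S f\<close> is meant for open \<open>S\<close> only.\<close>

primrec Ck_on ::
  "nat \<Rightarrow> 'a::euclidean_space set \<Rightarrow> ('a \<Rightarrow> 'b::real_normed_vector) \<Rightarrow> bool" where
  "Ck_on 0 S f \<longleftrightarrow> continuous_on S f"
| "Ck_on (Suc k) S f \<longleftrightarrow>
     f differentiable_on S \<and> (\<forall>v. Ck_on k S (\<lambda>x. frechet_derivative f (at x) v))"

text \<open>On an arbitrary set, smooth means: locally the restriction of a smooth map defined on an
  open set. This is used for closed balls (smoothness up to the boundary), for relatively open
  subsets of linear subspaces, and for the Clifford torus.\<close>

definition smooth_on ::
  "'a::euclidean_space set \<Rightarrow> ('a \<Rightarrow> 'b::real_normed_vector) \<Rightarrow> bool" where
  "smooth_on X f \<longleftrightarrow>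
     (\<forall>x\<in>X. \<exists>S F. open S \<and> x \<in> S \<and> (\<forall>k. Ck_on k S F) \<and> (\<forall>y\<in>X \<inter> S. F y = f y))"


section \<open>Closed connected Riemannian manifolds\<close>

text \<open>The model \<open>\<real>\<^sup>m\<close> is the coordinate subspace of a Euclidean space spanned by \<open>m\<close> distinct basis
  vectors \<open>b 0, \<dots>, b (m - 1)\<close>; unlike a type, it may have dimension \<open>m = 0\<close>.\<close>

definition model_frame :: "nat \<Rightarrow> (nat \<Rightarrow> 'e::euclidean_space) \<Rightarrow> bool" where
  "model_frame m b \<longleftrightarrow> inj_on b {..<m} \<and> b ` {..<m} \<subseteq> Basis"

definition model_space :: "nat \<Rightarrow> (nat \<Rightarrow> 'e::euclidean_space) \<Rightarrow> 'e set" where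
  "model_space m b = span (b ` {..<m})"

definition model_point :: "nat \<Rightarrow> (nat \<Rightarrow> 'e::euclidean_space) \<Rightarrow> (nat \<Rightarrow> real) \<Rightarrow> 'e" where
  "model_point m b z = (\<Sum>i<m. z i *\<^sub>R b i)"

type_synonym ('p, 'e) chart = "'p set \<times> ('p \<Rightarrow> 'e)"

definition transition :: "('p, 'e) chart \<Rightarrow> ('p, 'e) chart \<Rightarrow> 'e \<Rightarrow> 'e" where
  "transition c c' = snd c' \<circ> the_inv_into (fst c) (snd c)"

definition smooth_atlas ::
  "nat \<Rightarrow> (nat \<Rightarrow> 'e::euclidean_space) \<Rightarrow> ('p::topological_space, 'e) chart set \<Rightarrow> bool" where
  "smooth_atlas m b A \<longleftrightarrow>
     (\<Union>c\<in>A. fst c) = UNIV \<and>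
     (\<forall>c\<in>A. open (fst c) \<and> openin (top_of_set (model_space m b)) (snd c ` fst c) \<and>
        (\<exists>\<psi>. homeomorphism (fst c) (snd c ` fst c) (snd c) \<psi>)) \<and>
     (\<forall>c\<in>A. \<forall>c'\<in>A. smooth_on (snd c ` (fst c \<inter> fst c')) (transition c c'))"

text \<open>A tangent vector at \<open>p\<close> is a family of coordinate vectors, one for each chart around \<open>p\<close>,
  transforming by the derivatives of the transition maps. The value at the charts that do not
  contain \<open>p\<close> is set to 0, so that the family is determined by the tangent vector.\<close>

type_synonym ('p, 'e) tvec = "('p, 'e) chart \<Rightarrow> 'e"

instantiation "fun" :: (type, real_vector) real_vector
begin

definition scaleR_fun :: "real \<Rightarrow> ('a \<Rightarrow> 'b) \<Rightarrow> 'a \<Rightarrow> 'b" where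
  "scaleR_fun r f = (\<lambda>x. r *\<^sub>R f x)"

instance
  by standard (simp_all add: scaleR_fun_def fun_eq_iff scaleR_add_right scaleR_add_left)

end

definition tangent_space ::
  "nat \<Rightarrow> (nat \<Rightarrow> 'e::euclidean_space) \<Rightarrow> ('p, 'e) chart set \<Rightarrow> 'p \<Rightarrow> ('p, 'e) tvec set" where
  "tangent_space m b A p = {v.
     (\<forall>c. if c \<in> A \<and> p \<in> fst c then v c \<in> model_space m b else v c = 0) \<and>
     (\<forall>c\<in>A. \<forall>c'\<in>A. p \<in> fst c \<and> p \<in> fst c' \<longrightarrow>
        ((\<lambda>t. transition c c' (snd c p + t *\<^sub>R v c)) has_vector_derivative v c') (at 0))}"

definition coordinate_vector ::
  "('p, 'e::euclidean_space) chart set \<Rightarrow> ('p, 'e) chart \<Rightarrow> 'p \<Rightarrow> 'e \<Rightarrow> ('p, 'e) tvec" where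
  "coordinate_vector A c p u = (\<lambda>c'.
     if c' \<in> A \<and> p \<in> fst c'
     then vector_derivative (\<lambda>t. transition c c' (snd c p + t *\<^sub>R u)) (at 0) else 0)"

definition inner_product_on :: "'v::real_vector set \<Rightarrow> ('v \<Rightarrow> 'v \<Rightarrow> real) \<Rightarrow> bool" where
  "inner_product_on T G \<longleftrightarrow>
     (\<forall>u\<in>T. \<forall>v\<in>T. \<forall>w\<in>T. G (u + v) w = G u w + G v w) \<and>
     (\<forall>r. \<forall>v\<in>T. \<forall>w\<in>T. G (r *\<^sub>R v) w = r * G v w) \<and>
     (\<forall>v\<in>T. \<forall>w\<in>T. G v w = G w v) \<and>
     (\<forall>v\<in>T. v \<noteq> 0 \<longrightarrow> G v v > 0)"

definition riemannian_metric ::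
  "nat \<Rightarrow> (nat \<Rightarrow> 'e::euclidean_space) \<Rightarrow> ('p, 'e) chart set \<Rightarrow>
   ('p \<Rightarrow> ('p, 'e) tvec \<Rightarrow> ('p, 'e) tvec \<Rightarrow> real) \<Rightarrow> bool" where
  "riemannian_metric m b A h \<longleftrightarrow>
     (\<forall>p. inner_product_on (tangent_space m b A p) (h p)) \<and>
     (\<forall>c\<in>A. \<forall>i<m. \<forall>j<m. smooth_on (snd c ` fst c)
        (\<lambda>y. let p = the_inv_into (fst c) (snd c) y
             in h p (coordinate_vector A c p (b i)) (coordinate_vector A c p (b j))))"

definition closed_connected_riemannian_manifold ::
  "nat \<Rightarrow> (nat \<Rightarrow> 'e::euclidean_space) \<Rightarrow>
   ('p::{t2_space,second_countable_topology}, 'e) chart set \<Rightarrow>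
   ('p \<Rightarrow> ('p, 'e) tvec \<Rightarrow> ('p, 'e) tvec \<Rightarrow> real) \<Rightarrow> bool" where
  "closed_connected_riemannian_manifold m b A h \<longleftrightarrow>
     compact (UNIV :: 'p set) \<and> connected (UNIV :: 'p set) \<and>
     model_frame m b \<and> smooth_atlas m b A \<and> riemannian_metric m b A h"


section \<open>Riemannian metrics on the closed ball of radius 2\<close>

abbreviation ball2 :: "(real ^ 'n) set" where
  "ball2 \<equiv> cball 0 2"

type_synonym 'n ball_metric = "real ^ 'n \<Rightarrow> real ^ 'n \<Rightarrow> real ^ 'n \<Rightarrow> real"

definition riemannian_metric_on_ball :: "('n::finite) ball_metric \<Rightarrow> bool" where
  "riemannian_metric_on_ball g \<longleftrightarrow>
     (\<forall>x\<in>ball2. inner_product_on UNIV (g x)) \<and>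
     (\<forall>v w. smooth_on ball2 (\<lambda>x. g x v w))"

text \<open>\<open>ball_deriv f x v\<close> is the derivative of a function on the closed ball (one-sided at boundary
  points, where it is still unique).\<close>

definition ball_deriv ::
  "(real ^ 'n::finite \<Rightarrow> 'b::real_normed_vector) \<Rightarrow> real ^ 'n \<Rightarrow> real ^ 'n \<Rightarrow> 'b" where
  "ball_deriv f x = frechet_derivative f (at x within ball2)"

text \<open>The Christoffel map of the Levi-Civita connection, by the Koszul formula for constant vector
  fields: \<open>\<nabla>\<^sub>v Y = D\<^sub>v Y + \<Gamma>(v, Y)\<close>.\<close>

definition christoffel ::
  "('n::finite) ball_metric \<Rightarrow> real ^ 'n \<Rightarrow> real ^ 'n \<Rightarrow> real ^ 'n \<Rightarrow> real ^ 'n" where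
  "christoffel g x v w = (THE z. \<forall>u. 2 * g x z u =
     ball_deriv (\<lambda>y. g y w u) x v + ball_deriv (\<lambda>y. g y v u) x w - ball_deriv (\<lambda>y. g y v w) x u)"

definition gradient ::
  "('n::finite) ball_metric \<Rightarrow> (real ^ 'n \<Rightarrow> real) \<Rightarrow> real ^ 'n \<Rightarrow> real ^ 'n" where
  "gradient g f x = (THE z. \<forall>u. g x z u = ball_deriv f x u)"

definition hessian ::
  "('n::finite) ball_metric \<Rightarrow> (real ^ 'n \<Rightarrow> real) \<Rightarrow> real ^ 'n \<Rightarrow> real ^ 'n \<Rightarrow> real ^ 'n \<Rightarrow> real" where
  "hessian g f x v w =
     ball_deriv (\<lambda>y. ball_deriv f y w) x v - ball_deriv f x (christoffel g x v w)"

definition geodesic_on :: "('n::finite) ball_metric \<Rightarrow> real set \<Rightarrow> (real \<Rightarrow> real ^ 'n) \<Rightarrow> bool" where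
  "geodesic_on g I \<gamma> \<longleftrightarrow> is_interval I \<and> \<gamma> ` I \<subseteq> ball2 \<and>
     (\<exists>\<gamma>'. \<forall>t\<in>I. (\<gamma> has_vector_derivative \<gamma>' t) (at t within I) \<and>
        (\<gamma>' has_vector_derivative - christoffel g (\<gamma> t) (\<gamma>' t) (\<gamma>' t)) (at t within I))"


section \<open>The Clifford torus and its geodesic foliations\<close>

text \<open>\<open>e\<close> enumerates the coordinates of \<open>\<real>\<^sup>n\<close>; the torus lies in the span of the first four.\<close>

definition torus_cover :: "(nat \<Rightarrow> 'n::finite) \<Rightarrow> real \<times> real \<Rightarrow> real ^ 'n" where
  "torus_cover e = (\<lambda>(\<phi>, \<theta>). (1 / sqrt 2) *\<^sub>R
     (sin \<phi> *\<^sub>R axis (e 1) 1 + cos \<phi> *\<^sub>R axis (e 2) 1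
      + sin \<theta> *\<^sub>R axis (e 3) 1 + cos \<theta> *\<^sub>R axis (e 4) 1))"

definition clifford_torus :: "(nat \<Rightarrow> 'n::finite) \<Rightarrow> (real ^ 'n) set" where
  "clifford_torus e = torus_cover e ` ({0..2 * pi} \<times> {0..2 * pi})"

definition torus_cover_deriv ::
  "(nat \<Rightarrow> 'n::finite) \<Rightarrow> real \<times> real \<Rightarrow> real \<times> real \<Rightarrow> real ^ 'n" where
  "torus_cover_deriv e z = frechet_derivative (torus_cover e) (at z)"

definition torus_tangent_space :: "(nat \<Rightarrow> 'n::finite) \<Rightarrow> real ^ 'n \<Rightarrow> (real ^ 'n) set" where
  "torus_tangent_space e q = {torus_cover_deriv e z a | z a. torus_cover e z = q}"

text \<open>A foliation is given by its leaves, each leaf being the image of a line under the covering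
  together with the induced immersion of \<open>\<real>\<close>.\<close>

definition irrational_geodesic_foliation ::
  "(nat \<Rightarrow> 'n::finite) \<Rightarrow> (real \<Rightarrow> real ^ 'n) set \<Rightarrow> bool" where
  "irrational_geodesic_foliation e F \<longleftrightarrow>
     (\<exists>s. s \<notin> \<rat> \<and> F = {(\<lambda>r. torus_cover e (r, s * r + t)) | t. True})"

definition foliation_tangent :: "(real \<Rightarrow> real ^ 'n::finite) set \<Rightarrow> real ^ 'n \<Rightarrow> (real ^ 'n) set" where
  "foliation_tangent F q =
     {a *\<^sub>R vector_derivative \<gamma> (at r) | a \<gamma> r. \<gamma> \<in> F \<and> \<gamma> r = q}"

text \<open>The normal space of the torus at \<open>q\<close> inside the tangent space of the Euclidean unit sphere,
  orthogonality being taken with respect to \<open>g\<close>.\<close>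

definition torus_normal_space ::
  "(nat \<Rightarrow> 'n::finite) \<Rightarrow> 'n ball_metric \<Rightarrow> real ^ 'n \<Rightarrow> (real ^ 'n) set" where
  "torus_normal_space e g q =
     {u. u \<bullet> q = 0 \<and> (\<forall>t\<in>torus_tangent_space e q. g q u t = 0)}"

text \<open>The second fundamental form \<open>h(v, w)\<close> is the \<open>g\<close>-orthogonal projection of \<open>\<nabla>\<^sub>v Y\<close> to the normal
  space, \<open>Y\<close> being any tangent vector field of the torus with \<open>Y q = w\<close>. Projecting the ambient
  connection first to the sphere (which gives the Levi-Civita connection of the sphere with the
  metric induced by \<open>g\<close>) does not change the result, as the normal space is tangent to the sphere.
  The derivative of \<open>Y\<close> in direction \<open>v\<close> is taken along a curve in the torus.\<close>

definition second_fundamental_form ::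
  "(nat \<Rightarrow> 'n::finite) \<Rightarrow> 'n ball_metric \<Rightarrow> real ^ 'n \<Rightarrow> real ^ 'n \<Rightarrow> real ^ 'n \<Rightarrow> real ^ 'n" where
  "second_fundamental_form e g q v w = (THE N. N \<in> torus_normal_space e g q \<and>
     (\<forall>Y z a. smooth_on (clifford_torus e) Y \<and>
        (\<forall>x\<in>clifford_torus e. Y x \<in> torus_tangent_space e x) \<and> Y q = w \<and>
        torus_cover e z = q \<and> torus_cover_deriv e z a = v \<longrightarrow>
        (\<forall>u\<in>torus_normal_space e g q.
           g q N u =
           g q (vector_derivative (\<lambda>t. Y (torus_cover e (z + t *\<^sub>R a))) (at 0)
                + christoffel g q v w) u)))"


section \<open>The conditions on the metric of the ball\<close>

definition induces_flat_torus_metric :: "(nat \<Rightarrow> 'n::finite) \<Rightarrow> 'n ball_metric \<Rightarrow> bool" where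
  "induces_flat_torus_metric e g \<longleftrightarrow>
     (\<forall>q\<in>clifford_torus e. \<forall>v\<in>torus_tangent_space e q. \<forall>w\<in>torus_tangent_space e q.
        g q v w = v \<bullet> w)"

definition norm_is_convex_distance_function :: "('n::finite) ball_metric \<Rightarrow> bool" where
  "norm_is_convex_distance_function g \<longleftrightarrow>
     (\<forall>x\<in>ball2 - {0}. sqrt (g x (gradient g norm x) (gradient g norm x)) = 1) \<and>
     (\<forall>I \<gamma>. geodesic_on g I \<gamma> \<longrightarrow> convex_on I (\<lambda>t. norm (\<gamma> t)))"

definition hessian_condition ::
  "(nat \<Rightarrow> 'n::finite) \<Rightarrow> 'n ball_metric \<Rightarrow> (real \<Rightarrow> real ^ 'n) set \<Rightarrow> bool" where
  "hessian_condition e g F \<longleftrightarrow>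
     (\<forall>x\<in>ball2 - clifford_torus e. \<forall>v. v \<noteq> 0 \<longrightarrow> hessian g (\<lambda>y. (norm y)\<^sup>2) x v v > 0) \<and>
     (\<forall>x\<in>clifford_torus e.
        {v. \<forall>w. hessian g (\<lambda>y. (norm y)\<^sup>2) x v w = 0} = foliation_tangent F x)"

definition second_fundamental_form_condition ::
  "(nat \<Rightarrow> 'n::finite) \<Rightarrow> 'n ball_metric \<Rightarrow> (real \<Rightarrow> real ^ 'n) set \<Rightarrow> bool" where
  "second_fundamental_form_condition e g F \<longleftrightarrow>
     (\<forall>q\<in>clifford_torus e. \<forall>v\<in>foliation_tangent F q. second_fundamental_form e g q v v = 0)"


section \<open>The Riemannian product with the ball\<close>

definition product_manifold :: "('p \<times> (real ^ 'n::finite)) set" where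
  "product_manifold = UNIV \<times> ball2"

type_synonym ('p, 'e, 'n) product_tvec = "('p, 'e) tvec \<times> (real ^ 'n)"

definition product_tangent_space ::
  "nat \<Rightarrow> (nat \<Rightarrow> 'e::euclidean_space) \<Rightarrow> ('p, 'e) chart set \<Rightarrow> 'p \<times> (real ^ 'n::finite) \<Rightarrow>
   ('p, 'e, 'n) product_tvec set" where
  "product_tangent_space m b A x = tangent_space m b A (fst x) \<times> UNIV"

definition product_metric ::
  "('p \<Rightarrow> ('p, 'e) tvec \<Rightarrow> ('p, 'e) tvec \<Rightarrow> real) \<Rightarrow> ('n::finite) ball_metric \<Rightarrow>
   'p \<times> (real ^ 'n) \<Rightarrow> ('p, 'e, 'n) product_tvec \<Rightarrow> ('p, 'e, 'n) product_tvec \<Rightarrow> real" where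
  "product_metric h g x v w = h (fst x) (fst v) (fst w) + g (snd x) (snd v) (snd w)"

definition product_chart :: "('p, 'e) chart \<Rightarrow> 'p \<times> (real ^ 'n::finite) \<Rightarrow> 'e \<times> (real ^ 'n)" where
  "product_chart c x = (snd c (fst x), snd x)"

definition tvec_coords ::
  "('p, 'e) chart \<Rightarrow> ('p, 'e, 'n::finite) product_tvec \<Rightarrow> 'e \<times> (real ^ 'n)" where
  "tvec_coords c v = (fst v c, snd v)"


subsection \<open>Riemannian distance\<close>

definition C1_on :: "real set \<Rightarrow> (real \<Rightarrow> 'a::real_normed_vector) \<Rightarrow> bool" where
  "C1_on I f \<longleftrightarrow>
     (\<exists>f'. (\<forall>t\<in>I. (f has_vector_derivative f' t) (at t within I)) \<and> continuous_on I f')"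

definition C1_curve ::
  "('p::topological_space, 'e::euclidean_space) chart set \<Rightarrow>
   (real \<Rightarrow> 'p \<times> (real ^ 'n::finite)) \<Rightarrow> bool" where
  "C1_curve A \<gamma> \<longleftrightarrow> continuous_on {0..1} \<gamma> \<and> \<gamma> ` {0..1} \<subseteq> product_manifold \<and>
     (\<forall>c\<in>A. C1_on {t\<in>{0..1}. fst (\<gamma> t) \<in> fst c} (\<lambda>t. product_chart c (\<gamma> t)))"

definition velocity ::
  "('p, 'e::euclidean_space) chart set \<Rightarrow> (real \<Rightarrow> 'p \<times> (real ^ 'n::finite)) \<Rightarrow> real \<Rightarrow>
   ('p, 'e, 'n) product_tvec" where
  "velocity A \<gamma> t =
     (\<lambda>c. if c \<in> A \<and> fst (\<gamma> t) \<in> fst c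
          then vector_derivative (\<lambda>s. snd c (fst (\<gamma> s))) (at t within {0..1}) else 0,
      vector_derivative (\<lambda>s. snd (\<gamma> s)) (at t within {0..1}))"

definition curve_length ::
  "('p, 'e::euclidean_space) chart set \<Rightarrow> ('p \<Rightarrow> ('p, 'e) tvec \<Rightarrow> ('p, 'e) tvec \<Rightarrow> real) \<Rightarrow>
   ('n::finite) ball_metric \<Rightarrow> (real \<Rightarrow> 'p \<times> (real ^ 'n)) \<Rightarrow> real" where
  "curve_length A h g \<gamma> = integral {0..1}
     (\<lambda>t. sqrt (product_metric h g (\<gamma> t) (velocity A \<gamma> t) (velocity A \<gamma> t)))"

text \<open>\<open>piecewise_C1_join A h g x y l\<close>: some piecewise \<open>C\<^sup>1\<close> curve (a finite concatenation of \<open>C\<^sup>1\<close>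
  curves) from \<open>x\<close> to \<open>y\<close> has length \<open>l\<close>.\<close>

inductive piecewise_C1_join ::
  "('p::topological_space, 'e::euclidean_space) chart set \<Rightarrow>
   ('p \<Rightarrow> ('p, 'e) tvec \<Rightarrow> ('p, 'e) tvec \<Rightarrow> real) \<Rightarrow> ('n::finite) ball_metric \<Rightarrow>
   'p \<times> (real ^ 'n) \<Rightarrow> 'p \<times> (real ^ 'n) \<Rightarrow> real \<Rightarrow> bool"
  for A h g where
  "x \<in> product_manifold \<Longrightarrow> piecewise_C1_join A h g x x 0"
| "piecewise_C1_join A h g x (\<gamma> 0) l \<Longrightarrow> C1_curve A \<gamma> \<Longrightarrow>
     piecewise_C1_join A h g x (\<gamma> 1) (l + curve_length A h g \<gamma>)"

definition riemannian_distance ::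
  "('p::topological_space, 'e::euclidean_space) chart set \<Rightarrow>
   ('p \<Rightarrow> ('p, 'e) tvec \<Rightarrow> ('p, 'e) tvec \<Rightarrow> real) \<Rightarrow> ('n::finite) ball_metric \<Rightarrow>
   'p \<times> (real ^ 'n) \<Rightarrow> 'p \<times> (real ^ 'n) \<Rightarrow> real" where
  "riemannian_distance A h g x y = Inf {l. piecewise_C1_join A h g x y l}"


subsection \<open>Grassmann bundle\<close>

definition grassmann_bundle ::
  "nat \<Rightarrow> (nat \<Rightarrow> 'e::euclidean_space) \<Rightarrow> ('p, 'e) chart set \<Rightarrow> nat \<Rightarrow>
   (('p \<times> (real ^ 'n::finite)) \<times> ('p, 'e, 'n) product_tvec set) set" where
  "grassmann_bundle m b A k =
     {(x, S). x \<in> product_manifold \<and> S \<subseteq> product_tangent_space m b A x \<and> subspace S \<and> dim S = k}"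

text \<open>The usual metric on the Grassmannians of a Euclidean space: operator norm of the difference of
  the orthogonal projections.\<close>

definition subspace_dist :: "'a::euclidean_space set \<Rightarrow> 'a set \<Rightarrow> real" where
  "subspace_dist S S' = onorm (\<lambda>z. closest_point S z - closest_point S' z)"

text \<open>The topology in which the bundle projection is continuous, the parts over the chart domains
  are open, and the local trivialisations \<open>(x, S) \<mapsto> (x, tvec_coords c ` S)\<close> are homeomorphisms onto
  their images.\<close>

definition grassmann_topology ::
  "nat \<Rightarrow> (nat \<Rightarrow> 'e::euclidean_space) \<Rightarrow> ('p::topological_space, 'e) chart set \<Rightarrow> nat \<Rightarrow>
   (('p \<times> (real ^ 'n::finite)) \<times> ('p, 'e, 'n) product_tvec set) topology" where
  "grassmann_topology m b A k = topology_generated_by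
     {{\<xi> \<in> grassmann_bundle m b A k. fst \<xi> \<in> N \<and> fst (fst \<xi>) \<in> fst c \<and>
        subspace_dist (tvec_coords c ` snd \<xi>) Q < \<epsilon>} | N c Q \<epsilon>.
      open N \<and> c \<in> A \<and> subspace Q \<and> \<epsilon> > 0}"

definition grassmann_borel ::
  "nat \<Rightarrow> (nat \<Rightarrow> 'e::euclidean_space) \<Rightarrow> ('p::topological_space, 'e) chart set \<Rightarrow> nat \<Rightarrow>
   (('p \<times> (real ^ 'n::finite)) \<times> ('p, 'e, 'n) product_tvec set) measure" where
  "grassmann_borel m b A k =
     sigma (grassmann_bundle m b A k) {U. openin (grassmann_topology m b A k) U}"


section \<open>Hausdorff measure and rectifiability\<close>

definition ediam :: "('x \<Rightarrow> 'x \<Rightarrow> real) \<Rightarrow> 'x set \<Rightarrow> ennreal" where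
  "ediam d C = (SUP (x, y)\<in>C \<times> C. ennreal (d x y))"

definition hausdorff_premeasure ::
  "'x set \<Rightarrow> ('x \<Rightarrow> 'x \<Rightarrow> real) \<Rightarrow> nat \<Rightarrow> real \<Rightarrow> 'x set \<Rightarrow> ennreal" where
  "hausdorff_premeasure X d k \<delta> E =
     (INF C\<in>{C :: nat \<Rightarrow> 'x set. E \<subseteq> (\<Union>i. C i) \<and> (\<forall>i. C i \<subseteq> X \<and> ediam d (C i) \<le> ennreal \<delta>)}.
        \<Sum>i. if C i = {} then 0 else ennreal (unit_ball_vol (real k)) * (ediam d (C i) / 2) ^ k)"

definition hausdorff_outer ::
  "'x set \<Rightarrow> ('x \<Rightarrow> 'x \<Rightarrow> real) \<Rightarrow> nat \<Rightarrow> 'x set \<Rightarrow> ennreal" where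
  "hausdorff_outer X d k E = (SUP \<delta>\<in>{0<..}. hausdorff_premeasure X d k \<delta> E)"

text \<open>Its measurable sets are the Caratheodory-measurable ones.\<close>

definition hausdorff_measure :: "'x set \<Rightarrow> ('x \<Rightarrow> 'x \<Rightarrow> real) \<Rightarrow> nat \<Rightarrow> 'x measure" where
  "hausdorff_measure X d k =
     measure_of X (lambda_system X (Pow X) (hausdorff_outer X d k)) (hausdorff_outer X d k)"

definition lipschitz_from_Rk ::
  "('x \<Rightarrow> 'x \<Rightarrow> real) \<Rightarrow> nat \<Rightarrow> (nat \<Rightarrow> real) set \<Rightarrow> ((nat \<Rightarrow> real) \<Rightarrow> 'x) \<Rightarrow> bool" where
  "lipschitz_from_Rk d k S f \<longleftrightarrow> S \<subseteq> {..<k} \<rightarrow>\<^sub>E UNIV \<and>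
     (\<exists>L. \<forall>x\<in>S. \<forall>y\<in>S. d (f x) (f y) \<le> L * L2_set (\<lambda>i. x i - y i) {..<k})"

definition countably_rectifiable :: "'x set \<Rightarrow> ('x \<Rightarrow> 'x \<Rightarrow> real) \<Rightarrow> nat \<Rightarrow> 'x set \<Rightarrow> bool" where
  "countably_rectifiable X d k E \<longleftrightarrow> E \<subseteq> X \<and>
     (\<exists>N (S :: nat \<Rightarrow> (nat \<Rightarrow> real) set) f.
        N \<subseteq> X \<and> hausdorff_outer X d k N = 0 \<and>
        (\<forall>i. lipschitz_from_Rk d k (S i) (f i) \<and> f i ` S i \<subseteq> X) \<and>
        E \<subseteq> N \<union> (\<Union>i. f i ` S i))"

definition lebesgue_Rk :: "nat \<Rightarrow> (nat \<Rightarrow> real) measure" where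
  "lebesgue_Rk k = PiM {..<k} (\<lambda>_. lborel)"

abbreviation product_hausdorff ::
  "('p::topological_space, 'e::euclidean_space) chart set \<Rightarrow>
   ('p \<Rightarrow> ('p, 'e) tvec \<Rightarrow> ('p, 'e) tvec \<Rightarrow> real) \<Rightarrow> ('n::finite) ball_metric \<Rightarrow> nat \<Rightarrow>
   ('p \<times> (real ^ 'n)) measure" where
  "product_hausdorff A h g k \<equiv> hausdorff_measure product_manifold (riemannian_distance A h g) k"

text \<open>\<open>P\<close> is the approximate tangent space at \<open>x\<close> of the set \<open>E\<close> with multiplicity \<open>\<theta>\<close>: in coordinates,
  the blow-ups at \<open>x\<close> of the measure \<open>\<theta> \<H>\<^sup>k\<lfloor>E\<close> converge to \<open>\<theta>(x)\<close> times the \<open>k\<close>-dimensional area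
  measure of \<open>P\<close> (with respect to the inner product on the tangent space at \<open>x\<close>, hence expressed
  by an orthonormal basis \<open>u\<close> of \<open>P\<close>). For rectifiable \<open>E\<close> and almost all \<open>x\<close>, this space does not
  depend on \<open>\<theta>\<close>.\<close>

definition approximate_tangent_space ::
  "nat \<Rightarrow> (nat \<Rightarrow> 'e::euclidean_space) \<Rightarrow> ('p::topological_space, 'e) chart set \<Rightarrow>
   ('p \<Rightarrow> ('p, 'e) tvec \<Rightarrow> ('p, 'e) tvec \<Rightarrow> real) \<Rightarrow> ('n::finite) ball_metric \<Rightarrow> nat \<Rightarrow>
   ('p \<times> (real ^ 'n)) set \<Rightarrow> ('p \<times> (real ^ 'n) \<Rightarrow> real) \<Rightarrow>
   'p \<times> (real ^ 'n) \<Rightarrow> ('p, 'e, 'n) product_tvec set \<Rightarrow> bool" where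
  "approximate_tangent_space m b A h g k E \<theta> x P \<longleftrightarrow>
     (x, P) \<in> grassmann_bundle m b A k \<and>
     (\<forall>c\<in>A. fst x \<in> fst c \<longrightarrow>
       (\<forall>f :: 'e \<times> (real ^ 'n) \<Rightarrow> real. continuous_on UNIV f \<and> bounded {y. f y \<noteq> 0} \<longrightarrow>
         (\<forall>u. (\<forall>i<k. u i \<in> P) \<and>
              (\<forall>i<k. \<forall>j<k. product_metric h g x (u i) (u j) = (if i = j then 1 else 0)) \<longrightarrow>
           ((\<lambda>r. (LINT y:{y\<in>E. fst y \<in> fst c}|product_hausdorff A h g k.
                    f ((product_chart c y - product_chart c x) /\<^sub>R r) * \<theta> y) / r ^ k)
            \<longlongrightarrow> \<theta> x * (LINT z|lebesgue_Rk k. f (\<Sum>i<k. z i *\<^sub>R tvec_coords c (u i))))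
             (at_right 0))))"


section \<open>Varifolds\<close>

definition varifold ::
  "nat \<Rightarrow> (nat \<Rightarrow> 'e::euclidean_space) \<Rightarrow> ('p::topological_space, 'e) chart set \<Rightarrow> nat \<Rightarrow>
   (('p \<times> (real ^ 'n::finite)) \<times> ('p, 'e, 'n) product_tvec set) measure \<Rightarrow> bool" where
  "varifold m b A k V \<longleftrightarrow>
     space V = grassmann_bundle m b A k \<and> sets V = sets (grassmann_borel m b A k) \<and>
     finite_measure V"

definition continuous_compact_support :: "'x topology \<Rightarrow> ('x \<Rightarrow> real) \<Rightarrow> bool" where
  "continuous_compact_support X f \<longleftrightarrow> continuous_map X euclideanreal f \<and>
     (\<exists>K. compactin X K \<and> (\<forall>x\<in>topspace X - K. f x = 0))"

definition rectifiable_varifold ::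
  "nat \<Rightarrow> (nat \<Rightarrow> 'e::euclidean_space) \<Rightarrow> ('p::topological_space, 'e) chart set \<Rightarrow>
   ('p \<Rightarrow> ('p, 'e) tvec \<Rightarrow> ('p, 'e) tvec \<Rightarrow> real) \<Rightarrow> ('n::finite) ball_metric \<Rightarrow> nat \<Rightarrow>
   (('p \<times> (real ^ 'n)) \<times> ('p, 'e, 'n) product_tvec set) measure \<Rightarrow> bool" where
  "rectifiable_varifold m b A h g k V \<longleftrightarrow>
     (\<exists>E \<theta> T.
        E \<in> sets (product_hausdorff A h g k) \<and>
        countably_rectifiable product_manifold (riemannian_distance A h g) k E \<and>
        (\<forall>x\<in>E. \<theta> x > 0) \<and> set_integrable (product_hausdorff A h g k) E \<theta> \<and>
        (AE x in product_hausdorff A h g k.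
           x \<in> E \<longrightarrow> approximate_tangent_space m b A h g k E \<theta> x (T x)) \<and>
        (\<forall>\<phi>. continuous_compact_support (grassmann_topology m b A k) \<phi> \<longrightarrow>
           (LINT \<xi>|V. \<phi> \<xi>) = (LINT x:E|product_hausdorff A h g k. \<phi> (x, T x) * \<theta> x)))"


section \<open>The varifold of the foliation\<close>

definition gram_det :: "nat \<Rightarrow> (nat \<Rightarrow> nat \<Rightarrow> real) \<Rightarrow> real" where
  "gram_det k G = (\<Sum>p | p permutes {..<k}. of_int (sign p) * (\<Prod>i<k. G i (p i)))"

text \<open>Local coordinates of the product of the manifold with the torus: the first \<open>m\<close> coordinates belong
  to the chart \<open>c\<close>, the last two are the angles.\<close>

definition torus_product_param ::
  "nat \<Rightarrow> (nat \<Rightarrow> 'e::euclidean_space) \<Rightarrow> (nat \<Rightarrow> 'n::finite) \<Rightarrow> ('p, 'e) chart \<Rightarrow>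
   (nat \<Rightarrow> real) \<Rightarrow> 'p \<times> (real ^ 'n)" where
  "torus_product_param m b e c z =
     (the_inv_into (fst c) (snd c) (model_point m b z), torus_cover e (z m, z (Suc m)))"

definition torus_product_frame ::
  "nat \<Rightarrow> (nat \<Rightarrow> 'e::euclidean_space) \<Rightarrow> ('p, 'e) chart set \<Rightarrow> (nat \<Rightarrow> 'n::finite) \<Rightarrow>
   ('p, 'e) chart \<Rightarrow> (nat \<Rightarrow> real) \<Rightarrow> nat \<Rightarrow> ('p, 'e, 'n) product_tvec" where
  "torus_product_frame m b A e c z i =
     (if i < m
      then (coordinate_vector A c (the_inv_into (fst c) (snd c) (model_point m b z)) (b i), 0)
      else (0, torus_cover_deriv e (z m, z (Suc m)) (if i = m then (1, 0) else (0, 1))))"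

text \<open>\<open>\<mu>\<close> is the Riemannian volume measure of the product of the manifold with the torus, with the
  metric induced by the product metric: the Borel measure that is given by the density
  \<open>sqrt (det g\<^sub>i\<^sub>j)\<close> in all local coordinates. It is uniquely determined by this property.\<close>

definition torus_product_volume ::
  "nat \<Rightarrow> (nat \<Rightarrow> 'e::euclidean_space) \<Rightarrow> ('p::topological_space, 'e) chart set \<Rightarrow>
   ('p \<Rightarrow> ('p, 'e) tvec \<Rightarrow> ('p, 'e) tvec \<Rightarrow> real) \<Rightarrow> ('n::finite) ball_metric \<Rightarrow> (nat \<Rightarrow> 'n) \<Rightarrow>
   ('p \<times> (real ^ 'n)) measure \<Rightarrow> bool" where
  "torus_product_volume m b A h g e \<mu> \<longleftrightarrow>
     space \<mu> = UNIV \<times> clifford_torus e \<and>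
     sets \<mu> = sets (restrict_space borel (UNIV \<times> clifford_torus e)) \<and>
     (\<forall>c\<in>A. \<forall>\<phi>\<^sub>0 \<theta>\<^sub>0. \<forall>D\<in>sets \<mu>.
        D \<subseteq> fst c \<times> torus_cover e ` ({\<phi>\<^sub>0<..<\<phi>\<^sub>0 + 2 * pi} \<times> {\<theta>\<^sub>0<..<\<theta>\<^sub>0 + 2 * pi}) \<longrightarrow>
        emeasure \<mu> D =
          (\<integral>\<^sup>+z. indicator {z. model_point m b z \<in> snd c ` fst c \<and>
                            z m \<in> {\<phi>\<^sub>0<..<\<phi>\<^sub>0 + 2 * pi} \<and> z (Suc m) \<in> {\<theta>\<^sub>0<..<\<theta>\<^sub>0 + 2 * pi} \<and>
                            torus_product_param m b e c z \<in> D} z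
                 * ennreal (sqrt (gram_det (m + 2) (\<lambda>i j.
                     product_metric h g (torus_product_param m b e c z)
                       (torus_product_frame m b A e c z i) (torus_product_frame m b A e c z j))))
             \<partial>lebesgue_Rk (m + 2)))"

definition foliation_lift ::
  "nat \<Rightarrow> (nat \<Rightarrow> 'e::euclidean_space) \<Rightarrow> ('p, 'e) chart set \<Rightarrow> (nat \<Rightarrow> 'n::finite) \<Rightarrow>
   (real \<Rightarrow> real ^ 'n) set \<Rightarrow> (('p \<times> (real ^ 'n)) \<times> ('p, 'e, 'n) product_tvec set) set" where
  "foliation_lift m b A e F =
     {((p, q), tangent_space m b A p \<times> foliation_tangent F q) | p q. q \<in> clifford_torus e}"

definition normalized_measure :: "'x measure \<Rightarrow> 'x measure" where
  "normalized_measure \<mu> = scale_measure (inverse (emeasure \<mu> (space \<mu>))) \<mu>"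

definition foliation_varifold ::
  "nat \<Rightarrow> (nat \<Rightarrow> 'e::euclidean_space) \<Rightarrow> ('p::topological_space, 'e) chart set \<Rightarrow>
   (nat \<Rightarrow> 'n::finite) \<Rightarrow> (real \<Rightarrow> real ^ 'n) set \<Rightarrow> ('p \<times> (real ^ 'n)) measure \<Rightarrow>
   (('p \<times> (real ^ 'n)) \<times> ('p, 'e, 'n) product_tvec set) measure" where
  "foliation_varifold m b A e F \<mu> =
     distr (normalized_measure \<mu>) (grassmann_borel m b A (m + 1))
       (the_inv_into (foliation_lift m b A e F) fst)"

end

theory Submission
  imports Defs "Jordan_Normal_Form.Determinant"
begin

text \<open>The weight of the varifold is the normalized volume measure of the product of the manifold
  with the torus, which has dimension \<open>m + 2\<close>: a set of small diameter \<open>r\<close> has volume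
  \<open>O(r ^ (m + 2))\<close>. If the varifold were rectifiable, this weight would be \<open>\<theta> \<H>\<^sup>m\<^sup>+\<^sup>1\<close> on some set
  \<open>E\<close>. The sets \<open>{\<theta> \<ge> 1 / n}\<close> have finite \<open>\<H>\<^sup>m\<^sup>+\<^sup>1\<close>, so they are covered by sets of small diameters
  \<open>r\<^sub>i\<close> with \<open>\<Sum> r\<^sub>i ^ (m + 1)\<close> bounded, hence with \<open>\<Sum> r\<^sub>i ^ (m + 2)\<close> arbitrarily small. Continuous
  functions close to the indicator of such a cover of \<open>E\<close> have small integral against the volume,
  but integral close to 1 against \<open>\<theta> \<H>\<^sup>m\<^sup>+\<^sup>1\<close>. The tangent planes play no role.\<close>

text \<open>What reduces the statement to weights is the compactness of the Grassmann bundle over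
  the compact product: every continuous function of the base point alone is a continuous function of
  compact support on the bundle, and testing with such functions compares the two weight measures.

  The main obstacle is that Hausdorff measure is formed with the Riemannian distance, an infimum
  over curves that may leave a chart and come back, whereas volume is computed in charts. A C1 bump
  embedding of a coordinate ball, extended by 0, is Lipschitz along all curves. Near the centre its
  values are far from 0 and it can be inverted with a bound, so that a small Riemannian diameter
  forces a small coordinate diameter.

  The covering sets are arbitrary subsets and need not be measurable for the Hausdorff measure. This
  is why they are replaced by continuous functions, whose finite sums are passed to the limit by
  dominated convergence.\<close>

section \<open>Positivity of Gram determinants\<close>

no_notation scalar_prod (infix \<open>\<bullet>\<close> 70)
no_notation vec_index (infixl \<open>$\<close> 100)
hide_const (open) Determinant.det Matrix.vec
hide_type (open) Matrix.vec

text \<open>\<open>gram_det\<close> is the Leibniz formula. Read as the determinant of a matrix, it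
  supplies a kernel vector whenever it vanishes.\<close>

lemma gram_det_conv_det: "gram_det k G = Determinant.det (mat k k (\<lambda>(i, j). G i j))"
proof -
  have "(\<Prod>i<k. G i (p i)) = (\<Prod>i<k. mat k k (\<lambda>(i, j). G i j) $$ (i, p i))"
    if "p permutes {..<k}" for p
  proof (rule prod.cong[OF refl])
    fix i assume "i \<in> {..<k}"
    hence "i < k" "p i < k" using permutes_in_image[OF that, of i] by auto
    thus "G i (p i) = mat k k (\<lambda>(i, j). G i j) $$ (i, p i)" by simp
  qed
  hence "gram_det k G = (\<Sum>p | p permutes {..<k}. of_int (sign p) * (\<Prod>i<k. mat k k (\<lambda>(i, j). G i j) $$ (i, p i)))"
    unfolding gram_det_def by (intro sum.cong) simp_all
  thus ?thesis
    by (simp add: Determinant.det_def lessThan_atLeast0)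
qed

text \<open>A kernel vector of the matrix would be a zero of the quadratic form.\<close>

lemma gram_det_nonzero:
  assumes "\<And>a. \<exists>i<k. a i \<noteq> 0 \<Longrightarrow> (\<Sum>i<k. \<Sum>j<k. a i * a j * G i j) > 0"
  shows "gram_det k G \<noteq> 0"
proof
  let ?M = "mat k k (\<lambda>(i, j). G i j)"
  assume "gram_det k G = 0"
  then obtain v where v: "v \<in> carrier_vec k" "v \<noteq> 0\<^sub>v k" "?M *\<^sub>v v = 0\<^sub>v k"
    using det_0_iff_vec_prod_zero[of ?M k] unfolding gram_det_conv_det by auto
  have "\<exists>i<k. vec_index v i \<noteq> 0"
    using v(1,2) by (metis carrier_vecD eq_vecI index_zero_vec(1) index_zero_vec(2))
  from assms[OF this] have *: "(\<Sum>i<k. \<Sum>j<k. vec_index v i * vec_index v j * G i j) > 0" .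
  have "(\<Sum>j<k. G i j * vec_index v j) = 0" if "i < k" for i
  proof -
    have "vec_index (?M *\<^sub>v v) i = (\<Sum>j<k. G i j * vec_index v j)"
      using that v(1) by (auto simp: scalar_prod_def lessThan_atLeast0 intro!: sum.cong)
    thus ?thesis using v(3) that by simp
  qed
  hence "(\<Sum>i<k. vec_index v i * (\<Sum>j<k. G i j * vec_index v j)) = 0" by simp
  with * show False by (simp add: sum_distrib_left mult_ac)
qed

text \<open>Deform the identity matrix to \<open>G\<close> along a segment. The quadratic form stays
  positive on the way, so the determinant never vanishes and keeps the sign that it has at the
  identity.\<close>

lemma gram_det_pos:
  assumes "\<And>a. \<exists>i<k. a i \<noteq> 0 \<Longrightarrow> (\<Sum>i<k. \<Sum>j<k. a i * a j * G i j) > 0"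
  shows "gram_det k G > 0"
proof (rule ccontr)
  define G' where "G' = (\<lambda>t i j. (1 - t) * (if i = j then 1 else 0) + t * G i j :: real)"
  assume neg: "\<not> gram_det k G > 0"
  have one: "gram_det k (G' 0) = 1"
  proof -
    have "mat k k (\<lambda>(i, j). G' 0 i j) = (1\<^sub>m k :: real mat)"
      by (auto simp: G'_def)
    thus ?thesis by (simp add: gram_det_conv_det)
  qed
  have G1: "G' 1 = G" by (auto simp: G'_def)
  have "continuous_on {0..1} (\<lambda>t. gram_det k (G' t))"
    unfolding gram_det_def G'_def by (intro continuous_intros)
  then obtain t where t: "0 \<le> t" "t \<le> 1" "gram_det k (G' t) = 0"
    using IVT2'[of "\<lambda>t. gram_det k (G' t)" 1 0 0] one neg G1 by auto
  have "gram_det k (G' t) \<noteq> 0"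
  proof (rule gram_det_nonzero)
    fix a :: "nat \<Rightarrow> real" assume a: "\<exists>i<k. a i \<noteq> 0"
    have sq: "(\<Sum>i<k. \<Sum>j<k. a i * a j * (if i = j then 1 else 0)) = (\<Sum>i<k. (a i)\<^sup>2)"
      by (simp add: power2_eq_square if_distrib sum.delta cong: if_cong)
    have pos: "(\<Sum>i<k. (a i)\<^sup>2) > 0"
      using a by (meson finite_lessThan lessThan_iff sum_pos2 zero_le_power2 zero_less_power2)
    have "(\<Sum>i<k. \<Sum>j<k. a i * a j * G' t i j) =
        (1 - t) * (\<Sum>i<k. \<Sum>j<k. a i * a j * (if i = j then 1 else 0)) + t * (\<Sum>i<k. \<Sum>j<k. a i * a j * G i j)"
      by (simp only: G'_def sum_distrib_left sum.distrib[symmetric]) (simp add: algebra_simps)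
    also have "\<dots> > 0"
    proof (cases "t = 0")
      case False
      thus ?thesis using t assms[OF a] pos unfolding sq
        by (intro add_nonneg_pos mult_nonneg_nonneg mult_pos_pos) auto
    qed (use sq pos in simp)
    finally show "(\<Sum>i<k. \<Sum>j<k. a i * a j * G' t i j) > 0" .
  qed
  with t show False by simp
qed

lemma continuous_on_gram_det:
  assumes "\<And>i j. i < k \<Longrightarrow> j < k \<Longrightarrow> continuous_on S (\<lambda>x. G x i j)"
  shows "continuous_on S (\<lambda>x. gram_det k (G x))"
proof -
  have "continuous_on S (\<lambda>x. G x i (p i))" if "p permutes {..<k}" "i < k" for p i
    using assms that permutes_in_image[OF that(1)] by auto
  thus ?thesis unfolding gram_det_def by (intro continuous_intros) auto
qed

section \<open>Tangent spaces in charts\<close>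

text \<open>Charts and points of the product are pairs, but they are handled through
  \<open>fst\<close> and \<open>snd\<close>; splitting quantified variables into components would
  destroy the terms that the chart lemmas match.\<close>

declare split_paired_All [simp del] split_paired_Ex [simp del]

lemma has_vector_derivative_compose:
  assumes "(f has_vector_derivative w) (at t within I)" "(F has_derivative F') (at (f t))"
  shows "((\<lambda>s. F (f s)) has_vector_derivative F' w) (at t within I)"
  using vector_derivative_diff_chain_within[OF assms(1) has_derivative_at_withinI[OF assms(2)]]
  by (simp add: o_def)

locale closed_riemannian_manifold =
  fixes m :: nat and b :: "nat \<Rightarrow> 'e::euclidean_space"
    and A :: "('p::{t2_space,second_countable_topology}, 'e) chart set"
    and h :: "'p \<Rightarrow> ('p, 'e) tvec \<Rightarrow> ('p, 'e) tvec \<Rightarrow> real"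
  assumes manifold: "closed_connected_riemannian_manifold m b A h"
begin

abbreviation E0 where "E0 \<equiv> model_space m b"

definition chart_inv :: "('p, 'e) chart \<Rightarrow> 'e \<Rightarrow> 'p" where
  "chart_inv c = the_inv_into (fst c) (snd c)"

text \<open>The derivative at \<open>p\<close> of the change from \<open>c\<close> to
  \<open>c'\<close>, read off on the basis of \<open>E0\<close> and extended by 0 to the orthogonal
  complement. As an element of the normed space of bounded linear maps it can be said to depend
  continuously on \<open>p\<close>.\<close>

definition tangent_map :: "('p, 'e) chart \<Rightarrow> ('p, 'e) chart \<Rightarrow> 'p \<Rightarrow> 'e \<Rightarrow>\<^sub>L 'e" where
  "tangent_map c c' p = Blinfun (\<lambda>u. \<Sum>i<m. (u \<bullet> b i) *\<^sub>R
     vector_derivative (\<lambda>t. transition c c' (snd c p + t *\<^sub>R b i)) (at 0))"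

section \<open>The coordinate subspace \<open>E0\<close>\<close>

lemma b_Basis: "i < m \<Longrightarrow> b i \<in> Basis"
  using manifold by (auto simp: closed_connected_riemannian_manifold_def model_frame_def)

lemma b_inner: "i < m \<Longrightarrow> j < m \<Longrightarrow> b i \<bullet> b j = (if i = j then 1 else 0)"
  using manifold inner_Basis[OF b_Basis b_Basis, of i j]
  by (auto simp: closed_connected_riemannian_manifold_def model_frame_def inj_on_def)

lemma b_in_E0: "i < m \<Longrightarrow> b i \<in> E0"
  by (auto simp: model_space_def intro: span_base)

lemma subspace_E0: "subspace E0"
  by (simp add: model_space_def)

lemma closed_E0: "closed E0"
  by (simp add: closed_subspace subspace_E0)

lemma E0_expand: "u \<in> E0 \<Longrightarrow> u = (\<Sum>i<m. (u \<bullet> b i) *\<^sub>R b i)"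
  unfolding model_space_def
proof (induction rule: span_induct_alt)
  case base
  show ?case by simp
next
  case (step r x y)
  then obtain j where j: "j < m" "x = b j" by auto
  have "(\<Sum>i<m. ((r *\<^sub>R x + y) \<bullet> b i) *\<^sub>R b i) =
      (\<Sum>i<m. (r * (x \<bullet> b i)) *\<^sub>R b i) + (\<Sum>i<m. (y \<bullet> b i) *\<^sub>R b i)"
    by (simp add: inner_add_left scaleR_add_left sum.distrib)
  also have "(\<Sum>i<m. (r * (x \<bullet> b i)) *\<^sub>R b i) = (\<Sum>i<m. if i = j then r *\<^sub>R x else 0)"
    using j by (intro sum.cong) (auto simp: b_inner)
  finally show ?case using step j by simp
qed

lemma model_point_in_E0: "model_point m b z \<in> E0"
  unfolding model_point_def
  by (intro subspace_sum[OF subspace_E0] subspace_scale[OF subspace_E0] b_in_E0) auto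

lemma model_point_inner: "i < m \<Longrightarrow> model_point m b z \<bullet> b i = z i"
proof -
  assume i: "i < m"
  have "model_point m b z \<bullet> b i = (\<Sum>j<m. z j * (b j \<bullet> b i))"
    by (simp add: model_point_def inner_sum_left)
  also have "\<dots> = (\<Sum>j<m. if j = i then z j else 0)"
    using i by (intro sum.cong) (auto simp: b_inner)
  finally show ?thesis using i by simp
qed

section \<open>Charts and their inverses\<close>

lemma charts_cover: obtains c where "c \<in> A" "p \<in> fst c"
  using manifold unfolding closed_connected_riemannian_manifold_def smooth_atlas_def by blast

lemma open_chart: "c \<in> A \<Longrightarrow> open (fst c)"
  using manifold unfolding closed_connected_riemannian_manifold_def smooth_atlas_def by blast

lemma openin_chart_image: "c \<in> A \<Longrightarrow> openin (top_of_set E0) (snd c ` fst c)"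
  using manifold unfolding closed_connected_riemannian_manifold_def smooth_atlas_def by blast

lemma chart_homeomorphism: "c \<in> A \<Longrightarrow> homeomorphism (fst c) (snd c ` fst c) (snd c) (chart_inv c)"
proof -
  assume "c \<in> A"
  then obtain \<psi> where h: "homeomorphism (fst c) (snd c ` fst c) (snd c) \<psi>"
    using manifold unfolding closed_connected_riemannian_manifold_def smooth_atlas_def by blast
  have inj: "inj_on (snd c) (fst c)"
    using h by (intro inj_on_inverseI[where g = \<psi>]) (simp add: homeomorphism_apply1)
  show ?thesis
  proof (rule homeomorphism_cong[OF h])
    fix y assume "y \<in> snd c ` fst c"
    then obtain p where "p \<in> fst c" "y = snd c p" by blast
    thus "chart_inv c y = \<psi> y"
      using homeomorphism_apply1[OF h] inj by (simp add: chart_inv_def the_inv_into_f_f)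
  qed auto
qed

lemma chart_inv_chart [simp]: "c \<in> A \<Longrightarrow> p \<in> fst c \<Longrightarrow> chart_inv c (snd c p) = p"
  by (meson chart_homeomorphism homeomorphism_apply1)

lemma chart_chart_inv [simp]: "c \<in> A \<Longrightarrow> y \<in> snd c ` fst c \<Longrightarrow> snd c (chart_inv c y) = y"
  by (meson chart_homeomorphism homeomorphism_apply2)

lemma chart_inv_in [simp]: "c \<in> A \<Longrightarrow> y \<in> snd c ` fst c \<Longrightarrow> chart_inv c y \<in> fst c"
  by auto

lemma continuous_on_chart: "c \<in> A \<Longrightarrow> continuous_on (fst c) (snd c)"
  by (meson chart_homeomorphism homeomorphism_cont1)

lemma continuous_on_chart_inv: "c \<in> A \<Longrightarrow> continuous_on (snd c ` fst c) (chart_inv c)"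
  by (meson chart_homeomorphism homeomorphism_cont2)

lemma chart_image_subset: "c \<in> A \<Longrightarrow> snd c ` fst c \<subseteq> E0"
  using openin_chart_image openin_imp_subset by fastforce

lemma chart_in_E0: "c \<in> A \<Longrightarrow> p \<in> fst c \<Longrightarrow> snd c p \<in> E0"
  by (rule subsetD[OF chart_image_subset imageI])

lemma transition_chart: "c \<in> A \<Longrightarrow> p \<in> fst c \<Longrightarrow> transition c c' (snd c p) = snd c' p"
  using chart_inv_chart by (simp add: transition_def chart_inv_def)

lemma openin_chart_overlap:
  assumes "c \<in> A" "open N" shows "openin (top_of_set E0) (snd c ` (fst c \<inter> N))"
proof -
  have "openin (top_of_set (fst c)) (fst c \<inter> N)"
    using assms by (simp add: openin_open_Int)
  hence "openin (top_of_set (snd c ` fst c)) (snd c ` (fst c \<inter> N))"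
    using homeomorphism_imp_open_map[OF chart_homeomorphism[OF assms(1)]] by blast
  thus ?thesis using openin_chart_image[OF assms(1)] openin_trans by blast
qed

lemma chart_ball:
  assumes "c \<in> A" "open N" "p \<in> fst c" "p \<in> N"
  obtains \<rho> where "\<rho> > 0" "cball (snd c p) \<rho> \<inter> E0 \<subseteq> snd c ` (fst c \<inter> N)"
proof -
  obtain O' where O': "open O'" "snd c ` (fst c \<inter> N) = E0 \<inter> O'"
    using openin_chart_overlap[OF assms(1,2)] by (auto simp: openin_open)
  have "snd c p \<in> O'" using O' assms by blast
  then obtain \<rho> where "\<rho> > 0" "cball (snd c p) \<rho> \<subseteq> O'"
    using O'(1) open_contains_cball by blast
  thus ?thesis using that[of \<rho>] O' by auto
qed

text \<open>A transition map lives on a subset of \<open>E0\<close> that need not be open in the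
  ambient space, so Frechet derivatives are taken of a local extension \<open>F\<close>. The set
  \<open>S\<close> is shrunk until its part in \<open>E0\<close> lies in the overlap, where
  \<open>transition\<close> is meaningful.\<close>

lemma transition_local_extension:
  assumes c: "c \<in> A" "c' \<in> A" "p \<in> fst c" "p \<in> fst c'"
  obtains N S F where "open N" "p \<in> N" "N \<subseteq> fst c \<inter> fst c'" "open S" "snd c ` N \<subseteq> S"
    "\<And>q. q \<in> N \<Longrightarrow> snd c' q = F (snd c q)" "F differentiable_on S"
    "\<And>v. continuous_on S (\<lambda>x. frechet_derivative F (at x) v)"
    "\<And>y. y \<in> S \<Longrightarrow> y \<in> E0 \<Longrightarrow> y \<in> snd c ` (fst c \<inter> fst c') \<and> transition c c' y = F y"
proof -
  let ?X = "snd c ` (fst c \<inter> fst c')"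
  have "smooth_on ?X (transition c c')"
    using manifold c unfolding closed_connected_riemannian_manifold_def smooth_atlas_def by blast
  moreover have "snd c p \<in> ?X" using c by blast
  ultimately obtain S0 F where S0: "open S0" "snd c p \<in> S0" "\<And>k. Ck_on k S0 F"
      "\<forall>y\<in>?X \<inter> S0. F y = transition c c' y"
    unfolding smooth_on_def by blast
  obtain O' where O': "open O'" "?X = E0 \<inter> O'"
    using openin_chart_overlap[OF c(1) open_chart[OF c(2)]] by (auto simp: openin_open)
  define S where "S = S0 \<inter> O'"
  define N where "N = fst c' \<inter> (snd c -` S \<inter> fst c)"
  have S: "open S" using S0 O' by (auto simp: S_def)
  have sub: "S \<subseteq> S0" by (auto simp: S_def)
  have N: "open N"
    using continuous_on_open_vimage[OF open_chart[OF c(1)], of "snd c"] continuous_on_chart[OF c(1)]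
      S open_chart[OF c(2)] by (auto simp: N_def intro: open_Int)
  have C1: "Ck_on (Suc 0) S0 F" using S0(3) .
  have F: "F differentiable_on S" "continuous_on S (\<lambda>x. frechet_derivative F (at x) v)" for v
    using C1 sub by (auto intro: differentiable_on_subset continuous_on_subset)
  have X: "y \<in> ?X \<and> transition c c' y = F y" if "y \<in> S" "y \<in> E0" for y
    using that O' S0(4) sub by (auto simp: S_def)
  show ?thesis
  proof (rule that[of N S F])
    show "p \<in> N" using c S0 O' by (auto simp: N_def S_def)
    show "snd c' q = F (snd c q)" if "q \<in> N" for q
      using that X[of "snd c q"] chart_in_E0[OF c(1), of q] transition_chart[OF c(1), of q c']
      by (auto simp: N_def)
  qed (use N S F X in \<open>auto simp: N_def\<close>)
qed

section \<open>Derivatives of transition maps\<close>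

lemma bounded_linear_tangent_sum:
  "bounded_linear (\<lambda>u. \<Sum>i<m. (u \<bullet> b i) *\<^sub>R (w i :: 'b::real_normed_vector))"
  by (intro bounded_linear_sum bounded_linear_scaleR_left[THEN bounded_linear_compose] bounded_linear_inner_left)

lemma tangent_map_apply: "blinfun_apply (tangent_map c c' p) u = (\<Sum>i<m. (u \<bullet> b i) *\<^sub>R
     vector_derivative (\<lambda>t. transition c c' (snd c p + t *\<^sub>R b i)) (at 0))"
  unfolding tangent_map_def by (subst bounded_linear_Blinfun_apply[OF bounded_linear_tangent_sum]) simp

text \<open>A line in direction \<open>b i\<close> stays in \<open>E0\<close>, where transition and
  extension agree. So each basis derivative in \<open>tangent_map\<close> is one of
  \<open>F\<close>, and linearity does the rest.\<close>

lemma tangent_map_frechet: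
  assumes "c \<in> A" "p \<in> N" "N \<subseteq> fst c" "open S" "snd c ` N \<subseteq> S" "F differentiable_on S" "u \<in> E0"
    "\<And>y. y \<in> S \<Longrightarrow> y \<in> E0 \<Longrightarrow> transition c c' y = F y"
  shows "tangent_map c c' p u = frechet_derivative F (at (snd c p)) u"
proof -
  let ?y = "snd c p"
  have y: "?y \<in> S" "?y \<in> E0" using assms(1-5) by (blast intro: chart_in_E0)+
  have F: "(F has_derivative frechet_derivative F (at ?y)) (at ?y)"
    using assms(4,6) y(1) by (simp add: differentiable_on_eq_differentiable_at flip: frechet_derivative_works)
  have lin: "linear (frechet_derivative F (at ?y))" using F has_derivative_linear by blast
  have "vector_derivative (\<lambda>t. transition c c' (?y + t *\<^sub>R b i)) (at 0) = frechet_derivative F (at ?y) (b i)"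
    if "i < m" for i
  proof -
    have "((\<lambda>t. ?y + t *\<^sub>R b i) has_vector_derivative b i) (at 0)"
      by (auto intro!: derivative_eq_intros)
    hence 1: "((\<lambda>t. F (?y + t *\<^sub>R b i)) has_vector_derivative frechet_derivative F (at ?y) (b i)) (at 0)"
      by (rule has_vector_derivative_compose) (use F in simp)
    have "open ((\<lambda>t. ?y + t *\<^sub>R b i) -` S)"
      using assms(4) by (intro open_vimage continuous_intros)
    moreover have "F (?y + t *\<^sub>R b i) = transition c c' (?y + t *\<^sub>R b i)" if "?y + t *\<^sub>R b i \<in> S" for t
      using assms(8)[OF that] y(2) b_in_E0[OF \<open>i < m\<close>]
      by (simp add: subspace_E0 subspace_add subspace_scale)
    ultimately show ?thesis
      using y(1) by (intro vector_derivative_at has_vector_derivative_transform_within_open[OF 1, of "(\<lambda>t. ?y + t *\<^sub>R b i) -` S"]) simp_all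
  qed
  hence "tangent_map c c' p u = (\<Sum>i<m. (u \<bullet> b i) *\<^sub>R frechet_derivative F (at ?y) (b i))"
    by (simp add: tangent_map_apply)
  also have "\<dots> = frechet_derivative F (at ?y) (\<Sum>i<m. (u \<bullet> b i) *\<^sub>R b i)"
    by (simp add: linear_sum[OF lin] linear_scale[OF lin])
  finally show ?thesis using E0_expand[OF assms(7)] by simp
qed

lemma continuous_on_tangent_map:
  assumes c: "c \<in> A" "c' \<in> A"
  shows "continuous_on (fst c \<inter> fst c') (tangent_map c c')"
proof -
  have "continuous (at p within fst c \<inter> fst c') (tangent_map c c')" if p: "p \<in> fst c" "p \<in> fst c'" for p
  proof -
    obtain N S F where N: "open N" "p \<in> N" "N \<subseteq> fst c \<inter> fst c'" "open S" "snd c ` N \<subseteq> S"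
      and F: "F differentiable_on S" "\<And>v. continuous_on S (\<lambda>x. frechet_derivative F (at x) v)"
        "\<And>y. y \<in> S \<Longrightarrow> y \<in> E0 \<Longrightarrow> transition c c' y = F y"
      using transition_local_extension[OF c p] by metis
    have "continuous_on N (tangent_map c c')"
    proof (rule continuous_on_blinfun_componentwise)
      fix v :: 'e
      \<comment> \<open>Continuity in operator norm may be tested on single vectors, as the
        dimension is finite. Since \<open>tangent_map\<close> vanishes on the complement of
        \<open>E0\<close>, the vector \<open>v\<close> may be replaced by its projection
        \<open>u\<close>, whose image is a derivative of \<open>F\<close>.\<close>
      define u where "u = (\<Sum>i<m. (v \<bullet> b i) *\<^sub>R b i)"
      have u: "u \<in> E0"
        unfolding u_def by (intro subspace_sum[OF subspace_E0] subspace_scale[OF subspace_E0] b_in_E0) auto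
      have "u \<bullet> b i = v \<bullet> b i" if "i < m" for i
        using model_point_inner[OF that, of "\<lambda>i. v \<bullet> b i"] by (simp add: u_def model_point_def)
      hence "tangent_map c c' q v = tangent_map c c' q u" for q
        by (simp add: tangent_map_apply)
      hence eq: "tangent_map c c' q v = frechet_derivative F (at (snd c q)) u" if "q \<in> N" for q
        using tangent_map_frechet[OF c(1) that _ N(4,5) F(1) u F(3)] N(3) by auto
      have "continuous_on N (\<lambda>q. frechet_derivative F (at (snd c q)) u)"
        using continuous_on_compose2[OF F(2) continuous_on_subset[OF continuous_on_chart[OF c(1)]] N(5)] N(3)
        by auto
      thus "continuous_on N (\<lambda>q. tangent_map c c' q v)"
        by (rule continuous_on_eq) (simp add: eq)
    qed
    thus ?thesis
      using N(1,2) by (simp add: continuous_on_eq_continuous_at continuous_at_imp_continuous_at_within)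
  qed
  thus ?thesis by (simp add: continuous_on_eq_continuous_within)
qed

text \<open>The chain rule for the extension \<open>F\<close>. Here w \<in> E0 matters: off
  \<open>E0\<close> the derivative of \<open>F\<close> depends on the chosen extension.\<close>

lemma chart_change_derivative:
  fixes \<sigma> :: "real \<Rightarrow> 'p"
  assumes c: "c \<in> A" "c' \<in> A" "\<sigma> t \<in> fst c" "\<sigma> t \<in> fst c'" and cont: "continuous (at t within I) \<sigma>"
    and d: "((\<lambda>s. snd c (\<sigma> s)) has_vector_derivative w) (at t within I)" and w: "w \<in> E0" and t: "t \<in> I"
  shows "((\<lambda>s. snd c' (\<sigma> s)) has_vector_derivative tangent_map c c' (\<sigma> t) w) (at t within I)"
proof -
  obtain N S F where N: "open N" "\<sigma> t \<in> N" "N \<subseteq> fst c \<inter> fst c'" "open S" "snd c ` N \<subseteq> S"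
    and eq: "\<And>q. q \<in> N \<Longrightarrow> snd c' q = F (snd c q)"
    and F: "F differentiable_on S" "\<And>y. y \<in> S \<Longrightarrow> y \<in> E0 \<Longrightarrow> transition c c' y = F y"
    using transition_local_extension[OF c] by metis
  let ?y = "snd c (\<sigma> t)"
  have "(F has_derivative frechet_derivative F (at ?y)) (at ?y)"
    using N F(1) by (auto simp: differentiable_on_eq_differentiable_at subset_eq simp flip: frechet_derivative_works)
  hence "((\<lambda>s. F (snd c (\<sigma> s))) has_vector_derivative frechet_derivative F (at ?y) w) (at t within I)"
    by (rule has_vector_derivative_compose[OF d])
  moreover have "frechet_derivative F (at ?y) w = tangent_map c c' (\<sigma> t) w"
    using tangent_map_frechet[OF c(1) N(2) _ N(4,5) F(1) w F(2)] N(3) by auto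
  moreover have "\<forall>\<^sub>F s in at t within I. \<sigma> s \<in> N"
    using cont N(1,2) by (metis continuous_within topological_tendstoD)
  hence "\<forall>\<^sub>F s in at t within I. F (snd c (\<sigma> s)) = snd c' (\<sigma> s)"
    by eventually_elim (simp add: eq)
  ultimately show ?thesis
    using has_derivative_transform_eventually[of "\<lambda>s. F (snd c (\<sigma> s))" _ t I] eq[OF N(2)] t
    unfolding has_vector_derivative_def by metis
qed

text \<open>The difference quotients lie in \<open>E0\<close>, which is closed.\<close>

lemma vector_derivative_in_E0:
  assumes "(f has_vector_derivative w) (at t within I)" "at t within I \<noteq> bot" "t \<in> I"
    "\<forall>\<^sub>F s in at t within I. f s \<in> E0" "f t \<in> E0"
  shows "w \<in> E0"
proof (rule Lim_in_closed_set[OF closed_E0])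
  have "((\<lambda>s. norm ((f s - f t) - (s - t) *\<^sub>R w) / norm (s - t)) \<longlongrightarrow> 0) (at t within I)"
    using assms(1) unfolding has_vector_derivative_def has_derivative_iff_norm by blast
  moreover have "\<forall>\<^sub>F s in at t within I.
      norm ((f s - f t) - (s - t) *\<^sub>R w) / norm (s - t) = norm ((f s - f t) /\<^sub>R (s - t) - w)"
  proof (unfold eventually_at_filter, intro always_eventually allI impI)
    fix s assume "s \<noteq> t"
    hence "(f s - f t) /\<^sub>R (s - t) - w = ((f s - f t) - (s - t) *\<^sub>R w) /\<^sub>R (s - t)"
      by (simp add: scaleR_diff_right)
    thus "norm ((f s - f t) - (s - t) *\<^sub>R w) / norm (s - t) = norm ((f s - f t) /\<^sub>R (s - t) - w)"
      by (simp add: divide_inverse_commute)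
  qed
  ultimately have "((\<lambda>s. norm ((f s - f t) /\<^sub>R (s - t) - w)) \<longlongrightarrow> 0) (at t within I)"
    using tendsto_cong by force
  thus "((\<lambda>s. (f s - f t) /\<^sub>R (s - t)) \<longlongrightarrow> w) (at t within I)"
    by (simp add: tendsto_norm_zero_iff LIM_zero_iff)
  show "\<forall>\<^sub>F s in at t within I. (f s - f t) /\<^sub>R (s - t) \<in> E0"
    using assms(4) by eventually_elim (use assms(5) in \<open>simp add: subspace_E0 subspace_diff subspace_scale\<close>)
qed (use assms in auto)

lemma coordinate_line:
  assumes "c \<in> A" "p \<in> fst c" "u \<in> E0"
  obtains \<delta> where "\<delta> > 0" "\<And>s. \<bar>s\<bar> < \<delta> \<Longrightarrow> snd c p + s *\<^sub>R u \<in> snd c ` fst c"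
    "continuous_on {-\<delta><..<\<delta>} (\<lambda>s. chart_inv c (snd c p + s *\<^sub>R u))"
proof -
  obtain \<rho> where \<rho>: "\<rho> > 0" "cball (snd c p) \<rho> \<inter> E0 \<subseteq> snd c ` (fst c \<inter> UNIV)"
    using chart_ball[OF assms(1) open_UNIV assms(2)] by auto
  \<comment> \<open>The summand 1 covers \<open>u = 0\<close>.\<close>
  define \<delta> where "\<delta> = \<rho> / (norm u + 1)"
  have \<delta>: "\<delta> > 0" unfolding \<delta>_def using \<rho>(1) by (intro divide_pos_pos) (auto intro: add_nonneg_pos)
  have in_im: "snd c p + s *\<^sub>R u \<in> snd c ` fst c" if "\<bar>s\<bar> < \<delta>" for s
  proof -
    have "norm (s *\<^sub>R u) \<le> \<delta> * (norm u + 1)"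
      using that by (auto intro!: mult_mono)
    also have "\<dots> = \<rho>" unfolding \<delta>_def by (simp add: add_nonneg_eq_0_iff)
    finally have "snd c p + s *\<^sub>R u \<in> cball (snd c p) \<rho>" by (simp add: dist_norm)
    moreover have "snd c p + s *\<^sub>R u \<in> E0"
      using assms chart_in_E0 by (simp add: subspace_E0 subspace_add subspace_scale)
    ultimately show ?thesis using \<rho>(2) by auto
  qed
  show ?thesis
    by (rule that[OF \<delta> in_im])
      (auto intro!: continuous_on_compose2[OF continuous_on_chart_inv[OF assms(1)]] continuous_intros in_im)
qed

lemma tangent_map_self:
  assumes "c \<in> A" "p \<in> fst c" "u \<in> E0"
  shows "tangent_map c c p u = u"
proof -
  have "vector_derivative (\<lambda>t. transition c c (snd c p + t *\<^sub>R b i)) (at 0) = b i" if i: "i < m" for i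
  proof -
    have 1: "((\<lambda>t. snd c p + t *\<^sub>R b i) has_vector_derivative b i) (at 0)"
      by (auto intro!: derivative_eq_intros)
    obtain \<delta> where \<delta>: "\<delta> > 0" "\<And>s. \<bar>s\<bar> < \<delta> \<Longrightarrow> snd c p + s *\<^sub>R b i \<in> snd c ` fst c"
      using coordinate_line[OF assms(1,2) b_in_E0[OF i]] by metis
    have "transition c c (snd c p + s *\<^sub>R b i) = snd c p + s *\<^sub>R b i" if "s \<in> {-\<delta><..<\<delta>}" for s
    proof -
      have "snd c p + s *\<^sub>R b i \<in> snd c ` fst c" using \<delta>(2)[of s] that by (simp add: abs_less_iff)
      thus ?thesis using transition_chart[OF assms(1), of _ c] by auto
    qed
    thus ?thesis using \<delta>(1)
      by (intro vector_derivative_at has_vector_derivative_transform_within_open[OF 1, of "{-\<delta><..<\<delta>}"]) simp_all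
  qed
  hence "tangent_map c c p u = (\<Sum>i<m. (u \<bullet> b i) *\<^sub>R b i)" by (simp add: tangent_map_apply)
  thus ?thesis using E0_expand[OF assms(3)] by simp
qed

lemma coordinate_line_derivative:
  assumes c: "c \<in> A" "c' \<in> A" "p \<in> fst c" "p \<in> fst c'" and u: "u \<in> E0"
  shows "((\<lambda>t. snd c' (chart_inv c (snd c p + t *\<^sub>R u))) has_vector_derivative tangent_map c c' p u) (at 0)"
proof -
  obtain \<delta> where \<delta>: "\<delta> > 0" "\<And>s. \<bar>s\<bar> < \<delta> \<Longrightarrow> snd c p + s *\<^sub>R u \<in> snd c ` fst c"
    "continuous_on {-\<delta><..<\<delta>} (\<lambda>s. chart_inv c (snd c p + s *\<^sub>R u))"
    using coordinate_line[OF c(1,3) u] by metis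
  let ?\<sigma> = "\<lambda>s. chart_inv c (snd c p + s *\<^sub>R u)"
  have \<sigma>0: "?\<sigma> 0 = p" using c by simp
  have "((\<lambda>s. snd c p + s *\<^sub>R u) has_vector_derivative u) (at 0)"
    by (auto intro!: derivative_eq_intros)
  hence d: "((\<lambda>s. snd c (?\<sigma> s)) has_vector_derivative u) (at 0)"
    by (rule has_vector_derivative_transform_within_open[of _ _ _ "{-\<delta><..<\<delta>}"])
       (use \<delta> c in auto)
  have "continuous (at 0) ?\<sigma>"
    using \<delta>(1,3) by (simp add: continuous_on_eq_continuous_at)
  from chart_change_derivative[of c c' ?\<sigma> 0 UNIV u] this d u c show ?thesis
    unfolding \<sigma>0 by simp
qed

lemma transition_line_derivative:
  assumes "c \<in> A" "c' \<in> A" "p \<in> fst c" "p \<in> fst c'" "u \<in> E0"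
  shows "((\<lambda>t. transition c c' (snd c p + t *\<^sub>R u)) has_vector_derivative tangent_map c c' p u) (at 0)"
  using coordinate_line_derivative[OF assms] by (simp add: transition_def chart_inv_def)

lemma coordinate_line_continuous:
  assumes "c \<in> A" "p \<in> fst c" "u \<in> E0"
  shows "isCont (\<lambda>t. chart_inv c (snd c p + t *\<^sub>R u)) 0"
    "\<forall>\<^sub>F t in at 0. snd c p + t *\<^sub>R u \<in> snd c ` fst c"
proof -
  obtain \<delta> where \<delta>: "\<delta> > 0" "\<And>s. \<bar>s\<bar> < \<delta> \<Longrightarrow> snd c p + s *\<^sub>R u \<in> snd c ` fst c"
    "continuous_on {-\<delta><..<\<delta>} (\<lambda>s. chart_inv c (snd c p + s *\<^sub>R u))"
    using coordinate_line[OF assms] by metis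
  show "isCont (\<lambda>t. chart_inv c (snd c p + t *\<^sub>R u)) 0"
    using \<delta> by (simp add: continuous_on_eq_continuous_at)
  show "\<forall>\<^sub>F t in at 0. snd c p + t *\<^sub>R u \<in> snd c ` fst c"
    using \<delta> by (auto simp: eventually_at intro!: exI[of _ \<delta>])
qed

lemma tangent_map_in_E0:
  assumes c: "c \<in> A" "c' \<in> A" "p \<in> fst c" "p \<in> fst c'" and u: "u \<in> E0"
  shows "tangent_map c c' p u \<in> E0"
proof (rule vector_derivative_in_E0[OF coordinate_line_derivative[OF assms]])
  have "\<forall>\<^sub>F t in at 0. chart_inv c (snd c p + t *\<^sub>R u) \<in> fst c'"
    using coordinate_line_continuous(1)[OF c(1,3) u] c open_chart[OF c(2)]
    unfolding isCont_def by (intro topological_tendstoD) auto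
  thus "\<forall>\<^sub>F t in at 0. snd c' (chart_inv c (snd c p + t *\<^sub>R u)) \<in> E0"
    by eventually_elim (use c chart_in_E0 in auto)
qed (use c chart_in_E0 in auto)

text \<open>Both sides are the velocity, seen in \<open>c''\<close>, of the coordinate line of
  \<open>c\<close> with direction \<open>u\<close>.\<close>

lemma tangent_map_compose:
  assumes c: "c \<in> A" "c' \<in> A" "c'' \<in> A" "p \<in> fst c" "p \<in> fst c'" "p \<in> fst c''" and u: "u \<in> E0"
  shows "tangent_map c' c'' p (tangent_map c c' p u) = tangent_map c c'' p u"
proof -
  let ?\<sigma> = "\<lambda>t. chart_inv c (snd c p + t *\<^sub>R u)"
  have \<sigma>0: "?\<sigma> 0 = p" using c by simp
  have "((\<lambda>s. snd c'' (?\<sigma> s)) has_vector_derivative tangent_map c' c'' (?\<sigma> 0) (tangent_map c c' p u)) (at 0)"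
    using coordinate_line_continuous(1)[OF c(1,4) u] coordinate_line_derivative[of c c' p u] c u
    by (intro chart_change_derivative tangent_map_in_E0) (simp_all add: \<sigma>0)
  thus ?thesis
    using coordinate_line_derivative[of c c'' p u] c u \<sigma>0 vector_derivative_unique_at by metis
qed

section \<open>Coordinate vectors and the tangent space\<close>

lemma coordinate_vector_apply:
  assumes "c \<in> A" "c' \<in> A" "p \<in> fst c" "p \<in> fst c'" "u \<in> E0"
  shows "coordinate_vector A c p u c' = tangent_map c c' p u"
  using transition_line_derivative[OF assms] assms
  by (simp add: coordinate_vector_def vector_derivative_at)

lemma coordinate_vector_self [simp]:
  assumes "c \<in> A" "p \<in> fst c" "u \<in> E0"
  shows "coordinate_vector A c p u c = u"
  using coordinate_vector_apply[OF assms(1) assms(1) assms(2) assms(2) assms(3)] tangent_map_self[OF assms] by simp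

lemma coordinate_vector_outside: "\<not> (c' \<in> A \<and> p \<in> fst c') \<Longrightarrow> coordinate_vector A c p u c' = 0"
  by (auto simp: coordinate_vector_def)

text \<open>Turns the derivative condition of \<open>tangent_space\<close> into a linear relation
  between the components, which is easier to verify for sums, multiples and velocities.\<close>

lemma tangent_spaceI:
  assumes "\<And>c. c \<in> A \<Longrightarrow> p \<in> fst c \<Longrightarrow> v c \<in> E0" "\<And>c. \<not> (c \<in> A \<and> p \<in> fst c) \<Longrightarrow> v c = 0"
    "\<And>c c'. c \<in> A \<Longrightarrow> c' \<in> A \<Longrightarrow> p \<in> fst c \<Longrightarrow> p \<in> fst c' \<Longrightarrow> v c' = tangent_map c c' p (v c)"
  shows "v \<in> tangent_space m b A p"
  unfolding tangent_space_def mem_Collect_eq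
proof (intro conjI allI ballI impI)
  fix c c' assume c: "c \<in> A" "c' \<in> A" "p \<in> fst c \<and> p \<in> fst c'"
  show "((\<lambda>t. transition c c' (snd c p + t *\<^sub>R v c)) has_vector_derivative v c') (at 0)"
    using transition_line_derivative[OF c(1,2) _ _ assms(1)[OF c(1)]] assms(3)[OF c(1,2)] c(3) by simp
qed (simp add: assms(1,2))

lemma tangent_space_change:
  assumes "v \<in> tangent_space m b A p" "c \<in> A" "c' \<in> A" "p \<in> fst c" "p \<in> fst c'"
  shows "v c' = tangent_map c c' p (v c)"
proof -
  have "v c \<in> E0" "((\<lambda>t. transition c c' (snd c p + t *\<^sub>R v c)) has_vector_derivative v c') (at 0)"
    using assms unfolding tangent_space_def by (simp_all del: split_paired_All)
  thus ?thesis using transition_line_derivative[OF assms(2-5)] vector_derivative_unique_at by metis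
qed

lemma tangent_space_in_E0: "v \<in> tangent_space m b A p \<Longrightarrow> c \<in> A \<Longrightarrow> p \<in> fst c \<Longrightarrow> v c \<in> E0"
  by (auto simp: tangent_space_def)

lemma tangent_space_outside: "v \<in> tangent_space m b A p \<Longrightarrow> \<not> (c \<in> A \<and> p \<in> fst c) \<Longrightarrow> v c = 0"
  by (auto simp: tangent_space_def split: if_splits)

lemma coordinate_vector_in_tangent_space:
  assumes "c \<in> A" "p \<in> fst c" "u \<in> E0"
  shows "coordinate_vector A c p u \<in> tangent_space m b A p"
  by (rule tangent_spaceI)
    (use assms in \<open>auto simp: coordinate_vector_apply tangent_map_compose coordinate_vector_outside intro!: tangent_map_in_E0\<close>)

lemma tangent_space_eq_coordinate_vector:
  assumes "v \<in> tangent_space m b A p" "c \<in> A" "p \<in> fst c"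
  shows "v = coordinate_vector A c p (v c)"
proof
  fix c'
  show "v c' = coordinate_vector A c p (v c) c'"
    using assms tangent_space_change[OF assms(1,2) _ assms(3), of c'] tangent_space_in_E0[OF assms]
    by (cases "c' \<in> A \<and> p \<in> fst c'")
       (auto simp: coordinate_vector_apply coordinate_vector_outside tangent_space_outside)
qed

lemma tangent_space_eqI:
  assumes "v \<in> tangent_space m b A p" "w \<in> tangent_space m b A p" "c \<in> A" "p \<in> fst c" "v c = w c"
  shows "v = w"
  using tangent_space_eq_coordinate_vector assms by metis

lemma subspace_tangent_space: "subspace (tangent_space m b A p)"
  unfolding subspace_def
proof (intro conjI ballI allI)
  show "0 \<in> tangent_space m b A p"
    by (rule tangent_spaceI) (auto simp: subspace_E0 subspace_0 blinfun.zero_right)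
  fix v w r assume v: "v \<in> tangent_space m b A p"
  show "r *\<^sub>R v \<in> tangent_space m b A p"
  proof (rule tangent_spaceI)
    fix c c' assume c: "c \<in> A" "c' \<in> A" "p \<in> fst c" "p \<in> fst c'"
    show "(r *\<^sub>R v) c' = tangent_map c c' p ((r *\<^sub>R v) c)"
      by (simp add: scaleR_fun_def blinfun.scaleR_right tangent_space_change[OF v c])
  qed (simp_all add: scaleR_fun_def subspace_E0 subspace_scale tangent_space_in_E0[OF v] tangent_space_outside[OF v])
  assume w: "w \<in> tangent_space m b A p"
  show "v + w \<in> tangent_space m b A p"
  proof (rule tangent_spaceI)
    fix c c' assume c: "c \<in> A" "c' \<in> A" "p \<in> fst c" "p \<in> fst c'"
    show "(v + w) c' = tangent_map c c' p ((v + w) c)"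
      by (simp add: blinfun.add_right tangent_space_change[OF v c] tangent_space_change[OF w c])
  qed (simp_all add: subspace_E0 subspace_add tangent_space_in_E0[OF v] tangent_space_outside[OF v]
      tangent_space_in_E0[OF w] tangent_space_outside[OF w])
qed

lemma tangent_space_apply_image:
  assumes "c \<in> A" "p \<in> fst c"
  shows "(\<lambda>v. v c) ` tangent_space m b A p = E0"
proof
  show "E0 \<subseteq> (\<lambda>v. v c) ` tangent_space m b A p"
  proof
    fix u assume "u \<in> E0"
    thus "u \<in> (\<lambda>v. v c) ` tangent_space m b A p"
      using assms by (intro image_eqI[of _ _ "coordinate_vector A c p u"] coordinate_vector_in_tangent_space) simp_all
  qed
qed (use assms in \<open>auto intro: tangent_space_in_E0\<close>)

end

section \<open>A bump embedding of a ball\<close>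

lemma smooth_on_imp_continuous_on:
  assumes "smooth_on X f" shows "continuous_on X f"
  unfolding continuous_on_eq_continuous_within
proof
  fix x assume x: "x \<in> X"
  then obtain S F where S: "open S" "x \<in> S" "\<forall>k. Ck_on k S F" "\<forall>y\<in>X \<inter> S. F y = f y"
    using assms unfolding smooth_on_def by meson
  have "continuous_on S F" using S(3)[rule_format, of 0] by simp
  hence "continuous_on (X \<inter> S) F" by (rule continuous_on_subset) simp
  hence "continuous_on (X \<inter> S) f" by (rule continuous_on_eq) (simp add: S(4))
  hence "continuous (at x within X \<inter> S) f"
    using x S(2) by (simp add: continuous_on_eq_continuous_within)
  moreover have "at x within X \<inter> S = at x within X"
    by (rule at_within_nhd[OF S(2,1)]) auto
  ultimately show "continuous (at x within X) f" by simp
qed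

lemma sum_fun_eval: "(\<Sum>i\<in>I. f i) x = (\<Sum>i\<in>I. f i x)"
  by (induction I rule: infinite_finite_induct) simp_all

lemma inner_product_on_sum_left:
  assumes G: "inner_product_on T G" and T: "subspace T" and x: "\<And>i. i \<in> I \<Longrightarrow> x i \<in> T" and w: "w \<in> T"
  shows "G (\<Sum>i\<in>I. a i *\<^sub>R x i) w = (\<Sum>i\<in>I. a i * G (x i) w)"
proof -
  have add: "G (u + v) w = G u w + G v w" and scale: "G (r *\<^sub>R v) w = r * G v w" if "u \<in> T" "v \<in> T" for u v r
    using G w that unfolding inner_product_on_def by simp_all
  have "G (0 *\<^sub>R 0) w = 0" using scale[OF subspace_0[OF T] subspace_0[OF T], of 0] by simp
  hence z: "G 0 w = 0" by simp
  show ?thesis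
    using x
  proof (induction I rule: infinite_finite_induct)
    case (insert i I)
    have "(\<Sum>i\<in>I. a i *\<^sub>R x i) \<in> T"
      using insert.prems by (intro subspace_sum[OF T] subspace_scale[OF T]) simp
    moreover have "a i *\<^sub>R x i \<in> T" "x i \<in> T"
      using insert.prems by (simp_all add: subspace_scale[OF T])
    moreover have "G (\<Sum>i\<in>I. a i *\<^sub>R x i) w = (\<Sum>i\<in>I. a i * G (x i) w)"
      using insert.prems by (intro insert.IH) simp
    ultimately show ?case
      using insert.hyps by (simp add: add scale)
  qed (simp_all add: z)
qed

lemma inner_product_on_sum:
  assumes G: "inner_product_on T G" and T: "subspace T"
    and x: "\<And>i. i \<in> I \<Longrightarrow> x i \<in> T" and y: "\<And>j. j \<in> J \<Longrightarrow> y j \<in> T"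
  shows "G (\<Sum>i\<in>I. a i *\<^sub>R x i) (\<Sum>j\<in>J. c j *\<^sub>R y j) = (\<Sum>i\<in>I. \<Sum>j\<in>J. a i * c j * G (x i) (y j))"
proof -
  have sym: "G v w = G w v" if "v \<in> T" "w \<in> T" for v w
    using G that unfolding inner_product_on_def by blast
  have yT: "(\<Sum>j\<in>J. c j *\<^sub>R y j) \<in> T"
    using y by (intro subspace_sum[OF T] subspace_scale[OF T])
  have "G (\<Sum>i\<in>I. a i *\<^sub>R x i) (\<Sum>j\<in>J. c j *\<^sub>R y j) = (\<Sum>i\<in>I. a i * G (x i) (\<Sum>j\<in>J. c j *\<^sub>R y j))"
    by (rule inner_product_on_sum_left[OF G T x yT])
  also have "\<dots> = (\<Sum>i\<in>I. a i * (\<Sum>j\<in>J. c j * G (y j) (x i)))"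
  proof (rule sum.cong[OF refl])
    fix i assume i: "i \<in> I"
    have "G (x i) (\<Sum>j\<in>J. c j *\<^sub>R y j) = G (\<Sum>j\<in>J. c j *\<^sub>R y j) (x i)"
      by (rule sym[OF x[OF i] yT])
    also have "\<dots> = (\<Sum>j\<in>J. c j * G (y j) (x i))"
      by (rule inner_product_on_sum_left[OF G T y x[OF i]])
    finally show "a i * G (x i) (\<Sum>j\<in>J. c j *\<^sub>R y j) = a i * (\<Sum>j\<in>J. c j * G (y j) (x i))" by simp
  qed
  also have "\<dots> = (\<Sum>i\<in>I. \<Sum>j\<in>J. a i * c j * G (x i) (y j))"
    unfolding sum_distrib_left by (intro sum.cong refl) (simp add: mult_ac sym[OF y x])
  finally show ?thesis .
qed

lemma inner_product_on_zero:
  assumes "inner_product_on T G" "subspace T"  "w \<in> T" shows "G 0 w = 0" "G w 0 = 0"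
proof -
  show "G 0 w = 0" using inner_product_on_sum_left[OF assms(1,2) _ assms(3), of "{}"] by simp
  thus "G w 0 = 0" using assms subspace_0[OF assms(2)] unfolding inner_product_on_def by metis
qed

text \<open>The square smooths the kink of the positive part at 0; hence the squares in
  \<open>bump\<close>. At 0 the slope function in Caratheodory's criterion is \<open>max 0\<close>
  itself.\<close>

lemma has_real_derivative_max_sq:
  "((\<lambda>x::real. (max 0 x)\<^sup>2) has_real_derivative 2 * max 0 x) (at x)"
proof -
  consider "x > 0" | "x < 0" | "x = 0" by linarith
  thus ?thesis
  proof cases
    case 1
    have "((\<lambda>x::real. x\<^sup>2) has_real_derivative 2 * max 0 x) (at x)"
      using 1 by (auto intro!: derivative_eq_intros)
    thus ?thesis
      by (rule has_field_derivative_transform_within_open[of _ _ _ "{0<..}"]) (use 1 in auto)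
  next
    case 2
    have "((\<lambda>x::real. 0) has_real_derivative 2 * max 0 x) (at x)"
      using 2 by (auto intro!: derivative_eq_intros)
    thus ?thesis
      by (rule has_field_derivative_transform_within_open[of _ _ _ "{..<0}"]) (use 2 in auto)
  next
    case 3
    have "isCont (\<lambda>z::real. max 0 z) x" by (intro continuous_intros)
    moreover have "(max 0 z)\<^sup>2 - (max 0 x)\<^sup>2 = max 0 z * (z - x)" for z
      using 3 by (simp add: max_def power2_eq_square)
    ultimately show ?thesis using 3 unfolding CARAT_DERIV by (intro exI[of _ "\<lambda>z. max 0 z"]) simp
  qed
qed

text \<open>\<open>bump \<rho>\<close> is an embedding of the ball of radius \<open>\<rho>\<close> that extends by 0 to a C1 map.\<close>

definition bump :: "real \<Rightarrow> 'a::real_inner \<Rightarrow> real \<times> 'a" where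
  "bump \<rho> u = ((max 0 (\<rho>\<^sup>2 - u \<bullet> u))\<^sup>2, (max 0 (\<rho>\<^sup>2 - u \<bullet> u))\<^sup>2 *\<^sub>R u)"

definition bump_deriv :: "real \<Rightarrow> 'a::real_inner \<Rightarrow> 'a \<Rightarrow> real \<times> 'a" where
  "bump_deriv \<rho> u w = (let s = max 0 (\<rho>\<^sup>2 - u \<bullet> u) in
     (- (4 * s * (u \<bullet> w)), s\<^sup>2 *\<^sub>R w - (4 * s * (u \<bullet> w)) *\<^sub>R u))"

lemma has_vector_derivative_bump:
  fixes u :: "real \<Rightarrow> 'a::real_inner"
  assumes u: "(u has_vector_derivative w) (at t within I)"
  shows "((\<lambda>t. bump \<rho> (u t)) has_vector_derivative bump_deriv \<rho> (u t) w) (at t within I)"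
proof -
  have "((\<lambda>t. \<rho>\<^sup>2 - u t \<bullet> u t) has_vector_derivative - (2 * (u t \<bullet> w))) (at t within I)"
    using u unfolding has_vector_derivative_def
    by (auto intro!: derivative_eq_intros simp: inner_commute algebra_simps)
  hence "((\<lambda>t. \<rho>\<^sup>2 - u t \<bullet> u t) has_real_derivative - (2 * (u t \<bullet> w))) (at t within I)"
    by (simp add: has_real_derivative_iff_has_vector_derivative)
  from DERIV_chain2[OF has_real_derivative_max_sq this]
  have s: "((\<lambda>t. (max 0 (\<rho>\<^sup>2 - u t \<bullet> u t))\<^sup>2) has_real_derivative - (4 * max 0 (\<rho>\<^sup>2 - u t \<bullet> u t) * (u t \<bullet> w))) (at t within I)"
    by (simp add: mult_ac)
  show ?thesis
    unfolding bump_def bump_deriv_def Let_def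
    using has_vector_derivative_Pair[OF s[unfolded has_real_derivative_iff_has_vector_derivative]
        has_vector_derivative_scaleR[OF s u]]
    by (simp add: scaleR_minus_left)
qed

text \<open>On the ball, \<open>s\<close> is at most \<open>\<rho>\<^sup>2\<close> and
  \<open>norm u\<close> at most \<rho>: the first component contributes
  \<open>4 * \<rho> ^ 3\<close>, the second \<open>\<rho> ^ 4\<close> from \<open>s\<^sup>2\<close>
  and \<open>4 * \<rho> ^ 4\<close> from its derivative. Outside the ball everything is 0.\<close>

lemma norm_bump_deriv:
  assumes "\<rho> > 0"
  shows "norm (bump_deriv \<rho> u w) \<le> (4 * \<rho> ^ 3 + 5 * \<rho> ^ 4) * norm w"
proof (cases "u \<bullet> u < \<rho>\<^sup>2")
  case True
  define s where "s = \<rho>\<^sup>2 - u \<bullet> u"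
  have s: "0 \<le> s" "s \<le> \<rho>\<^sup>2" using True by (auto simp: s_def)
  have nu: "norm u \<le> \<rho>" using True assms by (intro norm_le_square[THEN iffD2]) auto
  have 1: "\<bar>4 * s * (u \<bullet> w)\<bar> \<le> 4 * \<rho>\<^sup>2 * (\<rho> * norm w)"
  proof -
    have "\<bar>u \<bullet> w\<bar> \<le> \<rho> * norm w"
      using Cauchy_Schwarz_ineq2[of u w] nu by (meson mult_right_mono norm_ge_zero order_trans)
    thus ?thesis unfolding abs_mult using s by (intro mult_mono) auto
  qed
  have "norm (bump_deriv \<rho> u w) \<le> norm (4 * s * (u \<bullet> w)) + norm (s\<^sup>2 *\<^sub>R w - (4 * s * (u \<bullet> w)) *\<^sub>R u)"
    using s norm_Pair_le[of "- (4 * s * (u \<bullet> w))" "s\<^sup>2 *\<^sub>R w - (4 * s * (u \<bullet> w)) *\<^sub>R u"]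
    by (simp add: bump_deriv_def s_def[symmetric] Let_def)
  also have "\<dots> \<le> \<bar>4 * s * (u \<bullet> w)\<bar> + (s\<^sup>2 * norm w + \<bar>4 * s * (u \<bullet> w)\<bar> * norm u)"
    using norm_triangle_ineq4[of "s\<^sup>2 *\<^sub>R w" "(4 * s * (u \<bullet> w)) *\<^sub>R u"] by simp
  also have "\<dots> \<le> 4 * \<rho>\<^sup>2 * (\<rho> * norm w) + ((\<rho>\<^sup>2)\<^sup>2 * norm w + 4 * \<rho>\<^sup>2 * (\<rho> * norm w) * \<rho>)"
    using 1 s nu assms by (intro add_mono mult_mono power_mono mult_nonneg_nonneg) auto
  also have "\<dots> = (4 * \<rho> ^ 3 + 5 * \<rho> ^ 4) * norm w"
    by (simp add: algebra_simps power2_eq_square power3_eq_cube power4_eq_xxxx)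
  finally show ?thesis .
next
  case False
  thus ?thesis using assms by (simp add: bump_deriv_def max_absorb1)
qed

lemma bump_eq_0: "\<rho> > 0 \<Longrightarrow> norm u > \<rho> \<Longrightarrow> bump \<rho> u = 0"
proof -
  assume "\<rho> > 0" "norm u > \<rho>"
  hence "\<rho>\<^sup>2 \<le> u \<bullet> u"
    by (simp add: dot_square_norm power_mono)
  thus ?thesis by (simp add: bump_def max_absorb1 zero_prod_def)
qed

text \<open>In the ball of radius \<open>\<rho> / 4\<close> the base of the square is at least
  \<open>15 / 16 * \<rho>\<^sup>2\<close>, and 225 / 256 exceeds 1 / 2. The bound leaves room for a
  perturbation by \<open>\<rho> ^ 4 / 4\<close>, after which the value is still bounded away from
  0.\<close>

lemma fst_bump_ge:
  assumes "\<rho> > 0" "norm u < \<rho> / 4"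
  shows "fst (bump \<rho> u) \<ge> \<rho> ^ 4 / 2"
proof -
  have "(norm u)\<^sup>2 \<le> (\<rho> / 4)\<^sup>2" using assms by (intro power_mono) auto
  hence "15 / 16 * \<rho>\<^sup>2 \<le> \<rho>\<^sup>2 - u \<bullet> u" by (simp add: dot_square_norm power_divide)
  hence 1: "15 / 16 * \<rho>\<^sup>2 \<le> max 0 (\<rho>\<^sup>2 - u \<bullet> u)" by (rule max.coboundedI2)
  moreover have "15 / 16 * \<rho>\<^sup>2 \<ge> 0" by simp
  ultimately have "(max 0 (\<rho>\<^sup>2 - u \<bullet> u))\<^sup>2 \<ge> (15 / 16 * \<rho>\<^sup>2)\<^sup>2"
    using 1 by (intro power_mono) auto
  moreover have "(15 / 16 * \<rho>\<^sup>2)\<^sup>2 = 225 / 256 * \<rho> ^ 4" by (simp add: power_mult_distrib power_divide)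
  moreover have "225 / 256 * \<rho> ^ 4 \<ge> \<rho> ^ 4 / 2" using assms(1) by simp
  ultimately show ?thesis unfolding bump_def fst_conv by linarith
qed

text \<open>The first component \<open>a\<close> is a factor of the second, so the vector is
  recovered by division. Nothing is assumed on the position of \<open>v\<close>: closeness of the
  values forces \<open>a'\<close> to be at least \<open>\<rho> ^ 4 / 4\<close>. The estimate is that
  of \<open>a' *\<^sub>R (u - v)\<close>, written as the difference of the second components minus
  \<open>(a - a') *\<^sub>R u\<close>.\<close>

lemma bump_expands:
  fixes u v :: "'a::real_inner"
  assumes "\<rho> > 0" "norm u < \<rho> / 4" "norm (bump \<rho> u - bump \<rho> v) < \<rho> ^ 4 / 4"
  shows "norm (u - v) \<le> 4 / \<rho> ^ 4 * (1 + \<rho>) * norm (bump \<rho> u - bump \<rho> v)"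
proof -
  define a where "a = fst (bump \<rho> u)"
  define a' where "a' = fst (bump \<rho> v)"
  define D where "D = norm (bump \<rho> u - bump \<rho> v)"
  have b: "bump \<rho> u = (a, a *\<^sub>R u)" "bump \<rho> v = (a', a' *\<^sub>R v)" by (simp_all add: bump_def a_def a'_def)
  have D1: "\<bar>a - a'\<bar> \<le> D" and D2: "norm (a *\<^sub>R u - a' *\<^sub>R v) \<le> D"
    using norm_fst_le[of "a - a'" "a *\<^sub>R u - a' *\<^sub>R v"] norm_snd_le[of "a *\<^sub>R u - a' *\<^sub>R v" "a - a'"]
    by (simp_all add: D_def b)
  have a': "a' \<ge> \<rho> ^ 4 / 4"
    using fst_bump_ge[OF assms(1,2)] D1 assms(3) unfolding a_def[symmetric] D_def[symmetric] by linarith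
  have pos: "\<rho> ^ 4 / 4 > 0" using assms(1) by simp
  have "a' *\<^sub>R (u - v) = (a *\<^sub>R u - a' *\<^sub>R v) - (a - a') *\<^sub>R u"
    by (simp add: algebra_simps)
  hence "norm (a' *\<^sub>R (u - v)) \<le> D + D * \<rho>"
    using norm_triangle_ineq4[of "a *\<^sub>R u - a' *\<^sub>R v" "(a - a') *\<^sub>R u"] D2
      mult_mono[OF D1, of "norm u" \<rho>] assms(1,2) D1 by (simp add: D_def)
  hence "a' * norm (u - v) \<le> D * (1 + \<rho>)" using a' pos unfolding norm_scaleR by (simp add: algebra_simps)
  moreover have "\<rho> ^ 4 / 4 * norm (u - v) \<le> a' * norm (u - v)"
    using a' by (intro mult_right_mono) auto
  ultimately have "\<rho> ^ 4 / 4 * norm (u - v) \<le> D * (1 + \<rho>)" by linarith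
  thus ?thesis using assms(1) unfolding D_def by (simp add: field_simps)
qed

text \<open>The fundamental theorem for the gauge integral integrates any derivative, so
  integrability is only asked of the bound \<open>s\<close>.\<close>

lemma norm_increment_le_integral:
  fixes \<phi> :: "real \<Rightarrow> 'a::euclidean_space"
  assumes d: "\<And>t. t \<in> {0..1} \<Longrightarrow> \<exists>\<phi>'. (\<phi> has_vector_derivative \<phi>') (at t within {0..1}) \<and> norm \<phi>' \<le> s t"
    and s: "s integrable_on {0..1}"
  shows "norm (\<phi> 1 - \<phi> 0) \<le> integral {0..1} s"
proof -
  obtain \<phi>' where \<phi>': "\<And>t. t \<in> {0..1} \<Longrightarrow> (\<phi> has_vector_derivative \<phi>' t) (at t within {0..1}) \<and> norm (\<phi>' t) \<le> s t"
    using d by metis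
  have "(\<phi>' has_integral (\<phi> 1 - \<phi> 0)) {0..1}"
    using \<phi>' by (intro fundamental_theorem_of_calculus) auto
  thus ?thesis
    using integral_norm_bound_integral[of \<phi>' "{0..1}" s] \<phi>' s by (auto simp: has_integral_iff)
qed

section \<open>The product metric in charts\<close>

locale riemannian_ball_product = closed_riemannian_manifold m b A h
  for m :: nat and b :: "nat \<Rightarrow> 'e::euclidean_space"
    and A :: "('p::{t2_space,second_countable_topology}, 'e) chart set"
    and h :: "'p \<Rightarrow> ('p, 'e) tvec \<Rightarrow> ('p, 'e) tvec \<Rightarrow> real" +
  fixes g :: "('n::finite) ball_metric"
  assumes ball_metric: "riemannian_metric_on_ball g"
begin

definition metric_coeff :: "('p, 'e) chart \<Rightarrow> 'p \<Rightarrow> nat \<Rightarrow> nat \<Rightarrow> real" where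
  "metric_coeff c p i j = h p (coordinate_vector A c p (b i)) (coordinate_vector A c p (b j))"

text \<open>The quadratic form of the product metric in coordinates, written as a polynomial with
  continuous coefficients so that compactness yields bounds. It ignores the part of
  \<open>fst v\<close> orthogonal to \<open>E0\<close>, whence the condition fst v \<in> E0 wherever
  positivity is concerned.\<close>

definition coord_form :: "('p, 'e) chart \<Rightarrow> 'p \<times> (real ^ 'n) \<Rightarrow> 'e \<times> (real ^ 'n) \<Rightarrow> real" where
  "coord_form c x v = (\<Sum>i<m. \<Sum>j<m. (fst v \<bullet> b i) * (fst v \<bullet> b j) * metric_coeff c (fst x) i j) +
     (\<Sum>i\<in>Basis. \<Sum>j\<in>Basis. (snd v \<bullet> i) * (snd v \<bullet> j) * g (snd x) i j)"

lemma inner_product_h: "inner_product_on (tangent_space m b A p) (h p)"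
  using manifold unfolding closed_connected_riemannian_manifold_def riemannian_metric_def by blast

lemma inner_product_g: "q \<in> ball2 \<Longrightarrow> inner_product_on UNIV (g q)"
  using ball_metric unfolding riemannian_metric_on_ball_def by blast

lemma continuous_on_g: "continuous_on ball2 (\<lambda>x. g x v w)"
  using ball_metric unfolding riemannian_metric_on_ball_def by (blast intro: smooth_on_imp_continuous_on)

lemma continuous_on_metric_coeff:
  assumes "c \<in> A" "i < m" "j < m"
  shows "continuous_on (fst c) (\<lambda>p. metric_coeff c p i j)"
proof -
  let ?f = "\<lambda>y. let p = the_inv_into (fst c) (snd c) y
             in h p (coordinate_vector A c p (b i)) (coordinate_vector A c p (b j))"
  have "smooth_on (snd c ` fst c) ?f"
    using manifold assms unfolding closed_connected_riemannian_manifold_def riemannian_metric_def by blast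
  hence "continuous_on (snd c ` fst c) ?f" by (rule smooth_on_imp_continuous_on)
  hence "continuous_on (fst c) (\<lambda>p. ?f (snd c p))"
    by (rule continuous_on_compose2[OF _ continuous_on_chart[OF assms(1)]]) simp
  thus ?thesis
  proof (rule continuous_on_eq)
    fix p assume "p \<in> fst c"
    thus "?f (snd c p) = metric_coeff c p i j"
      using chart_inv_chart[OF assms(1)] by (simp add: metric_coeff_def chart_inv_def)
  qed
qed

lemma tangent_vector_expand:
  assumes "v \<in> tangent_space m b A p" "c \<in> A" "p \<in> fst c"
  shows "v = (\<Sum>i<m. (v c \<bullet> b i) *\<^sub>R coordinate_vector A c p (b i))"
proof (rule tangent_space_eqI[OF assms(1) _ assms(2,3)])
  show "(\<Sum>i<m. (v c \<bullet> b i) *\<^sub>R coordinate_vector A c p (b i)) \<in> tangent_space m b A p"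
    using assms b_in_E0
    by (intro subspace_sum[OF subspace_tangent_space] subspace_scale[OF subspace_tangent_space]
        coordinate_vector_in_tangent_space) simp_all
  have "(\<Sum>i<m. (v c \<bullet> b i) *\<^sub>R coordinate_vector A c p (b i)) c = (\<Sum>i<m. (v c \<bullet> b i) *\<^sub>R b i)"
    unfolding sum_fun_eval using assms b_in_E0 by (intro sum.cong refl) (simp add: scaleR_fun_def)
  thus "v c = (\<Sum>i<m. (v c \<bullet> b i) *\<^sub>R coordinate_vector A c p (b i)) c"
    using E0_expand[OF tangent_space_in_E0[OF assms]] by simp
qed

lemma product_metric_coord_form:
  assumes v: "v \<in> product_tangent_space m b A x" and c: "c \<in> A" "fst x \<in> fst c" and x: "snd x \<in> ball2"
  shows "product_metric h g x v v = coord_form c x (tvec_coords c v)"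
proof -
  let ?p = "fst x"
  let ?e = "\<lambda>i. coordinate_vector A c ?p (b i)"
  have v1: "fst v \<in> tangent_space m b A ?p" using v by (auto simp: product_tangent_space_def)
  have e: "?e i \<in> tangent_space m b A ?p" if "i \<in> {..<m}" for i
    using c that b_in_E0 by (intro coordinate_vector_in_tangent_space) simp_all
  have "h ?p (\<Sum>i<m. (fst v c \<bullet> b i) *\<^sub>R ?e i) (\<Sum>i<m. (fst v c \<bullet> b i) *\<^sub>R ?e i) =
      (\<Sum>i<m. \<Sum>j<m. (fst v c \<bullet> b i) * (fst v c \<bullet> b j) * h ?p (?e i) (?e j))"
    by (rule inner_product_on_sum[OF inner_product_h subspace_tangent_space e e])
  hence 1: "h ?p (fst v) (fst v) = (\<Sum>i<m. \<Sum>j<m. (fst v c \<bullet> b i) * (fst v c \<bullet> b j) * metric_coeff c ?p i j)"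
    unfolding metric_coeff_def using tangent_vector_expand[OF v1 c] by simp
  have "g (snd x) (\<Sum>i\<in>Basis. (snd v \<bullet> i) *\<^sub>R i) (\<Sum>i\<in>Basis. (snd v \<bullet> i) *\<^sub>R i) =
      (\<Sum>i\<in>Basis. \<Sum>j\<in>Basis. (snd v \<bullet> i) * (snd v \<bullet> j) * g (snd x) i j)"
    by (rule inner_product_on_sum[OF inner_product_g[OF x] subspace_UNIV]) simp_all
  hence 2: "g (snd x) (snd v) (snd v) = (\<Sum>i\<in>Basis. \<Sum>j\<in>Basis. (snd v \<bullet> i) * (snd v \<bullet> j) * g (snd x) i j)"
    unfolding euclidean_representation .
  show ?thesis
    by (simp only: product_metric_def 1 2 coord_form_def tvec_coords_def fst_conv snd_conv)
qed

lemma coord_form_scaleR: "coord_form c x (r *\<^sub>R v) = r\<^sup>2 * coord_form c x v"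
  by (simp add: coord_form_def sum_distrib_left algebra_simps power2_eq_square)

lemma continuous_on_coord_form:
  assumes "c \<in> A" "continuous_on S X" "continuous_on S V" "\<And>s. s \<in> S \<Longrightarrow> fst (X s) \<in> fst c" "\<And>s. s \<in> S \<Longrightarrow> snd (X s) \<in> ball2"
  shows "continuous_on S (\<lambda>s. coord_form c (X s) (V s))"
proof -
  have "continuous_on S (\<lambda>s. metric_coeff c (fst (X s)) i j)" if "i < m" "j < m" for i j
    by (rule continuous_on_compose2[OF continuous_on_metric_coeff[OF assms(1) that]])
      (use assms in \<open>auto intro!: continuous_intros\<close>)
  moreover have "continuous_on S (\<lambda>s. g (snd (X s)) v w)" for v w
    by (rule continuous_on_compose2[OF continuous_on_g])
      (use assms in \<open>auto intro!: continuous_intros\<close>)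
  ultimately show ?thesis
    unfolding coord_form_def by (intro continuous_intros assms) simp_all
qed

text \<open>The coordinates \<open>v\<close> belong to a tangent vector \<open>w\<close>, and the
  two summands of the product metric are positive on its nonzero components.\<close>

lemma coord_form_pos:
  assumes c: "c \<in> A" "fst x \<in> fst c" and x: "snd x \<in> ball2" and v: "fst v \<in> E0" "v \<noteq> 0"
  shows "coord_form c x v > 0"
proof -
  let ?T = "tangent_space m b A (fst x)"
  define w where "w = (coordinate_vector A c (fst x) (fst v), snd v)"
  have w: "fst w \<in> ?T" unfolding w_def using c v by (simp add: coordinate_vector_in_tangent_space)
  have wc: "tvec_coords c w = v"
    using c v by (simp add: tvec_coords_def w_def)
  have "coord_form c x v = product_metric h g x w w"
    using product_metric_coord_form[of w x c] c x w wc by (cases w) (simp add: product_tangent_space_def)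
  also have "\<dots> = h (fst x) (fst w) (fst w) + g (snd x) (snd w) (snd w)"
    by (simp add: product_metric_def)
  also have "\<dots> > 0"
  proof -
    have h: "h (fst x) u u > 0" if "u \<in> ?T" "u \<noteq> 0" for u
      using inner_product_h that unfolding inner_product_on_def by blast
    have h0: "h (fst x) 0 0 = 0"
      by (rule inner_product_on_zero[OF inner_product_h subspace_tangent_space subspace_0[OF subspace_tangent_space]])
    have gp: "g (snd x) u u > 0" if "u \<noteq> 0" for u
      using inner_product_g[OF x] that unfolding inner_product_on_def by blast
    have g0: "g (snd x) 0 0 = 0"
      by (rule inner_product_on_zero[OF inner_product_g[OF x] subspace_UNIV UNIV_I])
    have "fst w \<noteq> 0 \<or> snd w \<noteq> 0"
    proof (rule ccontr)
      assume *: "\<not> (fst w \<noteq> 0 \<or> snd w \<noteq> 0)"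
      hence "tvec_coords c w = 0" by (simp add: tvec_coords_def zero_prod_def)
      thus False using wc v by simp
    qed
    moreover have "h (fst x) (fst w) (fst w) \<ge> 0" using h[OF w] h0 by (cases "fst w = 0") auto
    moreover have "g (snd x) (snd w) (snd w) \<ge> 0" using gp[of "snd w"] g0 by (cases "snd w = 0") auto
    ultimately show ?thesis using h[OF w] gp[of "snd w"] by (cases "snd w = 0") linarith+
  qed
  finally show ?thesis .
qed

text \<open>On unit vectors over the compact set the form attains a positive minimum;
  \<open>coord_form_scaleR\<close> extends the bound to all lengths.\<close>

lemma coord_form_coercive:
  assumes c: "c \<in> A" "K \<subseteq> fst c" "compact K"
  obtains \<kappa> where "\<kappa> > 0"
    "\<And>x v. fst x \<in> K \<Longrightarrow> snd x \<in> ball2 \<Longrightarrow> fst v \<in> E0 \<Longrightarrow> coord_form c x v \<ge> \<kappa> * (norm v)\<^sup>2"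
proof -
  define Z where "Z = (K \<times> (ball2 :: (real ^ 'n) set)) \<times> (sphere 0 1 \<inter> (E0 \<times> (UNIV :: (real ^ 'n) set)))"
  have "compact (sphere 0 1 \<inter> (E0 \<times> (UNIV :: (real ^ 'n) set)))"
    by (intro compact_Int_closed compact_sphere closed_Times closed_E0 closed_UNIV)
  hence Z: "compact Z" unfolding Z_def using c by (intro compact_Times compact_cball) auto
  have cont: "continuous_on Z (\<lambda>z. coord_form c (fst z) (snd z))"
    by (rule continuous_on_coord_form[OF c(1)]) (use c(2) in \<open>auto simp: Z_def intro!: continuous_intros\<close>)
  have "\<exists>\<kappa>>0. \<forall>z\<in>Z. coord_form c (fst z) (snd z) \<ge> \<kappa>"
  proof (cases "Z = {}")
    case False
    obtain z where z: "z \<in> Z" "\<forall>y\<in>Z. coord_form c (fst z) (snd z) \<le> coord_form c (fst y) (snd y)"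
      using continuous_attains_inf[OF Z False cont] by blast
    have "fst (fst z) \<in> K" "snd (fst z) \<in> ball2" "fst (snd z) \<in> E0" "norm (snd z) = 1"
      using z(1) by (auto simp: Z_def)
    hence "coord_form c (fst z) (snd z) > 0"
      using c(2) by (intro coord_form_pos[OF c(1)]) auto
    thus ?thesis using z(2) by blast
  qed (auto intro: exI[of _ 1])
  then obtain \<kappa> where \<kappa>: "\<kappa> > 0" "\<And>z. z \<in> Z \<Longrightarrow> coord_form c (fst z) (snd z) \<ge> \<kappa>" by blast
  show ?thesis
  proof (rule that[OF \<kappa>(1)])
    fix x :: "'p \<times> (real ^ 'n)" and v :: "'e \<times> (real ^ 'n)"
    assume a: "fst x \<in> K" "snd x \<in> ball2" "fst v \<in> E0"
    show "coord_form c x v \<ge> \<kappa> * (norm v)\<^sup>2"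
    proof (cases "v = 0")
      case True
      thus ?thesis by (simp add: coord_form_def)
    next
      case False
      have "(x, v /\<^sub>R norm v) \<in> Z"
        using a False by (auto simp: Z_def mem_Times_iff subspace_scale[OF subspace_E0])
      from \<kappa>(2)[OF this] have "\<kappa> \<le> (inverse (norm v))\<^sup>2 * coord_form c x v"
        by (simp add: coord_form_scaleR)
      hence "\<kappa> * (norm v)\<^sup>2 \<le> (inverse (norm v))\<^sup>2 * coord_form c x v * (norm v)\<^sup>2"
        by (intro mult_right_mono) auto
      thus ?thesis using False by (simp add: field_simps)
    qed
  qed
qed

text \<open>\<open>C1_curve\<close> differentiates within the set of parameters whose points lie in
  the chart, \<open>velocity\<close> within the unit interval. The former set is relatively open in
  the interval, so both filters agree.\<close>

lemma C1_curve_velocity: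
  assumes \<gamma>: "C1_curve A \<gamma>" and c: "c \<in> A"
  shows "\<And>t. t \<in> {0..1} \<Longrightarrow> fst (\<gamma> t) \<in> fst c \<Longrightarrow>
      ((\<lambda>s. product_chart c (\<gamma> s)) has_vector_derivative tvec_coords c (velocity A \<gamma> t)) (at t within {0..1})"
    and "continuous_on {t\<in>{0..1}. fst (\<gamma> t) \<in> fst c} (\<lambda>t. tvec_coords c (velocity A \<gamma> t))"
proof -
  let ?I = "{t\<in>{0..1}. fst (\<gamma> t) \<in> fst c}"
  have cont: "continuous_on {0..1} \<gamma>" using \<gamma> by (simp add: C1_curve_def)
  have "C1_on ?I (\<lambda>t. product_chart c (\<gamma> t))" using \<gamma> c unfolding C1_curve_def by blast
  then obtain f' where f': "\<forall>t\<in>?I. ((\<lambda>t. product_chart c (\<gamma> t)) has_vector_derivative f' t) (at t within ?I)"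
      "continuous_on ?I f'"
    unfolding C1_on_def by blast
  have "openin (top_of_set {0..1}) ({0..1} \<inter> (\<lambda>t. fst (\<gamma> t)) -` fst c)"
    using cont open_chart[OF c] by (intro continuous_openin_preimage_gen continuous_intros)
  then obtain O' where O': "open O'" "?I = {0..1} \<inter> O'"
    by (auto simp: openin_open Int_def)
  have at: "at t within ?I = at t within {0..1}" if "t \<in> ?I" for t
    by (rule at_within_nhd[of _ O']) (use O' that in auto)
  have d: "((\<lambda>s. product_chart c (\<gamma> s)) has_vector_derivative f' t) (at t within {0..1})" if "t \<in> ?I" for t
    using bspec[OF f'(1) that] unfolding at[OF that] .
  have eq: "tvec_coords c (velocity A \<gamma> t) = f' t" if t: "t \<in> ?I" for t
  proof -
    have nt: "at t within {0..1} \<noteq> bot" using t by (simp add: trivial_limit_within)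
    have 1: "((\<lambda>s. snd c (fst (\<gamma> s))) has_vector_derivative fst (f' t)) (at t within {0..1})"
      using bounded_linear.has_vector_derivative[OF bounded_linear_fst d[OF t]] by (simp add: product_chart_def)
    have 2: "((\<lambda>s. snd (\<gamma> s)) has_vector_derivative snd (f' t)) (at t within {0..1})"
      using bounded_linear.has_vector_derivative[OF bounded_linear_snd d[OF t]] by (simp add: product_chart_def)
    have "vector_derivative (\<lambda>s. snd c (fst (\<gamma> s))) (at t within {0..1}) = fst (f' t)"
      "vector_derivative (\<lambda>s. snd (\<gamma> s)) (at t within {0..1}) = snd (f' t)"
      by (rule vector_derivative_within[OF nt 1], rule vector_derivative_within[OF nt 2])
    thus ?thesis using t c by (simp add: tvec_coords_def velocity_def prod_eq_iff)
  qed
  show "((\<lambda>s. product_chart c (\<gamma> s)) has_vector_derivative tvec_coords c (velocity A \<gamma> t)) (at t within {0..1})"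
    if "t \<in> {0..1}" "fst (\<gamma> t) \<in> fst c" for t
    using d[of t] eq[of t] that by simp
  show "continuous_on ?I (\<lambda>t. tvec_coords c (velocity A \<gamma> t))"
    by (rule continuous_on_eq[OF f'(2)]) (simp add: eq)
qed

lemma velocity_in_tangent_space:
  assumes \<gamma>: "C1_curve A \<gamma>" and t: "t \<in> {0..1}"
  shows "velocity A \<gamma> t \<in> product_tangent_space m b A (\<gamma> t)"
proof -
  have cont: "continuous (at t within {0..1}) (\<lambda>s. fst (\<gamma> s))"
    using \<gamma> t by (auto simp: C1_curve_def continuous_on_eq_continuous_within intro!: continuous_intros)
  have nt: "at t within {0..1} \<noteq> bot"
    using t by (simp add: trivial_limit_within)
  have d: "((\<lambda>s. snd c (fst (\<gamma> s))) has_vector_derivative fst (velocity A \<gamma> t) c) (at t within {0..1})"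
    if c: "c \<in> A" "fst (\<gamma> t) \<in> fst c" for c
    using bounded_linear.has_vector_derivative[OF bounded_linear_fst C1_curve_velocity(1)[OF \<gamma> c(1) t c(2)]]
    by (simp add: product_chart_def tvec_coords_def)
  have E0: "fst (velocity A \<gamma> t) c \<in> E0" if c: "c \<in> A" "fst (\<gamma> t) \<in> fst c" for c
  proof (rule vector_derivative_in_E0[OF d[OF c] nt t])
    have "\<forall>\<^sub>F s in at t within {0..1}. fst (\<gamma> s) \<in> fst c"
      using cont open_chart[OF c(1)] c(2) unfolding continuous_within by (rule topological_tendstoD)
    thus "\<forall>\<^sub>F s in at t within {0..1}. snd c (fst (\<gamma> s)) \<in> E0"
      by eventually_elim (rule chart_in_E0[OF c(1)])
  qed (use c chart_in_E0 in simp)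
  have "fst (velocity A \<gamma> t) \<in> tangent_space m b A (fst (\<gamma> t))"
  proof (rule tangent_spaceI)
    fix c c' assume c: "c \<in> A" "c' \<in> A" "fst (\<gamma> t) \<in> fst c" "fst (\<gamma> t) \<in> fst c'"
    have 1: "((\<lambda>s. snd c' (fst (\<gamma> s))) has_vector_derivative tangent_map c c' (fst (\<gamma> t)) (fst (velocity A \<gamma> t) c)) (at t within {0..1})"
      by (rule chart_change_derivative[OF c cont d[OF c(1,3)] E0[OF c(1,3)] t])
    show "fst (velocity A \<gamma> t) c' = tangent_map c c' (fst (\<gamma> t)) (fst (velocity A \<gamma> t) c)"
      using vector_derivative_unique_within[OF nt d[OF c(2,4)] 1] .
  qed (use E0 in \<open>auto simp: velocity_def\<close>)
  thus ?thesis by (simp add: product_tangent_space_def mem_Times_iff)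
qed

lemma C1_curve_in_ball: "C1_curve A \<gamma> \<Longrightarrow> t \<in> {0..1} \<Longrightarrow> snd (\<gamma> t) \<in> ball2"
  by (auto simp: C1_curve_def product_manifold_def image_subset_iff mem_Times_iff)

definition speed :: "(real \<Rightarrow> 'p \<times> (real ^ 'n)) \<Rightarrow> real \<Rightarrow> real" where
  "speed \<gamma> t = sqrt (product_metric h g (\<gamma> t) (velocity A \<gamma> t) (velocity A \<gamma> t))"

lemma speed_coord_form:
  assumes "C1_curve A \<gamma>" "t \<in> {0..1}" "c \<in> A" "fst (\<gamma> t) \<in> fst c"
  shows "speed \<gamma> t = sqrt (coord_form c (\<gamma> t) (tvec_coords c (velocity A \<gamma> t)))"
  unfolding speed_def
  by (simp only: product_metric_coord_form[OF velocity_in_tangent_space[OF assms(1,2)] assms(3,4)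
        C1_curve_in_ball[OF assms(1,2)]])

text \<open>The velocity is given chart by chart, so continuity is checked in one chart around each
  parameter. It makes the speed integrable, so that pointwise bounds can be integrated to bounds by
  the length.\<close>

lemma continuous_on_speed:
  assumes \<gamma>: "C1_curve A \<gamma>"
  shows "continuous_on {0..1} (speed \<gamma>)"
  unfolding continuous_on_eq_continuous_within
proof
  fix t :: real assume t: "t \<in> {0..1}"
  obtain c where c: "c \<in> A" "fst (\<gamma> t) \<in> fst c" using charts_cover by metis
  let ?I = "{t\<in>{0..1}. fst (\<gamma> t) \<in> fst c}"
  have cont: "continuous_on {0..1} \<gamma>" using \<gamma> by (simp add: C1_curve_def)
  have "openin (top_of_set {0..1}) ({0..1} \<inter> (\<lambda>t. fst (\<gamma> t)) -` fst c)"
    using cont open_chart[OF c(1)] by (intro continuous_openin_preimage_gen continuous_intros)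
  then obtain O' where O': "open O'" "?I = {0..1} \<inter> O'"
    by (auto simp: openin_open Int_def)
  have at: "at t within ?I = at t within {0..1}"
    by (rule at_within_nhd[of _ O']) (use O' t c in auto)
  have "continuous_on ?I (\<lambda>t. sqrt (coord_form c (\<gamma> t) (tvec_coords c (velocity A \<gamma> t))))"
  proof (intro continuous_on_real_sqrt continuous_on_coord_form[OF c(1)] C1_curve_velocity(2)[OF \<gamma> c(1)])
    show "continuous_on ?I \<gamma>" by (rule continuous_on_subset[OF cont]) auto
  qed (use C1_curve_in_ball[OF \<gamma>] in auto)
  hence "continuous_on ?I (speed \<gamma>)"
    by (rule continuous_on_eq) (simp add: speed_coord_form[OF \<gamma> _ c(1)])
  thus "continuous (at t within {0..1}) (speed \<gamma>)"
    using t c at by (auto simp: continuous_on_eq_continuous_within)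
qed

lemma curve_length_speed: "curve_length A h g \<gamma> = integral {0..1} (speed \<gamma>)"
  by (simp add: curve_length_def speed_def[abs_def])

end

section \<open>The Riemannian distance dominates the distance in charts\<close>

text \<open>Pieces are appended at the end of a curve, so the induction runs over the second
  curve.\<close>

lemma piecewise_C1_join_trans:
  assumes "piecewise_C1_join A h g y z l'" "piecewise_C1_join A h g x y l"
  shows "piecewise_C1_join A h g x z (l + l')"
  using assms
proof (induction arbitrary: l rule: piecewise_C1_join.induct)
  case (2 y \<gamma> l')
  have "piecewise_C1_join A h g x (\<gamma> 0) (l + l')" by (rule 2(3)[OF 2(4)])
  from piecewise_C1_join.intros(2)[OF this 2(2)] show ?case by (simp add: add.assoc)
qed simp

context riemannian_ball_product
begin

text \<open>The extension by 0 gives a function on the whole product, which can be followed along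
  curves that leave the chart and return.\<close>

definition bump_chart :: "('p, 'e) chart \<Rightarrow> 'p \<times> (real ^ 'n) \<Rightarrow> real \<Rightarrow> 'p \<times> (real ^ 'n) \<Rightarrow> real \<times> 'e \<times> (real ^ 'n)" where
  "bump_chart c x0 \<rho> x = (if fst x \<in> fst c then bump \<rho> (product_chart c x - product_chart c x0) else 0)"

lemma compact_chart_ball:
  assumes "c \<in> A" "cball y \<rho> \<inter> E0 \<subseteq> snd c ` fst c"
  shows "compact (chart_inv c ` (cball y \<rho> \<inter> E0))" "chart_inv c ` (cball y \<rho> \<inter> E0) \<subseteq> fst c"
proof -
  have "compact (cball y \<rho> \<inter> E0)" by (intro compact_Int_closed compact_cball closed_E0)
  moreover have "continuous_on (cball y \<rho> \<inter> E0) (chart_inv c)"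
    by (rule continuous_on_subset[OF continuous_on_chart_inv[OF assms(1)] assms(2)])
  ultimately show "compact (chart_inv c ` (cball y \<rho> \<inter> E0))"
    by (rule compact_continuous_image[rotated])
  show "chart_inv c ` (cball y \<rho> \<inter> E0) \<subseteq> fst c"
  proof
    fix p assume "p \<in> chart_inv c ` (cball y \<rho> \<inter> E0)"
    then obtain z where "p = chart_inv c z" "z \<in> cball y \<rho> \<inter> E0" by blast
    thus "p \<in> fst c" using assms chart_inv_in by blast
  qed
qed

lemma in_chart_ball_iff:
  assumes "c \<in> A" "cball y \<rho> \<inter> E0 \<subseteq> snd c ` fst c"
  shows "p \<in> chart_inv c ` (cball y \<rho> \<inter> E0) \<longleftrightarrow> p \<in> fst c \<and> snd c p \<in> cball y \<rho>"
proof
  assume "p \<in> chart_inv c ` (cball y \<rho> \<inter> E0)"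
  then obtain z where z: "p = chart_inv c z" "z \<in> cball y \<rho> \<inter> E0" by blast
  hence "z \<in> snd c ` fst c" using assms(2) by blast
  thus "p \<in> fst c \<and> snd c p \<in> cball y \<rho>" using z assms(1) by simp
next
  assume "p \<in> fst c \<and> snd c p \<in> cball y \<rho>"
  thus "p \<in> chart_inv c ` (cball y \<rho> \<inter> E0)"
    using assms(1) chart_in_E0 by (intro image_eqI[of _ _ "snd c p"]) simp_all
qed

text \<open>Over the closed coordinate ball in the manifold the chain rule applies, and coercivity
  bounds the coordinate velocity by the speed; as the bump is C1 across its boundary sphere, no
  boundary case arises. Elsewhere the function is constantly 0 nearby. Only the manifold factor is
  cut off to a ball, because the Euclidean factor has global coordinates.\<close>

lemma bump_chart_curve:
  assumes c: "c \<in> A" "cball (snd c (fst x0)) \<rho> \<inter> E0 \<subseteq> snd c ` fst c" and \<rho>: "\<rho> > 0"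
    and \<kappa>: "\<kappa> > 0" "\<And>x v. fst x \<in> chart_inv c ` (cball (snd c (fst x0)) \<rho> \<inter> E0) \<Longrightarrow> snd x \<in> ball2 \<Longrightarrow>
        fst v \<in> E0 \<Longrightarrow> coord_form c x v \<ge> \<kappa> * (norm v)\<^sup>2"
    and \<gamma>: "C1_curve A \<gamma>" and t: "t \<in> {0..1}"
  shows "\<exists>\<phi>'. ((\<lambda>t. bump_chart c x0 \<rho> (\<gamma> t)) has_vector_derivative \<phi>') (at t within {0..1}) \<and>
     norm \<phi>' \<le> (4 * \<rho> ^ 3 + 5 * \<rho> ^ 4) / sqrt \<kappa> * speed \<gamma> t"
proof -
  let ?K = "chart_inv c ` (cball (snd c (fst x0)) \<rho> \<inter> E0)"
  let ?L = "4 * \<rho> ^ 3 + 5 * \<rho> ^ 4"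
  have L: "?L > 0" using \<rho> by (intro add_pos_pos) auto
  have cont: "continuous (at t within {0..1}) (\<lambda>s. fst (\<gamma> s))"
    using \<gamma> t by (auto simp: C1_curve_def continuous_on_eq_continuous_within intro!: continuous_intros)
  show ?thesis
  proof (cases "fst (\<gamma> t) \<in> ?K")
    case True
    hence p: "fst (\<gamma> t) \<in> fst c" using in_chart_ball_iff[OF c] by blast
    define w where "w = tvec_coords c (velocity A \<gamma> t)"
    define u where "u = (\<lambda>s. product_chart c (\<gamma> s) - product_chart c x0)"
    have "((\<lambda>s. product_chart c (\<gamma> s)) has_vector_derivative w) (at t within {0..1})"
      unfolding w_def by (rule C1_curve_velocity(1)[OF \<gamma> c(1) t p])
    hence "(u has_vector_derivative w) (at t within {0..1})"
      unfolding u_def by (auto intro!: derivative_eq_intros)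
    from has_vector_derivative_bump[OF this, of \<rho>]
    have d: "((\<lambda>s. bump \<rho> (u s)) has_vector_derivative bump_deriv \<rho> (u t) w) (at t within {0..1})" .
    have "\<forall>\<^sub>F s in at t within {0..1}. fst (\<gamma> s) \<in> fst c"
      using cont open_chart[OF c(1)] p unfolding continuous_within by (rule topological_tendstoD)
    hence ev: "\<forall>\<^sub>F s in at t within {0..1}. bump \<rho> (u s) = bump_chart c x0 \<rho> (\<gamma> s)"
      by eventually_elim (simp add: bump_chart_def u_def)
    have d2: "((\<lambda>t. bump_chart c x0 \<rho> (\<gamma> t)) has_vector_derivative bump_deriv \<rho> (u t) w) (at t within {0..1})"
      using d p t unfolding has_vector_derivative_def
      by (rule_tac has_derivative_transform_eventually[OF _ ev]) (simp_all add: bump_chart_def u_def)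
    have w1: "fst w \<in> E0"
      using velocity_in_tangent_space[OF \<gamma> t] tangent_space_in_E0[OF _ c(1) p]
      by (auto simp: w_def tvec_coords_def product_tangent_space_def mem_Times_iff)
    have "\<kappa> * (norm w)\<^sup>2 \<le> coord_form c (\<gamma> t) w"
      by (rule \<kappa>(2)[OF True C1_curve_in_ball[OF \<gamma> t] w1])
    hence "sqrt (\<kappa> * (norm w)\<^sup>2) \<le> speed \<gamma> t"
      unfolding speed_coord_form[OF \<gamma> t c(1) p] w_def[symmetric] by simp
    hence "norm w \<le> speed \<gamma> t / sqrt \<kappa>"
      using \<kappa>(1) by (simp add: real_sqrt_mult field_simps)
    hence "?L * norm w \<le> ?L * (speed \<gamma> t / sqrt \<kappa>)" using L by (intro mult_left_mono) auto
    with norm_bump_deriv[OF \<rho>, of "u t" w] have "norm (bump_deriv \<rho> (u t) w) \<le> ?L / sqrt \<kappa> * speed \<gamma> t"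
      by simp
    with d2 show ?thesis by blast
  next
    case False
    \<comment> \<open>The manifold is Hausdorff, so the compact set \<open>?K\<close> is closed, and
      a curve outside it stays outside for nearby parameters.\<close>
    have "open (- ?K)" using compact_chart_ball(1)[OF c] by (intro open_Compl compact_imp_closed)
    moreover have "fst (\<gamma> t) \<in> - ?K" using False by simp
    ultimately have evK: "\<forall>\<^sub>F s in at t within {0..1}. fst (\<gamma> s) \<in> - ?K"
      by (rule topological_tendstoD[OF cont[unfolded continuous_within]])
    have z: "bump_chart c x0 \<rho> x = 0" if "fst x \<notin> ?K" for x
    proof (cases "fst x \<in> fst c")
      case True
      hence "\<rho> < norm (snd c (fst x) - snd c (fst x0))"
        using that unfolding in_chart_ball_iff[OF c] by (simp add: dist_norm norm_minus_commute)
      also have "\<dots> \<le> norm (product_chart c x - product_chart c x0)"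
        by (simp add: product_chart_def norm_fst_le)
      finally show ?thesis by (simp add: bump_chart_def bump_eq_0[OF \<rho>])
    qed (simp add: bump_chart_def)
    have ev: "\<forall>\<^sub>F s in at t within {0..1}. 0 = bump_chart c x0 \<rho> (\<gamma> s)"
      using evK by eventually_elim (simp add: z)
    have "((\<lambda>s. 0) has_vector_derivative 0) (at t within {0..1})" by simp
    hence "((\<lambda>t. bump_chart c x0 \<rho> (\<gamma> t)) has_vector_derivative 0) (at t within {0..1})"
      using t z[OF False] unfolding has_vector_derivative_def
      by (rule_tac has_derivative_transform_eventually[OF _ ev]) simp_all
    moreover have "speed \<gamma> t \<ge> 0"
    proof -
      obtain c' where c': "c' \<in> A" "fst (\<gamma> t) \<in> fst c'" using charts_cover by metis
      have "fst (tvec_coords c' (velocity A \<gamma> t)) \<in> E0"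
        using velocity_in_tangent_space[OF \<gamma> t] tangent_space_in_E0[OF _ c']
        by (auto simp: tvec_coords_def product_tangent_space_def mem_Times_iff)
      hence "coord_form c' (\<gamma> t) (tvec_coords c' (velocity A \<gamma> t)) \<ge> 0"
        using coord_form_pos[OF c' C1_curve_in_ball[OF \<gamma> t]]
        by (cases "tvec_coords c' (velocity A \<gamma> t) = 0") (simp_all add: coord_form_def order_less_imp_le)
      thus ?thesis unfolding speed_coord_form[OF \<gamma> t c'] by simp
    qed
    ultimately show ?thesis using L \<kappa>(1) by (intro exI[of _ 0]) auto
  qed
qed

text \<open>The speed bound is integrated over each C1 piece and the pieces are added. The infimum
  over curves is taken only in \<open>local_chart_estimate\<close>.\<close>

lemma bump_chart_lipschitz:
  assumes c: "c \<in> A" "cball (snd c (fst x0)) \<rho> \<inter> E0 \<subseteq> snd c ` fst c" and \<rho>: "\<rho> > 0"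
  obtains L where "L > 0"
    "\<And>x y l. piecewise_C1_join A h g x y l \<Longrightarrow> norm (bump_chart c x0 \<rho> y - bump_chart c x0 \<rho> x) \<le> L * l"
proof -
  obtain \<kappa> where \<kappa>: "\<kappa> > 0" "\<And>x v. fst x \<in> chart_inv c ` (cball (snd c (fst x0)) \<rho> \<inter> E0) \<Longrightarrow> snd x \<in> ball2 \<Longrightarrow>
        fst v \<in> E0 \<Longrightarrow> coord_form c x v \<ge> \<kappa> * (norm v)\<^sup>2"
    using coord_form_coercive[OF c(1) compact_chart_ball(2,1)[OF c]] by metis
  define L where "L = (4 * \<rho> ^ 3 + 5 * \<rho> ^ 4) / sqrt \<kappa>"
  have L: "L > 0" unfolding L_def using \<rho> \<kappa>(1) by (intro divide_pos_pos add_pos_pos) auto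
  have curve: "norm (bump_chart c x0 \<rho> (\<gamma> 1) - bump_chart c x0 \<rho> (\<gamma> 0)) \<le> L * curve_length A h g \<gamma>"
    if \<gamma>: "C1_curve A \<gamma>" for \<gamma>
  proof -
    have s: "(\<lambda>t. L * speed \<gamma> t) integrable_on {0..1}"
      by (intro integrable_continuous_real continuous_intros continuous_on_speed[OF \<gamma>])
    have "norm (bump_chart c x0 \<rho> (\<gamma> 1) - bump_chart c x0 \<rho> (\<gamma> 0)) \<le> integral {0..1} (\<lambda>t. L * speed \<gamma> t)"
      by (rule norm_increment_le_integral[OF bump_chart_curve[OF c \<rho> \<kappa> \<gamma>, folded L_def] s])
    thus ?thesis by (simp add: curve_length_speed)
  qed
  show ?thesis
  proof (rule that[OF L])
    fix x y l assume "piecewise_C1_join A h g x y l"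
    thus "norm (bump_chart c x0 \<rho> y - bump_chart c x0 \<rho> x) \<le> L * l"
    proof (induction rule: piecewise_C1_join.induct)
      case (2 x \<gamma> l)
      thus ?case
        using curve[OF 2(2)] norm_triangle_ineq[of "bump_chart c x0 \<rho> (\<gamma> 1) - bump_chart c x0 \<rho> (\<gamma> 0)" "bump_chart c x0 \<rho> (\<gamma> 0) - bump_chart c x0 \<rho> x"]
        by (simp add: distrib_left)
    qed simp
  qed
qed

text \<open>In any other chart \<open>c'\<close> the velocity of the segment is
  \<open>tangent_map\<close> applied to a constant vector, and \<open>tangent_map\<close> depends
  continuously on the point.\<close>

lemma segment_C1_curve:
  assumes c: "c \<in> A" and y: "closed_segment y1 y2 \<subseteq> snd c ` fst c" and q: "q1 \<in> ball2" "q2 \<in> ball2"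
  shows "C1_curve A (\<lambda>t. (chart_inv c (y1 + t *\<^sub>R (y2 - y1)), q1 + t *\<^sub>R (q2 - q1)))"
proof -
  let ?y = "\<lambda>t. y1 + t *\<^sub>R (y2 - y1)"
  let ?q = "\<lambda>t. q1 + t *\<^sub>R (q2 - q1)"
  let ?\<sigma> = "\<lambda>t. chart_inv c (?y t)"
  have yin: "?y t \<in> snd c ` fst c" if "t \<in> {0..1}" for t
  proof -
    have "?y t \<in> closed_segment y1 y2"
      using that by (auto simp: in_segment algebra_simps)
    thus ?thesis using y by blast
  qed
  have qin: "?q t \<in> ball2" if "t \<in> {0..1}" for t
  proof -
    have "?q t \<in> closed_segment q1 q2" using that by (auto simp: in_segment algebra_simps)
    thus ?thesis using closed_segment_subset[OF q convex_cball] by blast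
  qed
  have cont: "continuous_on {0..1} ?\<sigma>"
    by (rule continuous_on_compose2[OF continuous_on_chart_inv[OF c]])
      (use yin in \<open>auto intro!: continuous_intros\<close>)
  have w: "y2 - y1 \<in> E0"
  proof -
    have "y1 \<in> E0" "y2 \<in> E0" using y chart_image_subset[OF c] by auto
    thus ?thesis by (simp add: subspace_E0 subspace_diff)
  qed
  have C1: "C1_on {t\<in>{0..1}. fst (?\<sigma> t, ?q t) \<in> fst c'} (\<lambda>t. product_chart c' (?\<sigma> t, ?q t))"
    if c': "c' \<in> A" for c'
  proof -
    let ?I = "{t\<in>{0..1}. ?\<sigma> t \<in> fst c'}"
    have sub: "?I \<subseteq> {0..1}" by auto
    have inc: "?\<sigma> t \<in> fst c" if "t \<in> {0..1}" for t using yin[OF that] c by simp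
    have d: "((\<lambda>t. snd c' (?\<sigma> t)) has_vector_derivative tangent_map c c' (?\<sigma> t) (y2 - y1)) (at t within ?I)"
      if t: "t \<in> ?I" for t
    proof (rule chart_change_derivative[OF c c' _ _ _ _ w t])
      show "?\<sigma> t \<in> fst c" "?\<sigma> t \<in> fst c'" using t inc by auto
      show "continuous (at t within ?I) ?\<sigma>"
        using continuous_on_subset[OF cont sub] t by (simp add: continuous_on_eq_continuous_within)
      have "(?y has_vector_derivative y2 - y1) (at t within ?I)"
        by (auto intro!: derivative_eq_intros)
      thus "((\<lambda>s. snd c (?\<sigma> s)) has_vector_derivative y2 - y1) (at t within ?I)"
        by (rule has_vector_derivative_transform[OF t, rotated]) (use yin c in auto)
    qed
    have "((\<lambda>t. (snd c' (?\<sigma> t), ?q t)) has_vector_derivative (tangent_map c c' (?\<sigma> t) (y2 - y1), q2 - q1)) (at t within ?I)"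
      if t: "t \<in> ?I" for t
      by (rule has_vector_derivative_Pair[OF d[OF t]]) (auto intro!: derivative_eq_intros)
    moreover have "continuous_on ?I (\<lambda>t. (tangent_map c c' (?\<sigma> t) (y2 - y1), q2 - q1))"
    proof (intro continuous_intros)
      show "continuous_on ?I (\<lambda>t. tangent_map c c' (?\<sigma> t))"
        by (rule continuous_on_compose2[OF continuous_on_tangent_map[OF c c'] continuous_on_subset[OF cont sub]])
          (use inc in auto)
    qed
    ultimately show ?thesis
      unfolding C1_on_def product_chart_def fst_conv snd_conv
      by (intro exI[of _ "\<lambda>t. (tangent_map c c' (?\<sigma> t) (y2 - y1), q2 - q1)"]) simp
  qed
  show ?thesis
    unfolding C1_curve_def
    using cont qin C1 by (auto simp: product_manifold_def intro!: continuous_intros)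
qed

text \<open>The distance is an infimum over a set of reals and says something only if that set is
  nonempty. Joinability is an equivalence relation whose classes are open, because nearby points are
  joined by segments in a chart; the product is connected.\<close>

lemma join_exists:
  assumes "x \<in> product_manifold" "y \<in> product_manifold"
  shows "\<exists>l. piecewise_C1_join A h g x y l"
proof -
  let ?S = "product_manifold :: ('p \<times> (real ^ 'n)) set"
  \<comment> \<open>Asking for curves in both directions builds symmetry into the relation.\<close>
  define R where "R = (\<lambda>x y. (\<exists>l. piecewise_C1_join A h g x y l) \<and> (\<exists>l. piecewise_C1_join A h g y x l))"
  have conn: "connected ?S"
    using manifold unfolding product_manifold_def closed_connected_riemannian_manifold_def
    by (intro connected_Times convex_connected convex_cball) simp
  have join: "\<exists>l. piecewise_C1_join A h g x y l"
    if c: "c \<in> A" "fst x \<in> fst c" "fst y \<in> fst c" "closed_segment (snd c (fst x)) (snd c (fst y)) \<subseteq> snd c ` fst c"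
      and xy: "x \<in> ?S" "y \<in> ?S" for c x y
  proof -
    let ?\<gamma> = "\<lambda>t. (chart_inv c (snd c (fst x) + t *\<^sub>R (snd c (fst y) - snd c (fst x))), snd x + t *\<^sub>R (snd y - snd x))"
    have \<gamma>: "C1_curve A ?\<gamma>"
      using xy by (intro segment_C1_curve[OF c(1,4)]) (auto simp: product_manifold_def mem_Times_iff)
    have 0: "?\<gamma> 0 = x" and 1: "?\<gamma> 1 = y" using c by simp_all
    have "piecewise_C1_join A h g x (?\<gamma> 0) 0"
      unfolding 0 by (rule piecewise_C1_join.intros(1)[OF xy(1)])
    from piecewise_C1_join.intros(2)[OF this \<gamma>] show ?thesis unfolding 1 by blast
  qed
  have "R x y"
  proof (rule connected_equivalence_relation[OF conn assms])
    show "R y x" if "R x y" for x y using that by (simp add: R_def)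
    show "R x z" if "R x y" "R y z" for x y z
      using that unfolding R_def by (blast intro: piecewise_C1_join_trans)
    fix a assume a: "a \<in> ?S"
    obtain c where c: "c \<in> A" "fst a \<in> fst c" using charts_cover by metis
    obtain \<rho> where \<rho>: "\<rho> > 0" "cball (snd c (fst a)) \<rho> \<inter> E0 \<subseteq> snd c ` fst c"
      using chart_ball[OF c(1) open_UNIV c(2)] by auto
    define N where "N = snd c -` ball (snd c (fst a)) \<rho> \<inter> fst c"
    have N: "open N"
      using continuous_on_open_vimage[OF open_chart[OF c(1)], of "snd c"] continuous_on_chart[OF c(1)]
      by (simp add: N_def)
    define T where "T = ?S \<inter> (N \<times> UNIV)"
    have "openin (top_of_set ?S) T"
      unfolding T_def by (intro openin_open_Int open_Times N open_UNIV)
    moreover have "a \<in> T" using a c \<rho> by (simp add: T_def N_def mem_Times_iff)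
    moreover have "R a x" if x: "x \<in> T" for x
    proof -
      have xN: "fst x \<in> fst c" "snd c (fst x) \<in> cball (snd c (fst a)) \<rho> \<inter> E0" "x \<in> ?S"
        using x chart_in_E0[OF c(1)] by (auto simp: T_def N_def)
      have aN: "snd c (fst a) \<in> cball (snd c (fst a)) \<rho> \<inter> E0"
        using c \<rho>(1) chart_in_E0[OF c] by auto
      have conv: "convex (cball (snd c (fst a)) \<rho> \<inter> E0)"
        by (intro convex_Int convex_cball subspace_imp_convex subspace_E0)
      have "closed_segment (snd c (fst a)) (snd c (fst x)) \<subseteq> snd c ` fst c"
        "closed_segment (snd c (fst x)) (snd c (fst a)) \<subseteq> snd c ` fst c"
        using closed_segment_subset[OF aN xN(2) conv] closed_segment_subset[OF xN(2) aN conv] \<rho>(2) by blast+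
      thus ?thesis unfolding R_def using join[OF c xN(1) _ a xN(3)] join[OF c(1) xN(1) c(2) _ xN(3) a] by blast
    qed
    ultimately show "\<exists>T. openin (top_of_set ?S) T \<and> a \<in> T \<and> (\<forall>x\<in>T. R a x)" by blast
  qed
  thus ?thesis by (simp add: R_def)
qed

lemma local_chart_estimate:
  assumes c: "c \<in> A" "cball (snd c (fst x0)) \<rho> \<inter> E0 \<subseteq> snd c ` fst c" and \<rho>: "\<rho> > 0"
  obtains \<delta> C where "\<delta> > 0" "C > 0"
    "\<And>x y. x \<in> product_manifold \<Longrightarrow> y \<in> product_manifold \<Longrightarrow> fst x \<in> fst c \<Longrightarrow>
       norm (product_chart c x - product_chart c x0) < \<rho> / 4 \<Longrightarrow> riemannian_distance A h g x y < \<delta> \<Longrightarrow>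
       fst y \<in> fst c \<and> norm (product_chart c x - product_chart c y) \<le> C * riemannian_distance A h g x y"
proof -
  obtain L where L: "L > 0"
    "\<And>x y l. piecewise_C1_join A h g x y l \<Longrightarrow> norm (bump_chart c x0 \<rho> y - bump_chart c x0 \<rho> x) \<le> L * l"
    using bump_chart_lipschitz[OF c \<rho>] by metis
  let ?d = "riemannian_distance A h g"
  have lip: "norm (bump_chart c x0 \<rho> y - bump_chart c x0 \<rho> x) \<le> L * ?d x y"
    if "x \<in> product_manifold" "y \<in> product_manifold" for x y
  proof -
    have "norm (bump_chart c x0 \<rho> y - bump_chart c x0 \<rho> x) / L \<le> ?d x y"
      unfolding riemannian_distance_def
    proof (rule cInf_greatest)
      show "{l. piecewise_C1_join A h g x y l} \<noteq> {}" using join_exists[OF that] by simp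
      show "norm (bump_chart c x0 \<rho> y - bump_chart c x0 \<rho> x) / L \<le> l" if "l \<in> {l. piecewise_C1_join A h g x y l}" for l
        using L(2)[of x y l] that L(1) by (simp add: divide_le_eq mult.commute)
    qed
    thus ?thesis using L(1) by (simp add: divide_le_eq mult.commute)
  qed
  \<comment> \<open>At distance below \<delta> the bump values differ by less than
    \<open>\<rho> ^ 4 / 4\<close>, while the value at \<open>x\<close> has size at least
    \<open>\<rho> ^ 4 / 2\<close>. Hence \<open>y\<close> cannot lie outside the chart, where the
    value is 0, and \<open>bump_expands\<close> applies; its constant times \<open>L\<close> is
    \<open>C\<close>.\<close>
  define \<delta> where "\<delta> = \<rho> ^ 4 / (4 * L)"
  define C where "C = 4 / \<rho> ^ 4 * (1 + \<rho>) * L"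
  have pos: "\<delta> > 0" "C > 0" using \<rho> L(1) by (auto simp: \<delta>_def C_def intro!: divide_pos_pos mult_pos_pos add_pos_pos)
  show ?thesis
  proof (rule that[OF pos])
    fix x y :: "'p \<times> (real ^ 'n)"
    assume xy: "x \<in> product_manifold" "y \<in> product_manifold" and x: "fst x \<in> fst c"
      "norm (product_chart c x - product_chart c x0) < \<rho> / 4" and d: "?d x y < \<delta>"
    have "L * ?d x y < L * \<delta>" using d L(1) by simp
    hence lt: "norm (bump_chart c x0 \<rho> x - bump_chart c x0 \<rho> y) < \<rho> ^ 4 / 4"
      using lip[OF xy] L(1) by (simp add: \<delta>_def norm_minus_commute)
    have y: "fst y \<in> fst c"
    proof (rule ccontr)
      assume "fst y \<notin> fst c"
      hence "norm (bump \<rho> (product_chart c x - product_chart c x0)) < \<rho> ^ 4 / 4"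
        using lt x by (simp add: bump_chart_def)
      moreover have "fst (bump \<rho> (product_chart c x - product_chart c x0)) \<le> norm (bump \<rho> (product_chart c x - product_chart c x0))"
        by (metis abs_ge_self norm_fst_le order_trans prod.collapse real_norm_def)
      moreover have "\<rho> ^ 4 / 4 \<le> \<rho> ^ 4 / 2" by simp
      ultimately show False using fst_bump_ge[OF \<rho> x(2)] by linarith
    qed
    have "norm (bump \<rho> (product_chart c x - product_chart c x0) - bump \<rho> (product_chart c y - product_chart c x0)) < \<rho> ^ 4 / 4"
      using lt x y by (simp add: bump_chart_def)
    from bump_expands[OF \<rho> x(2) this]
    have "norm (product_chart c x - product_chart c y) \<le> 4 / \<rho> ^ 4 * (1 + \<rho>) * norm (bump_chart c x0 \<rho> x - bump_chart c x0 \<rho> y)"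
      using x y by (simp add: bump_chart_def)
    also have "\<dots> \<le> 4 / \<rho> ^ 4 * (1 + \<rho>) * (L * ?d x y)"
      using lip[OF xy] \<rho> by (intro mult_left_mono) (auto simp: norm_minus_commute)
    finally show "fst y \<in> fst c \<and> norm (product_chart c x - product_chart c y) \<le> C * ?d x y"
      using y by (simp add: C_def mult_ac)
  qed
qed

end

section \<open>Distance of subspaces\<close>

text \<open>The variational inequality of the projection, used for the directions \<open>s\<close>
  and \<open>- s\<close>, becomes an equation.\<close>

lemma closest_point_subspace:
  fixes S :: "'a::euclidean_space set"
  assumes S: "subspace S"
  shows "closest_point S z \<in> S" "s \<in> S \<Longrightarrow> (z - closest_point S z) \<bullet> s = 0"
proof -
  have cl: "closed S" "convex S" "S \<noteq> {}"
    using S by (auto simp: closed_subspace subspace_imp_convex dest: subspace_0)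
  show P: "closest_point S z \<in> S" by (rule closest_point_in_set[OF cl(1,3)])
  assume s: "s \<in> S"
  let ?P = "closest_point S z"
  have "?P + s \<in> S" "?P - s \<in> S" using P s S by (auto intro: subspace_add subspace_diff)
  from this[THEN closest_point_dot[OF cl(2,1), of _ z]]
  show "(z - ?P) \<bullet> s = 0" by simp
qed

lemma closest_point_subspace_eqI:
  fixes S :: "'a::euclidean_space set"
  assumes S: "subspace S" and y: "y \<in> S" "\<And>s. s \<in> S \<Longrightarrow> (z - y) \<bullet> s = 0"
  shows "closest_point S z = y"
proof -
  let ?P = "closest_point S z"
  have d: "?P - y \<in> S" using closest_point_subspace(1)[OF S] y(1) S by (simp add: subspace_diff)
  have "(?P - y) \<bullet> (?P - y) = (z - y) \<bullet> (?P - y) - (z - ?P) \<bullet> (?P - y)"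
    by (simp add: algebra_simps)
  also have "\<dots> = 0" using y(2)[OF d] closest_point_subspace(2)[OF S d] by simp
  finally show ?thesis by simp
qed

lemma norm_closest_point_subspace_le:
  fixes S :: "'a::euclidean_space set"
  assumes S: "subspace S"
  shows "norm (closest_point S z) \<le> norm z" "norm (z - closest_point S z) \<le> norm z"
proof -
  let ?P = "closest_point S z"
  have "z \<bullet> ?P = ?P \<bullet> ?P"
    using closest_point_subspace(2)[OF S closest_point_subspace(1)[OF S], of z z]
    by (simp add: inner_diff_left)
  hence "(norm z)\<^sup>2 = (norm ?P)\<^sup>2 + (norm (z - ?P))\<^sup>2"
    by (simp add: power2_norm_eq_inner inner_diff_left inner_diff_right inner_commute)
  hence *: "(norm ?P)\<^sup>2 \<le> (norm z)\<^sup>2" "(norm (z - ?P))\<^sup>2 \<le> (norm z)\<^sup>2" by simp_all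
  show "norm ?P \<le> norm z" "norm (z - ?P) \<le> norm z"
    by (rule power2_le_imp_le[OF *(1) norm_ge_zero], rule power2_le_imp_le[OF *(2) norm_ge_zero])
qed

lemma bounded_linear_closest_point:
  fixes S :: "'a::euclidean_space set"
  assumes S: "subspace S"
  shows "bounded_linear (closest_point S)"
proof (rule bounded_linear_intro[where K = 1])
  note P = closest_point_subspace[OF S]
  show "closest_point S (x + y) = closest_point S x + closest_point S y" for x y
    by (rule closest_point_subspace_eqI[OF S])
      (use P(1)[of x] P(1)[of y] P(2)[of _ x] P(2)[of _ y] S in \<open>simp_all add: subspace_add algebra_simps\<close>)
  show "closest_point S (r *\<^sub>R x) = r *\<^sub>R closest_point S x" for r x
    by (rule closest_point_subspace_eqI[OF S])
      (use P(1)[of x] P(2)[of _ x] S in \<open>simp_all add: subspace_scale algebra_simps\<close>)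
  show "norm (closest_point S x) \<le> norm x * 1" for x
    using norm_closest_point_subspace_le(1)[OF S] by simp
qed

lemma subspace_dist_triangle:
  fixes S :: "'a::euclidean_space set"
  assumes "subspace S" "subspace S'" "subspace Q"
  shows "subspace_dist S Q \<le> subspace_dist S S' + subspace_dist S' Q"
proof -
  have "onorm (\<lambda>z. (closest_point S z - closest_point S' z) + (closest_point S' z - closest_point Q z))
      \<le> subspace_dist S S' + subspace_dist S' Q"
    unfolding subspace_dist_def
    by (intro onorm_triangle bounded_linear_sub bounded_linear_closest_point assms)
  thus ?thesis by (simp add: subspace_dist_def)
qed

lemma subspace_dist_sym: "subspace_dist S S' = subspace_dist S' S"
proof -
  have "onorm (\<lambda>z. closest_point S z - closest_point S' z) = onorm (\<lambda>z. - (closest_point S' z - closest_point S z))"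
    by simp
  also have "\<dots> = onorm (\<lambda>z. closest_point S' z - closest_point S z)" by (rule onorm_neg)
  finally show ?thesis by (simp add: subspace_dist_def)
qed

text \<open>Split \<open>z\<close> into \<open>?P' z\<close> and a part \<open>y\<close> orthogonal
  to \<open>S'\<close>. The projection of \<open>?P' z\<close> to \<open>S\<close> moves it by at
  most the gap from \<open>S'\<close> to \<open>S\<close>. The vector \<open>?P y\<close> lies in
  \<open>S\<close>, hence near \<open>S'\<close>, to which \<open>y\<close> is orthogonal, so it is
  small by the other gap. Each part contributes one \<eta>.\<close>

lemma subspace_dist_le_gap:
  fixes S :: "'a::euclidean_space set"
  assumes S: "subspace S" "subspace S'" and \<eta>: "\<eta> \<ge> 0"
    and gap: "\<And>w. w \<in> S \<Longrightarrow> \<exists>w'\<in>S'. norm (w - w') \<le> \<eta> * norm w"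
      "\<And>w. w \<in> S' \<Longrightarrow> \<exists>w'\<in>S. norm (w - w') \<le> \<eta> * norm w"
  shows "subspace_dist S S' \<le> 2 * \<eta>"
  unfolding subspace_dist_def
proof (rule onorm_le)
  fix z
  let ?P = "closest_point S" and ?P' = "closest_point S'"
  define y where "y = z - ?P' z"
  have lin: "?P z = ?P y + ?P (?P' z)"
    using linear_add[OF bounded_linear.linear[OF bounded_linear_closest_point[OF S(1)]], of y "?P' z"]
    by (simp add: y_def)
  have 1: "norm (?P y) \<le> \<eta> * norm y"
  proof -
    obtain w' where w': "w' \<in> S'" "norm (?P y - w') \<le> \<eta> * norm (?P y)"
      using gap(1)[OF closest_point_subspace(1)[OF S(1), of y]] by blast
    have "(norm (?P y))\<^sup>2 = y \<bullet> ?P y"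
      using closest_point_subspace(2)[OF S(1) closest_point_subspace(1)[OF S(1)], of y y]
      by (simp add: power2_norm_eq_inner inner_diff_left)
    also have "\<dots> = y \<bullet> (?P y - w')"
      using closest_point_subspace(2)[OF S(2) w'(1), of z] by (simp add: y_def inner_diff_right)
    also have "\<dots> \<le> norm y * (\<eta> * norm (?P y))"
      using norm_cauchy_schwarz[of y "?P y - w'"] w'(2) by (meson mult_left_mono norm_ge_zero order_trans)
    finally have "norm (?P y) * norm (?P y) \<le> (\<eta> * norm y) * norm (?P y)"
      by (simp add: power2_eq_square mult_ac)
    thus ?thesis using \<eta> by (cases "?P y = 0") auto
  qed
  have 2: "norm (?P' z - ?P (?P' z)) \<le> \<eta> * norm (?P' z)"
  proof -
    obtain w' where w': "w' \<in> S" "norm (?P' z - w') \<le> \<eta> * norm (?P' z)"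
      using gap(2)[OF closest_point_subspace(1)[OF S(2)]] by blast
    have "norm (?P' z - ?P (?P' z)) \<le> norm (?P' z - w')"
      using closest_point_le[OF closed_subspace[OF S(1)] w'(1), of "?P' z"] by (simp add: dist_norm)
    with w'(2) show ?thesis by linarith
  qed
  have "norm (?P z - ?P' z) \<le> norm (?P y) + norm (?P' z - ?P (?P' z))"
    unfolding lin using norm_triangle_ineq4[of "?P y" "?P' z - ?P (?P' z)"] by (simp add: algebra_simps)
  also have "\<dots> \<le> \<eta> * norm z + \<eta> * norm z"
    using 1 2 norm_closest_point_subspace_le[OF S(2), of z] \<eta>
    by (intro add_mono) (auto simp: y_def intro: order_trans mult_left_mono)
  finally show "norm (?P z - ?P' z) \<le> 2 * \<eta> * norm z" by simp
qed

section \<open>Images of a fixed subspace under varying linear maps\<close>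

lemma subspace_blinfun_image: "subspace Z \<Longrightarrow> subspace (blinfun_apply f ` Z)"
  by (rule linear_subspace_image[OF bounded_linear.linear[OF blinfun.bounded_linear_right]])

text \<open>On \<open>Z\<close> the injective map \<open>f x0\<close> expands by at least some
  \<kappa> > 0. A map at distance less than \<open>\<kappa> / 2\<close> still expands by
  \<open>\<kappa> / 2\<close>, so the images of one vector differ by a small multiple of the length
  of either image, which bounds both gaps. The triangle inequality passes from the image at
  \<open>x0\<close> to \<open>Q\<close>.\<close>

lemma continuous_on_subspace_dist_image:
  fixes f :: "'x::topological_space \<Rightarrow> 'a::euclidean_space \<Rightarrow>\<^sub>L 'b::euclidean_space"
  assumes f: "continuous_on X f" and Z: "subspace Z" and Q: "subspace Q"
    and inj: "\<And>x z. x \<in> X \<Longrightarrow> z \<in> Z \<Longrightarrow> f x z = 0 \<Longrightarrow> z = 0"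
  shows "continuous_on X (\<lambda>x. subspace_dist (f x ` Z) Q)"
  unfolding continuous_on_def
proof
  fix x0 assume x0: "x0 \<in> X"
  obtain \<kappa> where \<kappa>: "\<kappa> > 0" "\<And>z. z \<in> Z \<Longrightarrow> norm (f x0 z) \<ge> \<kappa> * norm z"
    using injective_imp_isometric[OF closed_subspace[OF Z] Z blinfun.bounded_linear_right, of "f x0"] inj[OF x0]
    by blast
  let ?S = "\<lambda>x. blinfun_apply (f x) ` Z"
  have S: "subspace (?S x)" for x by (rule subspace_blinfun_image[OF Z])
  have lim: "(f \<longlongrightarrow> f x0) (at x0 within X)" using f x0 by (simp add: continuous_on_def)
  have bound: "subspace_dist (?S x) (?S x0) \<le> 4 / \<kappa> * norm (f x - f x0)" if x: "norm (f x - f x0) < \<kappa> / 2" for x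
  proof -
    define \<delta> where "\<delta> = norm (f x - f x0)"
    have d: "norm (f x z - f x0 z) \<le> \<delta> * norm z" for z
      using norm_blinfun[of "f x - f x0" z] by (simp add: \<delta>_def blinfun.diff_left)
    have \<delta>: "0 \<le> \<delta>" "\<delta> < \<kappa> / 2" using x by (simp_all add: \<delta>_def)
    have le: "\<delta> * norm z \<le> (2 * \<delta> / \<kappa>) * r" if "\<kappa> / 2 * norm z \<le> r" for z :: 'a and r
      using mult_left_mono[OF that, of "2 * \<delta> / \<kappa>"] \<delta>(1) \<kappa>(1) by simp
    have "subspace_dist (?S x) (?S x0) \<le> 2 * (2 * \<delta> / \<kappa>)"
    proof (rule subspace_dist_le_gap[OF S S])
      show "0 \<le> 2 * \<delta> / \<kappa>" using \<delta>(1) \<kappa>(1) by simp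
      show "\<exists>w'\<in>?S x0. norm (w - w') \<le> 2 * \<delta> / \<kappa> * norm w" if w: "w \<in> ?S x" for w
      proof -
        obtain z where z: "z \<in> Z" "w = f x z" using w by blast
        have "\<kappa> * norm z \<le> norm (f x z) + \<delta> * norm z"
          using \<kappa>(2)[OF z(1)] d[of z] norm_triangle_sub[of "f x0 z" "f x z"] by (simp add: norm_minus_commute)
        moreover have "\<delta> * norm z \<le> \<kappa> / 2 * norm z" using \<delta>(2) by (intro mult_right_mono) auto
        ultimately have "\<kappa> / 2 * norm z \<le> norm w" by (simp add: z(2) field_simps)
        from order_trans[OF d le[OF this]] show ?thesis using z by blast
      qed
      show "\<exists>w'\<in>?S x. norm (w - w') \<le> 2 * \<delta> / \<kappa> * norm w" if w: "w \<in> ?S x0" for w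
      proof -
        obtain z where z: "z \<in> Z" "w = f x0 z" using w by blast
        have "\<kappa> / 2 * norm z \<le> \<kappa> * norm z" using \<kappa>(1) by (intro mult_right_mono) auto
        hence "\<kappa> / 2 * norm z \<le> norm w" using \<kappa>(2)[OF z(1)] z(2) by simp
        from order_trans[OF d le[OF this]] have "norm (f x z - w) \<le> 2 * \<delta> / \<kappa> * norm w" by (simp add: z(2))
        thus ?thesis using z(1) by (auto simp: norm_minus_commute)
      qed
    qed
    thus ?thesis by (simp add: \<delta>_def)
  qed
  have ev: "\<forall>\<^sub>F x in at x0 within X. norm (f x - f x0) < \<kappa> / 2"
    using lim \<kappa>(1) by (auto simp: tendsto_iff dist_norm dest: spec[of _ "\<kappa> / 2"])
  have "((\<lambda>x. subspace_dist (?S x) Q - subspace_dist (?S x0) Q) \<longlongrightarrow> 0) (at x0 within X)"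
  proof (rule Lim_null_comparison)
    show "\<forall>\<^sub>F x in at x0 within X. norm (subspace_dist (?S x) Q - subspace_dist (?S x0) Q) \<le> 4 / \<kappa> * norm (f x - f x0)"
      using ev
    proof eventually_elim
      case (elim x)
      have "\<bar>subspace_dist (?S x) Q - subspace_dist (?S x0) Q\<bar> \<le> subspace_dist (?S x) (?S x0)"
        using subspace_dist_triangle[OF S[of x] S[of x0] Q] subspace_dist_triangle[OF S[of x0] S[of x] Q]
          subspace_dist_sym[of "?S x" "?S x0"] by linarith
      thus ?case using bound[OF elim] by simp
    qed
    have "((\<lambda>x. f x - f x0) \<longlongrightarrow> 0) (at x0 within X)" using lim by (simp add: LIM_zero)
    hence "((\<lambda>x. 4 / \<kappa> * norm (f x - f x0)) \<longlongrightarrow> 4 / \<kappa> * norm (0 :: 'a \<Rightarrow>\<^sub>L 'b)) (at x0 within X)"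
      by (intro tendsto_intros)
    thus "((\<lambda>x. 4 / \<kappa> * norm (f x - f x0)) \<longlongrightarrow> 0) (at x0 within X)" by simp
  qed
  thus "((\<lambda>x. subspace_dist (?S x) Q) \<longlongrightarrow> subspace_dist (?S x0) Q) (at x0 within X)"
    by (simp add: LIM_zero_iff)
qed

text \<open>A compact parameter space for the subspaces of \<open>W\<close> of dimension
  \<open>dim Z\<close>: each of them is the image of \<open>Z\<close> under such a map. The bound on
  the operator norm controls the maps off \<open>Z\<close>.\<close>

definition isometries_on :: "'a::euclidean_space set \<Rightarrow> 'a set \<Rightarrow> ('a \<Rightarrow>\<^sub>L 'a) set" where
  "isometries_on Z W = {f. (\<forall>z\<in>Z. norm (blinfun_apply f z) = norm z \<and> blinfun_apply f z \<in> W) \<and> norm f \<le> 1}"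

lemma compact_isometries_on:
  assumes "closed W" shows "compact (isometries_on Z W)"
proof -
  have "isometries_on Z W = (\<Inter>z\<in>Z. {f. norm (blinfun_apply f z) = norm z} \<inter> (\<lambda>f. blinfun_apply f z) -` W) \<inter> cball 0 1"
    by (auto simp: isometries_on_def)
  moreover have "closed (\<Inter>z\<in>Z. {f. norm (blinfun_apply f z) = norm z} \<inter> (\<lambda>f. blinfun_apply f z) -` W)"
    using assms by (intro closed_INT ballI closed_Int closed_Collect_eq closed_vimage continuous_intros)
  ultimately show ?thesis by (simp add: closed_Int_compact)
qed

text \<open>Precomposition with the projection to \<open>Z\<close> keeps the isometry on
  \<open>Z\<close> and brings the operator norm down to at most 1.\<close>

lemma isometries_on_image:
  fixes Z :: "'a::euclidean_space set"
  assumes Z: "subspace Z" and S: "subspace S" "S \<subseteq> W" "dim S = dim Z"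
  obtains f where "f \<in> isometries_on Z W" "f ` Z = S"
proof -
  obtain f0 where f0: "linear f0" "f0 ` Z = S" "\<And>z. z \<in> Z \<Longrightarrow> norm (f0 z) = norm z"
    using isometry_subspaces[OF Z S(1)] S(3) by metis
  define f where "f = Blinfun (\<lambda>z. f0 (closest_point Z z))"
  have "bounded_linear (\<lambda>z. f0 (closest_point Z z))"
    using bounded_linear_compose[OF linear_conv_bounded_linear[THEN iffD1, OF f0(1)] bounded_linear_closest_point[OF Z]] .
  hence f: "f z = f0 (closest_point Z z)" for z
    by (simp add: f_def bounded_linear_Blinfun_apply)
  have fZ: "f z = f0 z" if "z \<in> Z" for z using that by (simp add: f closest_point_self)
  have img: "f ` Z = S" using f0(2) fZ by auto
  moreover have "f \<in> isometries_on Z W"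
  proof -
    have "norm f \<le> 1"
    proof (rule norm_blinfun_bound)
      show "norm (f z) \<le> 1 * norm z" for z
        using norm_closest_point_subspace_le(1)[OF Z, of z] f0(3)[OF closest_point_subspace(1)[OF Z]] by (simp add: f)
    qed simp
    moreover have "f z \<in> W" if "z \<in> Z" for z using that img S(2) by blast
    ultimately show ?thesis by (simp add: isometries_on_def fZ f0(3))
  qed
  ultimately show ?thesis using that by blast
qed

lemma isometries_on_facts:
  assumes "f \<in> isometries_on Z W" "subspace Z"
  shows "blinfun_apply f ` Z \<subseteq> W" "subspace (blinfun_apply f ` Z)" "dim (blinfun_apply f ` Z) = dim Z"
    "z \<in> Z \<Longrightarrow> f z = 0 \<Longrightarrow> z = 0"
proof -
  have n: "norm (f z) = norm z" if "z \<in> Z" for z using assms that by (simp add: isometries_on_def)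
  show "blinfun_apply f ` Z \<subseteq> W" using assms by (auto simp: isometries_on_def)
  show "subspace (blinfun_apply f ` Z)" by (rule subspace_blinfun_image[OF assms(2)])
  have lin: "linear (blinfun_apply f)" by (rule bounded_linear.linear[OF blinfun.bounded_linear_right])
  have "inj_on (blinfun_apply f) Z"
    unfolding linear_inj_on_iff_eq_0[OF lin assms(2)] using n by force
  hence "inj_on (blinfun_apply f) (span Z)"
    unfolding span_eq_iff[THEN iffD2, OF assms(2)] .
  thus "dim (blinfun_apply f ` Z) = dim Z"
    by (rule dim_image_eq[OF lin])
  show "z \<in> Z \<Longrightarrow> f z = 0 \<Longrightarrow> z = 0" using n by force
qed

section \<open>The Grassmann bundle\<close>

context riemannian_ball_product
begin

abbreviation E1 :: "('e \<times> (real ^ 'n)) set" where "E1 \<equiv> E0 \<times> UNIV"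

definition coords_inv :: "('p, 'e) chart \<Rightarrow> 'p \<times> (real ^ 'n) \<Rightarrow> 'e \<times> (real ^ 'n) \<Rightarrow> ('p, 'e, 'n) product_tvec" where
  "coords_inv c x y = (\<Sum>i<m. (fst y \<bullet> b i) *\<^sub>R coordinate_vector A c (fst x) (b i), snd y)"

definition chart_change :: "('p, 'e) chart \<Rightarrow> ('p, 'e) chart \<Rightarrow> 'p \<times> (real ^ 'n) \<Rightarrow>
    ('e \<times> (real ^ 'n)) \<Rightarrow>\<^sub>L ('e \<times> (real ^ 'n))" where
  "chart_change c c' x = Blinfun (\<lambda>y. (tangent_map c c' (fst x) (fst y), snd y))"

lemma chart_change_apply: "blinfun_apply (chart_change c c' x) y = (tangent_map c c' (fst x) (fst y), snd y)"
proof -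
  have "bounded_linear (\<lambda>y :: 'e \<times> (real ^ 'n). (tangent_map c c' (fst x) (fst y), snd y))"
    by (intro bounded_linear_Pair bounded_linear_snd bounded_linear_compose[OF blinfun.bounded_linear_right bounded_linear_fst])
  thus ?thesis by (simp add: chart_change_def bounded_linear_Blinfun_apply)
qed

lemma continuous_on_chart_change:
  assumes "c \<in> A" "c' \<in> A"
  shows "continuous_on {x. fst x \<in> fst c \<inter> fst c'} (chart_change c c')"
proof (rule continuous_on_blinfun_componentwise)
  fix y :: "'e \<times> (real ^ 'n)"
  have "continuous_on {x. fst x \<in> fst c \<inter> fst c'} (\<lambda>x :: 'p \<times> (real ^ 'n). tangent_map c c' (fst x))"
    by (rule continuous_on_compose2[OF continuous_on_tangent_map[OF assms]]) (auto intro!: continuous_intros)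
  thus "continuous_on {x. fst x \<in> fst c \<inter> fst c'} (\<lambda>x. blinfun_apply (chart_change c c' x) y)"
    unfolding chart_change_apply by (intro continuous_intros)
qed

lemma chart_change_injective:
  assumes "c \<in> A" "c' \<in> A" "fst x \<in> fst c" "fst x \<in> fst c'" "y \<in> E1" "chart_change c c' x y = 0"
  shows "y = 0"
proof -
  have y: "fst y \<in> E0" using assms(5) by auto
  have 0: "tangent_map c c' (fst x) (fst y) = 0" "snd y = 0"
    using assms(6) unfolding chart_change_apply by (simp_all add: zero_prod_def)
  have "fst y = tangent_map c' c (fst x) (tangent_map c c' (fst x) (fst y))"
    using tangent_map_compose[OF assms(1,2,1,3,4,3) y] tangent_map_self[OF assms(1,3) y] by simp
  hence "fst y = 0" unfolding 0(1) by (simp add: blinfun.zero_right)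
  with 0(2) show ?thesis by (simp add: prod_eq_iff)
qed

section \<open>Tangent vectors and planes in coordinates\<close>

lemma linear_tvec_coords: "linear (tvec_coords c :: ('p, 'e, 'n) product_tvec \<Rightarrow> _)"
  by (rule linearI) (simp_all add: tvec_coords_def scaleR_fun_def)

lemma linear_coords_inv: "linear (coords_inv c x)"
  by (rule linearI)
    (simp_all add: coords_inv_def inner_add_left scaleR_add_left sum.distrib scaleR_sum_right)

lemma coords_inv_tvec_coords:
  assumes "c \<in> A" "fst x \<in> fst c" "v \<in> product_tangent_space m b A x"
  shows "coords_inv c x (tvec_coords c v) = v"
proof -
  have "fst v \<in> tangent_space m b A (fst x)" using assms by (auto simp: product_tangent_space_def)
  from tangent_vector_expand[OF this assms(1,2)] show ?thesis
    by (simp add: coords_inv_def tvec_coords_def prod_eq_iff)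
qed

lemma coords_inv_in_tangent_space:
  assumes "c \<in> A" "fst x \<in> fst c"
  shows "coords_inv c x y \<in> product_tangent_space m b A x"
proof -
  have "(\<Sum>i<m. (fst y \<bullet> b i) *\<^sub>R coordinate_vector A c (fst x) (b i)) \<in> tangent_space m b A (fst x)"
    using assms b_in_E0
    by (intro subspace_sum[OF subspace_tangent_space] subspace_scale[OF subspace_tangent_space]
        coordinate_vector_in_tangent_space) simp_all
  thus ?thesis by (simp add: coords_inv_def product_tangent_space_def)
qed

lemma tvec_coords_coords_inv:
  assumes "c \<in> A" "fst x \<in> fst c" "y \<in> E1"
  shows "tvec_coords c (coords_inv c x y) = y"
proof -
  have "(\<Sum>i<m. (fst y \<bullet> b i) *\<^sub>R coordinate_vector A c (fst x) (b i)) c = (\<Sum>i<m. (fst y \<bullet> b i) *\<^sub>R b i)"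
    unfolding sum_fun_eval using assms b_in_E0 by (intro sum.cong refl) (simp add: scaleR_fun_def)
  also have "\<dots> = fst y" using E0_expand[of "fst y"] assms(3) by auto
  finally show ?thesis by (simp add: tvec_coords_def coords_inv_def prod_eq_iff)
qed

lemma tvec_coords_in_E1:
  assumes "c \<in> A" "fst x \<in> fst c" "v \<in> product_tangent_space m b A x"
  shows "tvec_coords c v \<in> E1"
  using assms tangent_space_in_E0[of "fst v" "fst x" c]
  by (auto simp: tvec_coords_def product_tangent_space_def)

lemma tvec_coords_change:
  assumes "c \<in> A" "c' \<in> A" "fst x \<in> fst c" "fst x \<in> fst c'" "v \<in> product_tangent_space m b A x"
  shows "tvec_coords c' v = chart_change c c' x (tvec_coords c v)"
  using assms tangent_space_change[OF _ assms(1-4), of "fst v"]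
  by (auto simp: chart_change_apply tvec_coords_def product_tangent_space_def)

lemma coords_inv_image:
  assumes c: "c \<in> A" "fst x \<in> fst c" and P: "subspace P" "P \<subseteq> E1"
  shows "subspace (coords_inv c x ` P)" "dim (coords_inv c x ` P) = dim P"
    "tvec_coords c ` coords_inv c x ` P = P"
    "coords_inv c x ` P \<subseteq> product_tangent_space m b A x"
proof -
  show "subspace (coords_inv c x ` P)" by (rule linear_subspace_image[OF linear_coords_inv P(1)])
  have inv: "tvec_coords c (coords_inv c x y) = y" if "y \<in> P" for y
    using tvec_coords_coords_inv[OF c] that P(2) by blast
  have "inj_on (coords_inv c x) P" using inv by (rule inj_on_inverseI)
  hence "inj_on (coords_inv c x) (span P)" unfolding span_eq_iff[THEN iffD2, OF P(1)] .
  thus "dim (coords_inv c x ` P) = dim P" by (rule eucl.dim_image_eq[OF linear_coords_inv])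
  show "tvec_coords c ` coords_inv c x ` P = P" unfolding image_image using inv by simp
  show "coords_inv c x ` P \<subseteq> product_tangent_space m b A x"
    using coords_inv_in_tangent_space[OF c] by blast
qed

lemma grassmann_bundleI:
  assumes "x \<in> product_manifold" "c \<in> A" "fst x \<in> fst c" "subspace P" "P \<subseteq> E1" "dim P = k"
  shows "(x, coords_inv c x ` P) \<in> grassmann_bundle m b A k"
  using assms coords_inv_image[OF assms(2-5)] by (simp add: grassmann_bundle_def)

lemma grassmann_bundleE:
  assumes "(x, S) \<in> grassmann_bundle m b A k" "c \<in> A" "fst x \<in> fst c"
  shows "subspace (tvec_coords c ` S)" "tvec_coords c ` S \<subseteq> E1" "dim (tvec_coords c ` S) = k"
    "coords_inv c x ` tvec_coords c ` S = S"
proof -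
  have S: "S \<subseteq> product_tangent_space m b A x" "subspace S" "dim S = k"
    using assms(1) by (auto simp: grassmann_bundle_def)
  show 1: "subspace (tvec_coords c ` S)" by (rule linear_subspace_image[OF linear_tvec_coords S(2)])
  show 2: "tvec_coords c ` S \<subseteq> E1" using tvec_coords_in_E1[OF assms(2,3)] S(1) by blast
  have "coords_inv c x (tvec_coords c v) = v" if "v \<in> S" for v
    using coords_inv_tvec_coords[OF assms(2,3)] S(1) that by blast
  thus 3: "coords_inv c x ` tvec_coords c ` S = S" unfolding image_image by simp
  show "dim (tvec_coords c ` S) = k"
    using coords_inv_image(2)[OF assms(2,3) 1 2] S(3) unfolding 3 by simp
qed

text \<open>The generating sets also bound a subspace distance. With the subspace \<open>{0}\<close>
  and a radius larger than the distance at the given point, that bound holds there and the set is a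
  neighbourhood over \<open>N\<close>.\<close>

lemma openin_grassmann_over:
  assumes N: "open N"
  shows "openin (grassmann_topology m b A k) {\<xi> \<in> grassmann_bundle m b A k. fst \<xi> \<in> (N :: ('p \<times> (real ^ 'n)) set)}"
proof (subst openin_subopen, intro ballI)
  fix \<xi> :: "('p \<times> (real ^ 'n)) \<times> _" assume \<xi>: "\<xi> \<in> {\<xi> \<in> grassmann_bundle m b A k. fst \<xi> \<in> N}"
  obtain c where c: "c \<in> A" "fst (fst \<xi>) \<in> fst c" using charts_cover by metis
  define r where "r = \<bar>subspace_dist (tvec_coords c ` snd \<xi>) {0}\<bar> + 1"
  let ?U = "{\<xi>' \<in> grassmann_bundle m b A k. fst \<xi>' \<in> N \<and> fst (fst \<xi>') \<in> fst c \<and>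
      subspace_dist (tvec_coords c ` snd \<xi>') {0} < r}"
  have "openin (grassmann_topology m b A k) ?U"
    unfolding grassmann_topology_def
  proof (rule topology_generated_by_Basis, rule CollectI, intro exI conjI)
    show "subspace ({0} :: ('e \<times> (real ^ 'n)) set)" by (rule subspace_single_0)
    show "r > 0" by (simp add: r_def)
  qed (use c(1) N in simp_all)
  moreover have "\<xi> \<in> ?U" using \<xi> c by (auto simp: r_def)
  ultimately show "\<exists>T. openin (grassmann_topology m b A k) T \<and> \<xi> \<in> T \<and> T \<subseteq> {\<xi> \<in> grassmann_bundle m b A k. fst \<xi> \<in> N}"
    by (intro exI[of _ ?U]) auto
qed

lemma topspace_grassmann_topology: "topspace (grassmann_topology m b A k) = (grassmann_bundle m b A k :: (('p \<times> (real ^ 'n)) \<times> _) set)"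
proof
  show "topspace (grassmann_topology m b A k) \<subseteq> (grassmann_bundle m b A k :: (('p \<times> (real ^ 'n)) \<times> _) set)"
    unfolding grassmann_topology_def topology_generated_by_topspace by blast
  show "(grassmann_bundle m b A k :: (('p \<times> (real ^ 'n)) \<times> _) set) \<subseteq> topspace (grassmann_topology m b A k)"
    using openin_subset[OF openin_grassmann_over[OF open_UNIV, of k]] by simp
qed

lemma continuous_map_grassmann_base:
  assumes "continuous_on UNIV (f :: 'p \<times> (real ^ 'n) \<Rightarrow> real)"
  shows "continuous_map (grassmann_topology m b A k) euclideanreal (\<lambda>\<xi>. f (fst \<xi>))"
  unfolding continuous_map_def topspace_grassmann_topology
proof (intro conjI allI impI)
  fix U :: "real set" assume "openin euclideanreal U"
  hence "open (f -` U)" using assms by (simp add: open_vimage)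
  from openin_grassmann_over[OF this, of k]
  show "openin (grassmann_topology m b A k) {\<xi> \<in> grassmann_bundle m b A k. f (fst \<xi>) \<in> U}" by simp
qed simp

lemma chart_change_inverse_image:
  assumes "c \<in> A" "c' \<in> A" "fst x \<in> fst c" "fst x \<in> fst c'" "P \<subseteq> E1"
  shows "tvec_coords c' ` coords_inv c x ` P = chart_change c c' x ` P"
proof -
  have "tvec_coords c' (coords_inv c x y) = chart_change c c' x y" if "y \<in> P" for y
    using tvec_coords_change[OF assms(1-4) coords_inv_in_tangent_space[OF assms(1,3)], of y]
      tvec_coords_coords_inv[OF assms(1,3), of y] that assms(5) by auto
  thus ?thesis unfolding image_image by (intro image_cong) simp_all
qed

text \<open>This part of the bundle is the continuous image of a compact product: points over
  \<open>K\<close>, times isometries of a model subspace \<open>Z\<close> of dimension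
  \<open>k\<close>. The bound on \<open>k\<close> guarantees that \<open>Z\<close> exists.\<close>

lemma compactin_grassmann_chart:
  assumes c: "c \<in> A" "K \<subseteq> fst c" "compact K" and k: "k \<le> DIM('e \<times> (real ^ 'n))"
  shows "compactin (grassmann_topology m b A k)
    {\<xi> \<in> (grassmann_bundle m b A k :: (('p \<times> (real ^ 'n)) \<times> _) set). fst (fst \<xi>) \<in> K}"
proof -
  obtain Z :: "('e \<times> (real ^ 'n)) set" where Z: "subspace Z" "dim Z = k"
    using choose_subspace_of_subspace[of k "UNIV :: ('e \<times> (real ^ 'n)) set"] k by (auto simp: dim_UNIV)
  define X where "X = (K \<times> (ball2 :: (real ^ 'n) set)) \<times> isometries_on Z E1"
  define \<Psi> where "\<Psi> = (\<lambda>z :: ('p \<times> (real ^ 'n)) \<times> (('e \<times> (real ^ 'n)) \<Rightarrow>\<^sub>L ('e \<times> (real ^ 'n))).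
      (fst z, coords_inv c (fst z) ` blinfun_apply (snd z) ` Z))"
  let ?G = "grassmann_bundle m b A k :: (('p \<times> (real ^ 'n)) \<times> _) set"
  have iso: "blinfun_apply (snd z) ` Z \<subseteq> E1" "subspace (blinfun_apply (snd z) ` Z)" "dim (blinfun_apply (snd z) ` Z) = k"
    "\<And>y. y \<in> Z \<Longrightarrow> blinfun_apply (snd z) y = 0 \<Longrightarrow> y = 0" if "z \<in> X" for z
  proof -
    have f: "snd z \<in> isometries_on Z E1" using that by (auto simp: X_def)
    note * = isometries_on_facts[OF f Z(1)]
    show "blinfun_apply (snd z) ` Z \<subseteq> E1" "subspace (blinfun_apply (snd z) ` Z)" "dim (blinfun_apply (snd z) ` Z) = k"
      using *(1-3) Z(2) by simp_all
    show "y = 0" if "y \<in> Z" "blinfun_apply (snd z) y = 0" for y by (rule *(4)[OF that])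
  qed
  have XM: "fst (fst z) \<in> fst c" "fst z \<in> product_manifold" if "z \<in> X" for z
    using that c(2) by (auto simp: X_def product_manifold_def)
  have \<Psi>G: "\<Psi> z \<in> ?G" if "z \<in> X" for z
    unfolding \<Psi>_def by (rule grassmann_bundleI[OF XM(2)[OF that] c(1) XM(1)[OF that] iso(2,1,3)[OF that]])
  have compX: "compact X"
    unfolding X_def using c(3)
    by (intro compact_Times compact_cball compact_isometries_on closed_Times closed_E0 closed_UNIV)
  have "continuous_map (top_of_set X) (grassmann_topology m b A k) \<Psi>"
    unfolding grassmann_topology_def
  proof (rule continuous_on_generated_topo)
    let ?gens = "{{\<xi> \<in> ?G. fst \<xi> \<in> N \<and> fst (fst \<xi>) \<in> fst c \<and> subspace_dist (tvec_coords c ` snd \<xi>) Q < \<epsilon>} | N c Q \<epsilon>.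
      open N \<and> c \<in> A \<and> subspace Q \<and> \<epsilon> > 0}"
    have "\<Union>?gens = ?G"
      using topspace_grassmann_topology[of k] unfolding grassmann_topology_def topology_generated_by_topspace .
    thus "\<Psi> ` topspace (top_of_set X) \<subseteq> \<Union>?gens" using \<Psi>G by auto
    fix U assume "U \<in> ?gens"
    then obtain N c' Q \<epsilon> where U: "U = {\<xi> \<in> ?G. fst \<xi> \<in> N \<and> fst (fst \<xi>) \<in> fst c' \<and> subspace_dist (tvec_coords c' ` snd \<xi>) Q < \<epsilon>}"
      and N: "open N" "c' \<in> A" "subspace Q" by blast
    define X' where "X' = X \<inter> (N \<inter> (fst c' \<times> UNIV)) \<times> UNIV"
    have X': "openin (top_of_set X) X'"
      unfolding X'_def using N open_chart[OF N(2)] by (intro openin_open_Int open_Times open_Int open_UNIV)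
    have mem: "z \<in> X" "fst z \<in> N" "fst (fst z) \<in> fst c'" if "z \<in> X'" for z
      using that by (auto simp: X'_def)
    \<comment> \<open>In the chart \<open>c'\<close> the plane of \<open>\<Psi> z\<close> is the
      image of \<open>Z\<close> under \<open>fl z\<close>, so its distance to \<open>Q\<close> is
      continuous in \<open>z\<close> even if \<open>c'\<close> differs from the chart
      \<open>c\<close> that defines \<Psi>.\<close>
    define fl where "fl = (\<lambda>z :: ('p \<times> (real ^ 'n)) \<times> (('e \<times> (real ^ 'n)) \<Rightarrow>\<^sub>L ('e \<times> (real ^ 'n))). chart_change c c' (fst z) o\<^sub>L snd z)"
    have "continuous_on X' (\<lambda>z. chart_change c c' (fst z))"
    proof (rule continuous_on_compose2[OF continuous_on_chart_change[OF c(1) N(2)]])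
      show "continuous_on X' (\<lambda>z. fst z)" by (intro continuous_intros)
      show "(\<lambda>z. fst z) ` X' \<subseteq> {x. fst x \<in> fst c \<inter> fst c'}"
      proof (rule image_subsetI)
        fix z assume z: "z \<in> X'"
        show "fst z \<in> {x. fst x \<in> fst c \<inter> fst c'}" using mem(3)[OF z] XM(1)[OF mem(1)[OF z]] by simp
      qed
    qed
    hence fl: "continuous_on X' fl"
      unfolding fl_def by (intro bounded_bilinear.continuous_on[OF bounded_bilinear_blinfun_compose] continuous_intros)
    have "continuous_on X' (\<lambda>z. subspace_dist (blinfun_apply (fl z) ` Z) Q)"
    proof (rule continuous_on_subspace_dist_image[OF fl Z(1) N(3)])
      fix z y assume z: "z \<in> X'" and y: "y \<in> Z" "blinfun_apply (fl z) y = 0"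
      have "blinfun_apply (snd z) y = 0"
        using chart_change_injective[OF c(1) N(2) XM(1)[OF mem(1)[OF z]] mem(3)[OF z], of "blinfun_apply (snd z) y"]
          iso(1)[OF mem(1)[OF z]] y by (auto simp: fl_def)
      thus "y = 0" using iso(4)[OF mem(1)[OF z]] y(1) by blast
    qed
    hence "openin (top_of_set X') (X' \<inter> (\<lambda>z. subspace_dist (blinfun_apply (fl z) ` Z) Q) -` {..<\<epsilon>})"
      by (rule continuous_openin_preimage_gen) simp
    hence "openin (top_of_set X) (X' \<inter> (\<lambda>z. subspace_dist (blinfun_apply (fl z) ` Z) Q) -` {..<\<epsilon>})"
      using X' openin_trans by blast
    moreover have "\<Psi> -` U \<inter> X = X' \<inter> (\<lambda>z. subspace_dist (blinfun_apply (fl z) ` Z) Q) -` {..<\<epsilon>}"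
    proof (rule Set.set_eqI)
      fix z
      have eq: "tvec_coords c' ` snd (\<Psi> z) = blinfun_apply (fl z) ` Z" if "z \<in> X" "fst (fst z) \<in> fst c'"
        using chart_change_inverse_image[OF c(1) N(2) XM(1)[OF that(1)] that(2) iso(1)[OF that(1)]]
        by (simp add: \<Psi>_def fl_def image_image)
      have fst: "fst (\<Psi> z) = fst z" by (simp add: \<Psi>_def)
      show "z \<in> \<Psi> -` U \<inter> X \<longleftrightarrow> z \<in> X' \<inter> (\<lambda>z. subspace_dist (blinfun_apply (fl z) ` Z) Q) -` {..<\<epsilon>}"
      proof
        assume z: "z \<in> \<Psi> -` U \<inter> X"
        hence "fst z \<in> N" "fst (fst z) \<in> fst c'" "subspace_dist (tvec_coords c' ` snd (\<Psi> z)) Q < \<epsilon>" "z \<in> X"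
          by (simp_all add: U fst)
        thus "z \<in> X' \<inter> (\<lambda>z. subspace_dist (blinfun_apply (fl z) ` Z) Q) -` {..<\<epsilon>}"
          using eq by (simp add: X'_def mem_Times_iff)
      next
        assume z: "z \<in> X' \<inter> (\<lambda>z. subspace_dist (blinfun_apply (fl z) ` Z) Q) -` {..<\<epsilon>}"
        hence z': "z \<in> X'" by simp
        show "z \<in> \<Psi> -` U \<inter> X"
          using z mem[OF z'] eq[OF mem(1)[OF z'] mem(3)[OF z']] \<Psi>G[OF mem(1)[OF z']] by (simp add: U fst)
      qed
    qed
    ultimately show "openin (top_of_set X) (\<Psi> -` U \<inter> topspace (top_of_set X))" by simp
  qed
  moreover have "compactin (top_of_set X) X" using compX by (simp add: compactin_subtopology)
  ultimately have "compactin (grassmann_topology m b A k) (\<Psi> ` X)" by (rule image_compactin[rotated])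
  moreover have "\<Psi> ` X = {\<xi> \<in> ?G. fst (fst \<xi>) \<in> K}"
  proof
    show "\<Psi> ` X \<subseteq> {\<xi> \<in> ?G. fst (fst \<xi>) \<in> K}" using \<Psi>G by (auto simp: \<Psi>_def X_def)
    show "{\<xi> \<in> ?G. fst (fst \<xi>) \<in> K} \<subseteq> \<Psi> ` X"
    proof
      fix \<xi> assume \<xi>: "\<xi> \<in> {\<xi> \<in> ?G. fst (fst \<xi>) \<in> K}"
      obtain x S where xS: "\<xi> = (x, S)" by (cases \<xi>)
      have x: "fst x \<in> K" "snd x \<in> ball2" "(x, S) \<in> ?G"
        using \<xi> by (auto simp: xS grassmann_bundle_def product_manifold_def)
      have xc: "fst x \<in> fst c" using x(1) c(2) by blast
      note S = grassmann_bundleE[OF x(3) c(1) xc]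
      obtain f where f: "f \<in> isometries_on Z E1" "f ` Z = tvec_coords c ` S"
        using isometries_on_image[OF Z(1) S(1,2)] S(3) Z(2) by metis
      have "\<xi> = \<Psi> (x, f)" by (simp add: \<Psi>_def xS f(2) S(4))
      moreover have "(x, f) \<in> X" using x f(1) by (simp add: X_def mem_Times_iff)
      ultimately show "\<xi> \<in> \<Psi> ` X" by blast
    qed
  qed
  ultimately show ?thesis by simp
qed

text \<open>Finitely many compact coordinate balls cover the closed manifold.\<close>

lemma compactin_grassmann_bundle:
  assumes k: "k \<le> DIM('e \<times> (real ^ 'n))"
  shows "compactin (grassmann_topology m b A k) (grassmann_bundle m b A k :: (('p \<times> (real ^ 'n)) \<times> _) set)"
proof -
  define \<N> where "\<N> = {N. open N \<and> (\<exists>c K. c \<in> A \<and> N \<subseteq> K \<and> K \<subseteq> fst c \<and> compact K)}"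
  have cov: "UNIV \<subseteq> \<Union>\<N>"
  proof
    fix p :: 'p
    obtain c where c: "c \<in> A" "p \<in> fst c" using charts_cover by metis
    obtain \<rho> where \<rho>: "\<rho> > 0" "cball (snd c p) \<rho> \<inter> E0 \<subseteq> snd c ` fst c"
      using chart_ball[OF c(1) open_UNIV c(2)] by auto
    let ?N = "snd c -` ball (snd c p) \<rho> \<inter> fst c"
    have "open ?N"
      using continuous_on_open_vimage[OF open_chart[OF c(1)], of "snd c"] continuous_on_chart[OF c(1)] by simp
    moreover have "?N \<subseteq> chart_inv c ` (cball (snd c p) \<rho> \<inter> E0)"
      using in_chart_ball_iff[OF c(1) \<rho>(2)] by auto
    ultimately have "?N \<in> \<N>" using compact_chart_ball[OF c(1) \<rho>(2)] c(1) unfolding \<N>_def by blast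
    moreover have "p \<in> ?N" using c(2) \<rho>(1) by simp
    ultimately show "p \<in> \<Union>\<N>" by blast
  qed
  have comp: "compact (UNIV :: 'p set)" using manifold by (simp add: closed_connected_riemannian_manifold_def)
  have op: "open N" if "N \<in> \<N>" for N using that by (simp add: \<N>_def)
  obtain \<N>' where \<N>': "\<N>' \<subseteq> \<N>" "finite \<N>'" "UNIV \<subseteq> \<Union>\<N>'"
    by (rule compactE[OF comp cov op])
  have "\<forall>N\<in>\<N>'. \<exists>K c. c \<in> A \<and> N \<subseteq> K \<and> K \<subseteq> fst c \<and> compact K"
  proof
    fix N assume "N \<in> \<N>'"
    hence "N \<in> \<N>" using \<N>'(1) by (rule rev_subsetD)
    thus "\<exists>K c. c \<in> A \<and> N \<subseteq> K \<and> K \<subseteq> fst c \<and> compact K"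
      unfolding \<N>_def mem_Collect_eq by meson
  qed
  from bchoice[OF this] obtain K where K: "\<forall>N\<in>\<N>'. \<exists>c. c \<in> A \<and> N \<subseteq> K N \<and> K N \<subseteq> fst c \<and> compact (K N)" ..
  let ?G = "grassmann_bundle m b A k :: (('p \<times> (real ^ 'n)) \<times> _) set"
  have "compactin (grassmann_topology m b A k) (\<Union>((\<lambda>N. {\<xi> \<in> ?G. fst (fst \<xi>) \<in> K N}) ` \<N>'))"
  proof (rule compactin_Union)
    show "finite ((\<lambda>N. {\<xi> \<in> ?G. fst (fst \<xi>) \<in> K N}) ` \<N>')" using \<N>'(2) by simp
    fix S assume "S \<in> (\<lambda>N. {\<xi> \<in> ?G. fst (fst \<xi>) \<in> K N}) ` \<N>'"
    then obtain N where N: "N \<in> \<N>'" "S = {\<xi> \<in> ?G. fst (fst \<xi>) \<in> K N}" by blast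
    then obtain c where "c \<in> A" "K N \<subseteq> fst c" "compact (K N)" using K by blast
    from compactin_grassmann_chart[OF this k] show "compactin (grassmann_topology m b A k) S"
      unfolding N(2) .
  qed
  moreover have "\<Union>((\<lambda>N. {\<xi> \<in> ?G. fst (fst \<xi>) \<in> K N}) ` \<N>') = ?G"
  proof
    show "?G \<subseteq> \<Union>((\<lambda>N. {\<xi> \<in> ?G. fst (fst \<xi>) \<in> K N}) ` \<N>')"
    proof
      fix \<xi> assume \<xi>: "\<xi> \<in> ?G"
      obtain N where N: "N \<in> \<N>'" "fst (fst \<xi>) \<in> N" using \<N>'(3) by blast
      hence "fst (fst \<xi>) \<in> K N" using K by blast
      thus "\<xi> \<in> \<Union>((\<lambda>N. {\<xi> \<in> ?G. fst (fst \<xi>) \<in> K N}) ` \<N>')" using \<xi> N(1) by blast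
    qed
  qed blast
  ultimately show ?thesis by simp
qed

text \<open>Makes functions of the base point admissible test functions for rectifiability; the
  whole bundle serves as the compact set.\<close>

lemma continuous_compact_support_base:
  assumes "k \<le> DIM('e \<times> (real ^ 'n))" "continuous_on UNIV (f :: 'p \<times> (real ^ 'n) \<Rightarrow> real)"
  shows "continuous_compact_support (grassmann_topology m b A k) (\<lambda>\<xi>. f (fst \<xi>))"
  unfolding continuous_compact_support_def
  using continuous_map_grassmann_base[OF assms(2), of k] compactin_grassmann_bundle[OF assms(1)]
    topspace_grassmann_topology[of k] by auto

lemma space_grassmann_borel: "space (grassmann_borel m b A k) = (grassmann_bundle m b A k :: (('p \<times> (real ^ 'n)) \<times> _) set)"
  and sets_grassmann_borel: "openin (grassmann_topology m b A k) U \<Longrightarrow> (U :: (('p \<times> (real ^ 'n)) \<times> _) set) \<in> sets (grassmann_borel m b A k)"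
proof -
  have sub: "{U. openin (grassmann_topology m b A k) U} \<subseteq> Pow (grassmann_bundle m b A k :: (('p \<times> (real ^ 'n)) \<times> _) set)"
    using openin_subset topspace_grassmann_topology by blast
  show "space (grassmann_borel m b A k) = (grassmann_bundle m b A k :: (('p \<times> (real ^ 'n)) \<times> _) set)"
    unfolding grassmann_borel_def by (rule space_measure_of[OF sub])
  show "openin (grassmann_topology m b A k) U \<Longrightarrow> (U :: (('p \<times> (real ^ 'n)) \<times> _) set) \<in> sets (grassmann_borel m b A k)"
    unfolding grassmann_borel_def sets_measure_of[OF sub] by (rule sigma_sets.Basic) simp
qed

end

section \<open>The torus and its linear foliations\<close>

text \<open>Up to \<open>pi / 3\<close> the difference has derivative \<open>cos y - 1 / 2\<close>,
  which is nonnegative. Beyond, the sine is at least \<open>sqrt 3 / 2\<close> and hence 0.85, while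
  \<open>x / 2\<close> is at most \<open>pi / 4\<close> and hence 0.8.\<close>

lemma half_le_sin:
  assumes "0 \<le> x" "x \<le> pi / 2"
  shows "x / 2 \<le> sin x"
proof (cases "x \<le> pi / 3")
  case True
  have "sin 0 - 0 / 2 \<le> sin x - x / 2"
  proof (rule DERIV_nonneg_imp_nondecreasing[OF assms(1)])
    fix y assume y: "0 \<le> y" "y \<le> x"
    have "cos (pi / 3) \<le> cos y"
      using y True by (intro cos_monotone_0_pi_le) auto
    hence "0 \<le> cos y - 1 / 2" by (simp add: cos_60)
    moreover have "((\<lambda>x. sin x - x / 2) has_real_derivative cos y - 1 / 2) (at y)"
      by (auto intro!: derivative_eq_intros)
    ultimately show "\<exists>d. ((\<lambda>x. sin x - x / 2) has_real_derivative d) (at y) \<and> 0 \<le> d" by blast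
  qed
  thus ?thesis by simp
next
  case False
  have "sin (pi / 3) \<le> sin x"
    using False assms by (intro sin_monotone_2pi_le) auto
  moreover have "sqrt 3 \<ge> 1.7" by (rule real_le_rsqrt) (simp add: power2_eq_square)
  moreover have "x / 2 \<le> 0.8" using assms(2) pi_approx by simp
  ultimately show ?thesis by (simp add: sin_60)
qed

text \<open>Square the inequality \<open>half_le_sin\<close> for half the angle:
  \<open>\<bar>d\<bar> / 4\<close> is at most \<open>sin \<bar>d / 2\<bar>\<close>.\<close>

lemma angle_le_chord:
  assumes "\<bar>d\<bar> \<le> pi"
  shows "d\<^sup>2 \<le> 16 * (sin (d / 2))\<^sup>2"
proof -
  have "\<bar>d / 2\<bar> / 2 \<le> sin \<bar>d / 2\<bar>" by (rule half_le_sin) (use assms in auto)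
  hence "(\<bar>d\<bar> / 4)\<^sup>2 \<le> (sin \<bar>d / 2\<bar>)\<^sup>2" by (intro power_mono) auto
  moreover have "(sin \<bar>d / 2\<bar>)\<^sup>2 = (sin (d / 2))\<^sup>2" by (simp add: abs_if)
  ultimately show ?thesis by (simp add: power_divide)
qed

lemma angle_representative:
  obtains \<psi> where "\<bar>\<psi> - a\<bar> \<le> pi" "sin \<psi> = sin \<phi>" "cos \<psi> = cos (\<phi> :: real)"
proof -
  define k where "k = \<lfloor>(\<phi> - (a - pi)) / (2 * pi)\<rfloor>"
  define \<psi> where "\<psi> = \<phi> - 2 * pi * of_int k"
  have "of_int k \<le> (\<phi> - (a - pi)) / (2 * pi)" "(\<phi> - (a - pi)) / (2 * pi) < of_int k + 1"
    unfolding k_def by linarith+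
  hence "2 * pi * of_int k \<le> \<phi> - (a - pi)" "\<phi> - (a - pi) < 2 * pi * (of_int k + 1)"
    by (simp_all add: field_simps)
  hence "\<bar>\<psi> - a\<bar> \<le> pi" by (simp add: \<psi>_def algebra_simps abs_le_iff)
  moreover have "sin \<psi> = sin \<phi>" "cos \<psi> = cos \<phi>"
    by (simp_all add: \<psi>_def sin_diff cos_diff sin_int_2pin cos_int_2pin)
  ultimately show ?thesis using that by blast
qed

section \<open>The torus in the unit sphere\<close>

locale torus_in_ball =
  fixes e :: "nat \<Rightarrow> 'n::finite"
  assumes card_ge_4: "CARD('n) \<ge> 4" and e_bij: "bij_betw e {1..CARD('n)} UNIV"
begin

abbreviation T :: "real \<times> real \<Rightarrow> real ^ 'n" where "T \<equiv> torus_cover e"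

abbreviation ax :: "nat \<Rightarrow> real ^ 'n" where "ax i \<equiv> axis (e i) 1"

lemma ax_inner: "i \<in> {1..4} \<Longrightarrow> j \<in> {1..4} \<Longrightarrow> ax i \<bullet> ax j = (if i = j then 1 else 0)"
proof -
  assume ij: "i \<in> {1..4}" "j \<in> {1..4}"
  have "inj_on e {1..CARD('n)}" using e_bij by (simp add: bij_betw_def)
  hence "e i = e j \<longleftrightarrow> i = j" using ij card_ge_4 by (intro inj_on_eq_iff) auto
  thus ?thesis by (simp add: inner_axis_axis)
qed

lemma lincomb_inner:
  "((1 / sqrt 2) *\<^sub>R (a1 *\<^sub>R ax 1 + a2 *\<^sub>R ax 2 + a3 *\<^sub>R ax 3 + a4 *\<^sub>R ax 4)) \<bullet>
   ((1 / sqrt 2) *\<^sub>R (b1 *\<^sub>R ax 1 + b2 *\<^sub>R ax 2 + b3 *\<^sub>R ax 3 + b4 *\<^sub>R ax 4)) =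
   (a1 * b1 + a2 * b2 + a3 * b3 + a4 * b4) / 2"
  by (simp add: inner_add_left inner_add_right ax_inner algebra_simps)

lemma torus_cover_eq: "T (\<phi>, \<theta>) = (1 / sqrt 2) *\<^sub>R
     (sin \<phi> *\<^sub>R ax 1 + cos \<phi> *\<^sub>R ax 2 + sin \<theta> *\<^sub>R ax 3 + cos \<theta> *\<^sub>R ax 4)"
  by (simp add: torus_cover_def)

lemma norm_torus_cover: "norm (T z) = 1"
proof -
  obtain \<phi> \<theta> where z: "z = (\<phi>, \<theta>)" by (cases z)
  have "T z \<bullet> T z = ((sin \<phi>)\<^sup>2 + (cos \<phi>)\<^sup>2 + ((sin \<theta>)\<^sup>2 + (cos \<theta>)\<^sup>2)) / 2"
    unfolding z torus_cover_eq lincomb_inner by (simp add: power2_eq_square)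
  thus ?thesis by (simp add: norm_eq_sqrt_inner)
qed

text \<open>The radii \<open>1 / sqrt 2\<close> make the inner product of two points half the sum of
  the cosines of the angle differences; the half-angle formula gives the squares.\<close>

lemma torus_chord:
  "(norm (T (\<phi>, \<theta>) - T (\<phi>', \<theta>')))\<^sup>2 = 2 * (sin ((\<phi> - \<phi>') / 2))\<^sup>2 + 2 * (sin ((\<theta> - \<theta>') / 2))\<^sup>2"
proof -
  have half: "1 - cos x = 2 * (sin (x / 2))\<^sup>2" for x :: real
    using cos_double_sin[of "x / 2"] by simp
  have "(norm (T (\<phi>, \<theta>) - T (\<phi>', \<theta>')))\<^sup>2 =
      T (\<phi>, \<theta>) \<bullet> T (\<phi>, \<theta>) + T (\<phi>', \<theta>') \<bullet> T (\<phi>', \<theta>') - 2 * (T (\<phi>, \<theta>) \<bullet> T (\<phi>', \<theta>'))"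
    by (simp add: power2_norm_eq_inner inner_diff_left inner_diff_right inner_commute)
  also have "\<dots> = 2 - 2 * (T (\<phi>, \<theta>) \<bullet> T (\<phi>', \<theta>'))"
    using norm_torus_cover by (simp add: dot_square_norm)
  also have "\<dots> = (1 - cos (\<phi> - \<phi>')) + (1 - cos (\<theta> - \<theta>'))"
    unfolding torus_cover_eq lincomb_inner cos_diff by (simp add: field_simps)
  finally show ?thesis unfolding half .
qed

lemma torus_cover_lipschitz: "norm (T (\<phi>, \<theta>) - T (\<phi>', \<theta>')) \<le> \<bar>\<phi> - \<phi>'\<bar> + \<bar>\<theta> - \<theta>'\<bar>"
proof (rule power2_le_imp_le)
  have s: "(sin (x / 2))\<^sup>2 \<le> x\<^sup>2 / 4" for x :: real
  proof -
    have "\<bar>sin (x / 2)\<bar> \<le> \<bar>x / 2\<bar>" by (rule abs_sin_x_le_abs_x)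
    hence "\<bar>sin (x / 2)\<bar>\<^sup>2 \<le> \<bar>x / 2\<bar>\<^sup>2" by (intro power_mono) auto
    thus ?thesis by (simp add: power_divide)
  qed
  have "(norm (T (\<phi>, \<theta>) - T (\<phi>', \<theta>')))\<^sup>2 \<le> (\<phi> - \<phi>')\<^sup>2 + (\<theta> - \<theta>')\<^sup>2"
    unfolding torus_chord using s[of "\<phi> - \<phi>'"] s[of "\<theta> - \<theta>'"]
      zero_le_power2[of "\<phi> - \<phi>'"] zero_le_power2[of "\<theta> - \<theta>'"] by linarith
  also have "\<dots> \<le> (\<bar>\<phi> - \<phi>'\<bar> + \<bar>\<theta> - \<theta>'\<bar>)\<^sup>2"
    by (simp add: power2_sum)
  finally show "(norm (T (\<phi>, \<theta>) - T (\<phi>', \<theta>')))\<^sup>2 \<le> (\<bar>\<phi> - \<phi>'\<bar> + \<bar>\<theta> - \<theta>'\<bar>)\<^sup>2" .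
qed auto

lemma torus_angle_le:
  assumes "\<bar>\<phi> - \<phi>'\<bar> \<le> pi" "\<bar>\<theta> - \<theta>'\<bar> \<le> pi"
  shows "\<bar>\<phi> - \<phi>'\<bar> \<le> 4 * norm (T (\<phi>, \<theta>) - T (\<phi>', \<theta>'))" "\<bar>\<theta> - \<theta>'\<bar> \<le> 4 * norm (T (\<phi>, \<theta>) - T (\<phi>', \<theta>'))"
proof -
  let ?N = "norm (T (\<phi>, \<theta>) - T (\<phi>', \<theta>'))"
  have "(\<phi> - \<phi>')\<^sup>2 \<le> 16 * ?N\<^sup>2" "(\<theta> - \<theta>')\<^sup>2 \<le> 16 * ?N\<^sup>2"
    using angle_le_chord[OF assms(1)] angle_le_chord[OF assms(2)] torus_chord[of \<phi> \<theta> \<phi>' \<theta>']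
      zero_le_power2[of "sin ((\<phi> - \<phi>') / 2)"] zero_le_power2[of "sin ((\<theta> - \<theta>') / 2)"] by linarith+
  hence "\<bar>\<phi> - \<phi>'\<bar>\<^sup>2 \<le> (4 * ?N)\<^sup>2" "\<bar>\<theta> - \<theta>'\<bar>\<^sup>2 \<le> (4 * ?N)\<^sup>2"
    by (simp_all add: power_mult_distrib)
  thus "\<bar>\<phi> - \<phi>'\<bar> \<le> 4 * ?N" "\<bar>\<theta> - \<theta>'\<bar> \<le> 4 * ?N"
    using power2_le_imp_le[of "\<bar>\<phi> - \<phi>'\<bar>" "4 * ?N"] power2_le_imp_le[of "\<bar>\<theta> - \<theta>'\<bar>" "4 * ?N"]
      norm_ge_zero[of "T (\<phi>, \<theta>) - T (\<phi>', \<theta>')"] by auto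
qed

lemma torus_cover_representative:
  obtains \<phi>' \<theta>' where "\<bar>\<phi>' - a\<bar> \<le> pi" "\<bar>\<theta>' - a'\<bar> \<le> pi" "T (\<phi>', \<theta>') = T z"
proof -
  obtain \<phi>' where 1: "\<bar>\<phi>' - a\<bar> \<le> pi" "sin \<phi>' = sin (fst z)" "cos \<phi>' = cos (fst z)"
    using angle_representative by metis
  obtain \<theta>' where 2: "\<bar>\<theta>' - a'\<bar> \<le> pi" "sin \<theta>' = sin (snd z)" "cos \<theta>' = cos (snd z)"
    using angle_representative by metis
  have "T (\<phi>', \<theta>') = T z" using 1 2 torus_cover_eq[of "fst z" "snd z"] by (simp add: torus_cover_eq)
  thus ?thesis using that 1(1) 2(1) by blast
qed

text \<open>The angles within \<open>pi\<close> of \<open>pi\<close> fill exactly the square of the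
  definition.\<close>

lemma clifford_torus_eq_range: "clifford_torus e = range T"
proof
  show "range T \<subseteq> clifford_torus e"
  proof
    fix q assume "q \<in> range T"
    then obtain z where z: "q = T z" by blast
    obtain \<phi>' \<theta>' where "\<bar>\<phi>' - pi\<bar> \<le> pi" "\<bar>\<theta>' - pi\<bar> \<le> pi" "T (\<phi>', \<theta>') = T z"
      using torus_cover_representative[of pi pi z] by metis
    thus "q \<in> clifford_torus e" unfolding clifford_torus_def z
      by (intro image_eqI[of _ _ "(\<phi>', \<theta>')"]) (auto simp: abs_le_iff)
  qed
qed (auto simp: clifford_torus_def)

lemma torus_in_ball2: "clifford_torus e \<subseteq> ball2"
  using norm_torus_cover by (auto simp: clifford_torus_eq_range)

text \<open>Angle differences are at most 4 times the chord, hence below 3 and so below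
  \<open>pi\<close>. The strict inequality places the point in the open square of angles that the
  definition of the volume uses.\<close>

lemma torus_near:
  assumes "q \<in> clifford_torus e" "norm (q - T (\<phi>1, \<theta>1)) < 3 / 4"
  obtains \<phi> \<theta> where "q = T (\<phi>, \<theta>)" "\<bar>\<phi> - \<phi>1\<bar> < pi" "\<bar>\<theta> - \<theta>1\<bar> < pi"
proof -
  obtain z where z: "q = T z" using assms(1) by (auto simp: clifford_torus_eq_range)
  obtain \<phi> \<theta> where *: "\<bar>\<phi> - \<phi>1\<bar> \<le> pi" "\<bar>\<theta> - \<theta>1\<bar> \<le> pi" "T (\<phi>, \<theta>) = T z"
    using torus_cover_representative[of \<phi>1 \<theta>1 z] by metis
  have "\<bar>\<phi> - \<phi>1\<bar> < pi" "\<bar>\<theta> - \<theta>1\<bar> < pi"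
    using torus_angle_le[OF *(1,2)] assms(2) pi_gt3 unfolding z *(3) by linarith+
  thus ?thesis using that[of \<phi> \<theta>] *(3) z by simp
qed

lemma has_derivative_torus_cover:
  "(T has_derivative (\<lambda>a. (1 / sqrt 2) *\<^sub>R ((fst a * cos (fst z)) *\<^sub>R ax 1 + (- (fst a * sin (fst z))) *\<^sub>R ax 2
     + (snd a * cos (snd z)) *\<^sub>R ax 3 + (- (snd a * sin (snd z))) *\<^sub>R ax 4))) (at z)"
  unfolding torus_cover_def case_prod_unfold
  by (auto intro!: derivative_eq_intros simp: mult_ac)

lemma torus_cover_deriv_eq:
  "torus_cover_deriv e z a = (1 / sqrt 2) *\<^sub>R ((fst a * cos (fst z)) *\<^sub>R ax 1 + (- (fst a * sin (fst z))) *\<^sub>R ax 2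
     + (snd a * cos (snd z)) *\<^sub>R ax 3 + (- (snd a * sin (snd z))) *\<^sub>R ax 4)"
  unfolding torus_cover_deriv_def by (simp add: frechet_derivative_at[OF has_derivative_torus_cover, symmetric])

lemma torus_cover_deriv_inner:
  "torus_cover_deriv e z a \<bullet> torus_cover_deriv e z a' = (fst a * fst a' + snd a * snd a') / 2"
proof -
  have c: "cos x * cos x = 1 - sin x * sin x" for x :: real using sin_cos_squared_add3[of x] by linarith
  show ?thesis unfolding torus_cover_deriv_eq lincomb_inner by (simp add: c algebra_simps)
qed

text \<open>The linear map that is tangent to the leaves of slope \<open>s\<close> at every point of the torus.\<close>

definition leaf_direction :: "real \<Rightarrow> real ^ 'n \<Rightarrow> real ^ 'n" where
  "leaf_direction s q = (q \<bullet> ax 2) *\<^sub>R ax 1 - (q \<bullet> ax 1) *\<^sub>R ax 2 + (s * (q \<bullet> ax 4)) *\<^sub>R ax 3 - (s * (q \<bullet> ax 3)) *\<^sub>R ax 4"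

lemma torus_cover_inner_ax:
  "T z \<bullet> ax 1 = sin (fst z) / sqrt 2" "T z \<bullet> ax 2 = cos (fst z) / sqrt 2"
  "T z \<bullet> ax 3 = sin (snd z) / sqrt 2" "T z \<bullet> ax 4 = cos (snd z) / sqrt 2"
  by (cases z; simp add: torus_cover_eq inner_add_left ax_inner)+

lemma leaf_direction_torus: "leaf_direction s (T z) = torus_cover_deriv e z (1, s)"
  unfolding leaf_direction_def torus_cover_deriv_eq torus_cover_inner_ax by (simp add: algebra_simps)

lemma leaf_direction_nonzero: "q \<in> clifford_torus e \<Longrightarrow> leaf_direction s q \<noteq> 0"
proof
  assume "q \<in> clifford_torus e" and 0: "leaf_direction s q = 0"
  then obtain z where z: "q = T z" by (auto simp: clifford_torus_eq_range)
  have "leaf_direction s q \<bullet> leaf_direction s q = (1 + s * s) / 2"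
    unfolding z leaf_direction_torus torus_cover_deriv_inner by simp
  moreover have "1 + s * s > 0" using zero_le_square[of s] by linarith
  ultimately show False unfolding 0 by simp
qed

lemma continuous_on_leaf_direction: "continuous_on S (leaf_direction s)"
  unfolding leaf_direction_def by (intro continuous_intros)

text \<open>All leaves and parameters that reach \<open>q\<close> have the same velocity there, as
  \<open>leaf_direction\<close> depends on the point only. Conversely the line of slope
  \<open>s\<close> through the angles of \<open>q\<close> is a leaf.\<close>

lemma foliation_tangent_eq:
  assumes F: "F = {(\<lambda>r. T (r, s * r + t)) | t. True}" and q: "q \<in> clifford_torus e"
  shows "foliation_tangent F q = range (\<lambda>a. a *\<^sub>R leaf_direction s q)"
proof -
  have d: "vector_derivative (\<lambda>r. T (r, s * r + t)) (at r) = leaf_direction s (T (r, s * r + t))" for r t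
  proof (rule vector_derivative_at)
    have "((\<lambda>r. (r, s * r + t)) has_vector_derivative (1, s)) (at r)"
      by (auto intro!: derivative_eq_intros has_vector_derivative_Pair)
    from has_vector_derivative_compose[OF this, OF has_derivative_torus_cover]
    show "((\<lambda>r. T (r, s * r + t)) has_vector_derivative leaf_direction s (T (r, s * r + t))) (at r)"
      unfolding leaf_direction_torus torus_cover_deriv_eq .
  qed
  show ?thesis
  proof
    show "foliation_tangent F q \<subseteq> range (\<lambda>a. a *\<^sub>R leaf_direction s q)"
      unfolding foliation_tangent_def F using d by force
    show "range (\<lambda>a. a *\<^sub>R leaf_direction s q) \<subseteq> foliation_tangent F q"
    proof
      fix v assume "v \<in> range (\<lambda>a. a *\<^sub>R leaf_direction s q)"
      then obtain a where a: "v = a *\<^sub>R leaf_direction s q" by blast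
      obtain \<phi> \<theta> where z: "q = T (\<phi>, \<theta>)" using q by (auto simp: clifford_torus_eq_range)
      define \<gamma> where "\<gamma> = (\<lambda>r. T (r, s * r + (\<theta> - s * \<phi>)))"
      have "\<gamma> \<phi> = q" by (simp add: \<gamma>_def z)
      moreover have "\<gamma> \<in> F" unfolding F \<gamma>_def by blast
      moreover have "v = a *\<^sub>R vector_derivative \<gamma> (at \<phi>)" unfolding a \<gamma>_def d by (simp add: z)
      ultimately show "v \<in> foliation_tangent F q" unfolding foliation_tangent_def by blast
    qed
  qed
qed

end

section \<open>Volume of coordinate balls\<close>

locale torus_product_volume_measure = riemannian_ball_product m b A h g + torus_in_ball e
  for m :: nat and b :: "nat \<Rightarrow> 'e::euclidean_space"
    and A :: "('p::{t2_space,second_countable_topology}, 'e) chart set"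
    and h :: "'p \<Rightarrow> ('p, 'e) tvec \<Rightarrow> ('p, 'e) tvec \<Rightarrow> real"
    and g :: "('n::finite) ball_metric" and e :: "nat \<Rightarrow> 'n" +
  fixes \<mu> :: "('p \<times> (real ^ 'n)) measure"
  assumes flat: "induces_flat_torus_metric e g"
    and volume: "torus_product_volume m b A h g e \<mu>"
begin

abbreviation torus_product :: "('p \<times> (real ^ 'n)) set" where "torus_product \<equiv> UNIV \<times> clifford_torus e"

abbreviation param :: "('p, 'e) chart \<Rightarrow> (nat \<Rightarrow> real) \<Rightarrow> 'p \<times> (real ^ 'n)" where
  "param c z \<equiv> torus_product_param m b e c z"

lemma space_volume: "space \<mu> = torus_product"
  and sets_volume: "sets \<mu> = sets (restrict_space borel torus_product)"
  using volume unfolding torus_product_volume_def by simp_all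

lemma open_Int_in_sets_volume: "open U \<Longrightarrow> U \<inter> torus_product \<in> sets \<mu>"
  unfolding sets_volume sets_restrict_space by (auto simp: Int_commute)

text \<open>The Gram matrix is block diagonal and depends only on the manifold point: the metric on
  the torus is flat, and the cover has speed \<open>1 / sqrt 2\<close> in each angle, whence the
  entries 1 / 2.\<close>

definition gram_coeff :: "('p, 'e) chart \<Rightarrow> 'p \<Rightarrow> nat \<Rightarrow> nat \<Rightarrow> real" where
  "gram_coeff c p i j = (if i < m \<and> j < m then metric_coeff c p i j else if i = j then 1 / 2 else 0)"

lemma gram_coeff_eq:
  assumes "c \<in> A" "model_point m b z \<in> snd c ` fst c" "i < m + 2" "j < m + 2"
  shows "product_metric h g (param c z) (torus_product_frame m b A e c z i) (torus_product_frame m b A e c z j) =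
    gram_coeff c (fst (param c z)) i j"
proof -
  let ?p = "the_inv_into (fst c) (snd c) (model_point m b z)"
  let ?q = "T (z m, z (Suc m))"
  have p: "?p \<in> fst c" using chart_inv_in[OF assms(1,2)] by (simp add: chart_inv_def)
  have q: "?q \<in> clifford_torus e" by (auto simp: clifford_torus_eq_range)
  have q2: "?q \<in> ball2" using q torus_in_ball2 by blast
  have h0: "h ?p v 0 = 0" "h ?p 0 v = 0" if "v \<in> tangent_space m b A ?p" for v
    using inner_product_on_zero[OF inner_product_h subspace_tangent_space that] by simp_all
  have h00: "h ?p 0 0 = 0" using h0[OF subspace_0[OF subspace_tangent_space]] by simp
  have g0: "g ?q v 0 = 0" "g ?q 0 v = 0" for v
    using inner_product_on_zero[OF inner_product_g[OF q2] subspace_UNIV UNIV_I] by simp_all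
  have cv: "coordinate_vector A c ?p (b i) \<in> tangent_space m b A ?p" if "i < m" for i
    by (rule coordinate_vector_in_tangent_space[OF assms(1) p b_in_E0[OF that]])
  have gt: "g ?q (torus_cover_deriv e (z m, z (Suc m)) a) (torus_cover_deriv e (z m, z (Suc m)) a') = (fst a * fst a' + snd a * snd a') / 2" for a a'
  proof -
    have "torus_cover_deriv e (z m, z (Suc m)) a \<in> torus_tangent_space e ?q" for a
      unfolding torus_tangent_space_def by blast
    thus ?thesis using flat q torus_cover_deriv_inner unfolding induces_flat_torus_metric_def by metis
  qed
  have "i < m \<or> i = m \<or> i = Suc m" "j < m \<or> j = m \<or> j = Suc m" using assms(3,4) by auto
  thus ?thesis
    by (elim disjE)
      (simp_all add: torus_product_param_def torus_product_frame_def product_metric_def gram_coeff_def metric_coeff_def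
        g0 h0 h00 cv gt)
qed

text \<open>The volume is specified on sets over open angle squares of side \<open>2 * pi\<close>.
  By \<open>torus_near\<close> a set within 3 / 4 of a point of the torus lies over the square
  centred at the angles of that point.\<close>

lemma volume_chart:
  assumes c: "c \<in> A" and D: "D \<in> sets \<mu>"
    and sub: "\<And>y. y \<in> D \<Longrightarrow> fst y \<in> fst c \<and> norm (snd y - T (\<phi>1, \<theta>1)) < 3 / 4"
  shows "emeasure \<mu> D = (\<integral>\<^sup>+z. indicator {z. model_point m b z \<in> snd c ` fst c \<and>
      \<bar>z m - \<phi>1\<bar> < pi \<and> \<bar>z (Suc m) - \<theta>1\<bar> < pi \<and> param c z \<in> D} z *
      ennreal (sqrt (gram_det (m + 2) (gram_coeff c (fst (param c z))))) \<partial>lebesgue_Rk (m + 2))"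
proof -
  have "D \<subseteq> fst c \<times> T ` ({\<phi>1 - pi<..<\<phi>1 - pi + 2 * pi} \<times> {\<theta>1 - pi<..<\<theta>1 - pi + 2 * pi})"
  proof
    fix y assume y: "y \<in> D"
    have "y \<in> torus_product" using sets.sets_into_space[OF D] y space_volume by auto
    then obtain \<phi> \<theta> where "snd y = T (\<phi>, \<theta>)" "\<bar>\<phi> - \<phi>1\<bar> < pi" "\<bar>\<theta> - \<theta>1\<bar> < pi"
      using torus_near[of "snd y" \<phi>1 \<theta>1] sub[OF y] by (metis mem_Times_iff)
    thus "y \<in> fst c \<times> T ` ({\<phi>1 - pi<..<\<phi>1 - pi + 2 * pi} \<times> {\<theta>1 - pi<..<\<theta>1 - pi + 2 * pi})"
      using sub[OF y] by (auto simp: mem_Times_iff abs_less_iff intro!: image_eqI[of _ _ "(\<phi>, \<theta>)"])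
  qed
  hence "emeasure \<mu> D =
          (\<integral>\<^sup>+z. indicator {z. model_point m b z \<in> snd c ` fst c \<and>
                            z m \<in> {\<phi>1 - pi<..<\<phi>1 - pi + 2 * pi} \<and> z (Suc m) \<in> {\<theta>1 - pi<..<\<theta>1 - pi + 2 * pi} \<and>
                            torus_product_param m b e c z \<in> D} z
                 * ennreal (sqrt (gram_det (m + 2) (\<lambda>i j.
                     product_metric h g (torus_product_param m b e c z)
                       (torus_product_frame m b A e c z i) (torus_product_frame m b A e c z j))))
             \<partial>lebesgue_Rk (m + 2))"
    using volume c D unfolding torus_product_volume_def by blast
  also have "\<dots> = (\<integral>\<^sup>+z. indicator {z. model_point m b z \<in> snd c ` fst c \<and>
      \<bar>z m - \<phi>1\<bar> < pi \<and> \<bar>z (Suc m) - \<theta>1\<bar> < pi \<and> param c z \<in> D} z *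
      ennreal (sqrt (gram_det (m + 2) (gram_coeff c (fst (param c z))))) \<partial>lebesgue_Rk (m + 2))"
  proof (rule nn_integral_cong)
    fix z :: "nat \<Rightarrow> real"
    have iff: "x \<in> {a - pi<..<a - pi + 2 * pi} \<longleftrightarrow> \<bar>x - a\<bar> < pi" for x a :: real by auto
    have "gram_det (m + 2) (\<lambda>i j. product_metric h g (param c z)
         (torus_product_frame m b A e c z i) (torus_product_frame m b A e c z j)) = gram_det (m + 2) (gram_coeff c (fst (param c z)))"
      if "model_point m b z \<in> snd c ` fst c"
    proof -
      have "(\<Prod>i<m + 2. product_metric h g (param c z) (torus_product_frame m b A e c z i) (torus_product_frame m b A e c z (p i))) =
          (\<Prod>i<m + 2. gram_coeff c (fst (param c z)) i (p i))" if p: "p permutes {..<m + 2}" for p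
      proof (rule prod.cong[OF refl])
        fix i assume "i \<in> {..<m + 2}"
        moreover from this have "p i < m + 2" using permutes_in_image[OF p, of i] by simp
        ultimately show "product_metric h g (param c z) (torus_product_frame m b A e c z i) (torus_product_frame m b A e c z (p i)) =
            gram_coeff c (fst (param c z)) i (p i)"
          using gram_coeff_eq[OF c \<open>model_point m b z \<in> snd c ` fst c\<close>] by simp
      qed
      thus ?thesis unfolding gram_det_def by (intro sum.cong) simp_all
    qed
    thus "indicator {z. model_point m b z \<in> snd c ` fst c \<and>
                            z m \<in> {\<phi>1 - pi<..<\<phi>1 - pi + 2 * pi} \<and> z (Suc m) \<in> {\<theta>1 - pi<..<\<theta>1 - pi + 2 * pi} \<and>
                            torus_product_param m b e c z \<in> D} z
                 * ennreal (sqrt (gram_det (m + 2) (\<lambda>i j.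
                     product_metric h g (torus_product_param m b e c z)
                       (torus_product_frame m b A e c z i) (torus_product_frame m b A e c z j)))) =
        indicator {z. model_point m b z \<in> snd c ` fst c \<and>
      \<bar>z m - \<phi>1\<bar> < pi \<and> \<bar>z (Suc m) - \<theta>1\<bar> < pi \<and> param c z \<in> D} z *
      ennreal (sqrt (gram_det (m + 2) (gram_coeff c (fst (param c z)))))"
      unfolding iff by (auto simp: indicator_def)
  qed
  finally show ?thesis .
qed

lemma gram_coeff_pos:
  assumes "c \<in> A" "p \<in> fst c"
  shows "gram_det (m + 2) (gram_coeff c p) > 0"
proof (rule gram_det_pos)
  fix a :: "nat \<Rightarrow> real" assume a: "\<exists>i<m + 2. a i \<noteq> 0"
  \<comment> \<open>With zero component in the ball, \<open>coord_form\<close> is the quadratic form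
    of the manifold alone, so \<open>coord_form_pos\<close> yields its positivity; the origin serves
    as an arbitrary point of the ball.\<close>
  let ?v = "(model_point m b a, 0 :: real ^ 'n)"
  have cf: "coord_form c (p, 0) ?v = (\<Sum>i<m. \<Sum>j<m. a i * a j * metric_coeff c p i j)"
    by (simp add: coord_form_def model_point_inner)
  have "(\<Sum>i<m + 2. \<Sum>j<m + 2. a i * a j * gram_coeff c p i j) =
      (\<Sum>i<m. \<Sum>j<m. a i * a j * metric_coeff c p i j) + ((a m)\<^sup>2 + (a (Suc m))\<^sup>2) / 2"
    by (simp add: gram_coeff_def numeral_2_eq_2 power2_eq_square)
  also have "\<dots> > 0"
  proof (cases "\<exists>i<m. a i \<noteq> 0")
    case True
    then obtain i where "i < m" "model_point m b a \<bullet> b i \<noteq> 0" using model_point_inner by auto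
    hence "?v \<noteq> 0" by (auto simp: zero_prod_def)
    hence "coord_form c (p, 0) ?v > 0"
      using assms by (intro coord_form_pos) (simp_all add: model_point_in_E0)
    thus ?thesis unfolding cf by (intro add_pos_nonneg) auto
  next
    case False
    then obtain i where "i < m + 2" "\<not> i < m" "a i \<noteq> 0" using a by blast
    hence "a m \<noteq> 0 \<or> a (Suc m) \<noteq> 0" by (metis Suc_less_eq add_2_eq_Suc' less_SucE)
    hence "(a m)\<^sup>2 + (a (Suc m))\<^sup>2 > 0" by (simp add: sum_power2_gt_zero_iff)
    thus ?thesis using False by simp
  qed
  finally show "(\<Sum>i<m + 2. \<Sum>j<m + 2. a i * a j * gram_coeff c p i j) > 0" .
qed

lemma continuous_on_gram_coeff:
  assumes "c \<in> A" shows "continuous_on (fst c) (\<lambda>p. gram_det (m + 2) (gram_coeff c p))"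
proof (rule continuous_on_gram_det)
  fix i j assume "i < m + 2" "j < m + 2"
  show "continuous_on (fst c) (\<lambda>p. gram_coeff c p i j)"
    unfolding gram_coeff_def using continuous_on_metric_coeff[OF assms]
    by (cases "i < m \<and> j < m") (auto intro: continuous_on_const)
qed

lemma emeasure_box:
  "emeasure (lebesgue_Rk k) (PiE {..<k} (\<lambda>i. {l i..u i})) = (\<Prod>i<k. ennreal (if l i \<le> u i then u i - l i else 0))"
  "PiE {..<k} (\<lambda>i. {l i..u i}) \<in> sets (lebesgue_Rk k)"
proof -
  interpret product_sigma_finite "\<lambda>_ :: nat. lborel :: real measure" ..
  have "emeasure (lebesgue_Rk k) (PiE {..<k} (\<lambda>i. {l i..u i})) = (\<Prod>i<k. emeasure lborel {l i..u i})"
    unfolding lebesgue_Rk_def by (rule emeasure_PiM) simp_all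
  also have "\<dots> = (\<Prod>i<k. ennreal (if l i \<le> u i then u i - l i else 0))"
    by (intro prod.cong refl) (simp add: emeasure_lborel_Icc_eq)
  finally show "emeasure (lebesgue_Rk k) (PiE {..<k} (\<lambda>i. {l i..u i})) = (\<Prod>i<k. ennreal (if l i \<le> u i then u i - l i else 0))" .
  show "PiE {..<k} (\<lambda>i. {l i..u i}) \<in> sets (lebesgue_Rk k)"
    unfolding lebesgue_Rk_def by (intro sets_PiM_I_finite) simp_all
qed

definition coord_ball :: "('p, 'e) chart \<Rightarrow> 'e \<times> (real ^ 'n) \<Rightarrow> real \<Rightarrow> ('p \<times> (real ^ 'n)) set" where
  "coord_ball c w R = {y. fst y \<in> fst c \<and> norm (product_chart c y - w) < R}"

lemma open_coord_ball: "c \<in> A \<Longrightarrow> open (coord_ball c w R)"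
proof -
  assume c: "c \<in> A"
  have op: "open (fst c \<times> (UNIV :: (real ^ 'n) set))" by (intro open_Times open_chart[OF c] open_UNIV)
  have "continuous_on (fst c \<times> (UNIV :: (real ^ 'n) set)) (product_chart c)"
    unfolding product_chart_def
    by (intro continuous_intros continuous_on_compose2[OF continuous_on_chart[OF c]]) auto
  hence "open (product_chart c -` ball w R \<inter> (fst c \<times> UNIV))"
    using continuous_on_open_vimage[OF op] by blast
  moreover have "product_chart c -` ball w R \<inter> (fst c \<times> UNIV) = coord_ball c w R"
    by (auto simp: coord_ball_def dist_norm norm_minus_commute)
  ultimately show ?thesis by simp
qed

text \<open>In coordinates the set lies in a box with \<open>m\<close> sides \<open>2 * R\<close>
  and two sides \<open>16 * R\<close>. The condition on \<open>dist y0 (fst w) + R\<close> keeps it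
  over a compact set, on which the density is bounded by a constant independent of \<open>w\<close>
  and \<open>R\<close>.\<close>

lemma volume_coord_ball_le:
  assumes c: "c \<in> A" and \<rho>: "cball y0 \<rho> \<inter> E0 \<subseteq> snd c ` fst c"
  obtains K where "K \<ge> 0" "\<And>w R. 0 < R \<Longrightarrow> R \<le> 1 / 4 \<Longrightarrow> dist y0 (fst w) + R \<le> \<rho> \<Longrightarrow>
    emeasure \<mu> (coord_ball c w R \<inter> torus_product) \<le> ennreal (K * R ^ (m + 2))"
proof -
  let ?K = "chart_inv c ` (cball y0 \<rho> \<inter> E0)"
  have K: "compact ?K" "?K \<subseteq> fst c" using compact_chart_ball[OF c \<rho>] .
  have "compact ((\<lambda>p. gram_det (m + 2) (gram_coeff c p)) ` ?K)"
    by (intro compact_continuous_image K continuous_on_subset[OF continuous_on_gram_coeff[OF c] K(2)])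
  then obtain M where M: "\<And>p. p \<in> ?K \<Longrightarrow> gram_det (m + 2) (gram_coeff c p) \<le> M"
    using compact_imp_bounded bounded_imp_bdd_above unfolding bdd_above_def by (metis image_eqI)
  define C where "C = sqrt (max 0 M)"
  have C: "C \<ge> 0" by (simp add: C_def)
  show ?thesis
  proof (rule that[of "C * (2 ^ m * 16\<^sup>2)"])
    show "C * (2 ^ m * 16\<^sup>2) \<ge> 0" using C by simp
    fix w :: "'e \<times> (real ^ 'n)" and R :: real
    assume R: "0 < R" "R \<le> 1 / 4" "dist y0 (fst w) + R \<le> \<rho>"
    let ?D = "coord_ball c w R \<inter> torus_product"
    show "emeasure \<mu> ?D \<le> ennreal (C * (2 ^ m * 16\<^sup>2) * R ^ (m + 2))"
    proof (cases "?D = {}")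
      case False
      \<comment> \<open>The centre \<open>w\<close> need not lie on the torus, so angles are
        measured from a point \<open>y1\<close> of the set itself. Torus components of the set are
        within \<open>2 * R\<close> of it, thus within 1 / 2 and in the range of
        \<open>volume_chart\<close>.\<close>
      then obtain y1 where y1: "y1 \<in> ?D" by blast
      then obtain z1 where "snd y1 = T z1" by (auto simp: clifford_torus_eq_range)
      then obtain \<phi>1 \<theta>1 where s1: "snd y1 = T (\<phi>1, \<theta>1)" by (cases z1) simp
      have comp: "dist (fst w) (snd c (fst y)) < R" "dist (snd w) (snd y) < R" if "y \<in> ?D" for y
      proof -
        have lt: "dist w (product_chart c y) < R"
          using that by (simp add: coord_ball_def dist_norm norm_minus_commute)
        have "fst (product_chart c y) = snd c (fst y)" "snd (product_chart c y) = snd y"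
          by (simp_all add: product_chart_def)
        thus "dist (fst w) (snd c (fst y)) < R" "dist (snd w) (snd y) < R"
          using le_less_trans[OF dist_fst_le lt] le_less_trans[OF dist_snd_le lt] by simp_all
      qed
      have near: "norm (snd y - T (\<phi>1, \<theta>1)) < 2 * R" if "y \<in> ?D" for y
        using comp(2)[OF that] comp(2)[OF y1] dist_triangle3[of "snd y" "T (\<phi>1, \<theta>1)" "snd w"]
        unfolding s1 dist_norm[symmetric] by linarith
      \<comment> \<open>A chord below \<open>2 * R\<close> bounds the angle differences by
        \<open>4 * (2 * R)\<close>.\<close>
      define l where "l = (\<lambda>i. if i < m then fst w \<bullet> b i - R else if i = m then \<phi>1 - 8 * R else \<theta>1 - 8 * R)"
      define u where "u = (\<lambda>i. if i < m then fst w \<bullet> b i + R else if i = m then \<phi>1 + 8 * R else \<theta>1 + 8 * R)"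
      let ?B = "PiE {..<m + 2} (\<lambda>i. {l i..u i})"
      have DS: "?D \<in> sets \<mu>" using open_Int_in_sets_volume[OF open_coord_ball[OF c]] .
      have sub: "fst y \<in> fst c \<and> norm (snd y - T (\<phi>1, \<theta>1)) < 3 / 4" if "y \<in> ?D" for y
        using near[OF that] R(2) that by (auto simp: coord_ball_def)
      have "emeasure \<mu> ?D = (\<integral>\<^sup>+z. indicator {z. model_point m b z \<in> snd c ` fst c \<and>
          \<bar>z m - \<phi>1\<bar> < pi \<and> \<bar>z (Suc m) - \<theta>1\<bar> < pi \<and> param c z \<in> ?D} z *
          ennreal (sqrt (gram_det (m + 2) (gram_coeff c (fst (param c z))))) \<partial>lebesgue_Rk (m + 2))"
        by (rule volume_chart[OF c DS sub])
      also have "\<dots> \<le> (\<integral>\<^sup>+z. ennreal C * indicator ?B z \<partial>lebesgue_Rk (m + 2))"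
      proof (rule nn_integral_mono)
        fix z assume "z \<in> space (lebesgue_Rk (m + 2))"
        hence ext: "z \<in> extensional {..<m + 2}" by (auto simp: lebesgue_Rk_def space_PiM PiE_def)
        show "indicator {z. model_point m b z \<in> snd c ` fst c \<and>
          \<bar>z m - \<phi>1\<bar> < pi \<and> \<bar>z (Suc m) - \<theta>1\<bar> < pi \<and> param c z \<in> ?D} z *
          ennreal (sqrt (gram_det (m + 2) (gram_coeff c (fst (param c z))))) \<le> ennreal C * indicator ?B z"
        proof (cases "z \<in> {z. model_point m b z \<in> snd c ` fst c \<and> \<bar>z m - \<phi>1\<bar> < pi \<and> \<bar>z (Suc m) - \<theta>1\<bar> < pi \<and> param c z \<in> ?D}")
          case True
          hence z: "model_point m b z \<in> snd c ` fst c" "\<bar>z m - \<phi>1\<bar> < pi" "\<bar>z (Suc m) - \<theta>1\<bar> < pi" "param c z \<in> ?D"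
            unfolding mem_Collect_eq by simp_all
          have p: "snd c (fst (param c z)) = model_point m b z" "fst (param c z) = chart_inv c (model_point m b z)"
            using chart_chart_inv[OF c z(1)] by (simp_all add: torus_product_param_def chart_inv_def)
          have q: "snd (param c z) = T (z m, z (Suc m))" by (simp add: torus_product_param_def)
          have dist1: "dist (fst w) (model_point m b z) < R" using comp(1)[OF z(4)] p(1) by simp
          have "z \<in> ?B"
          proof (rule PiE_I)
            fix i assume "i \<in> {..<m + 2}"
            hence "i < m \<or> i = m \<or> i = Suc m" by auto
            thus "z i \<in> {l i..u i}"
            proof (elim disjE)
              assume i: "i < m"
              have "\<bar>(fst w - model_point m b z) \<bullet> b i\<bar> \<le> norm (fst w - model_point m b z)"
                by (rule Basis_le_norm[OF b_Basis[OF i]])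
              hence "\<bar>fst w \<bullet> b i - z i\<bar> \<le> R"
                using dist1 by (simp add: inner_diff_left model_point_inner[OF i] dist_norm)
              thus ?thesis using i by (auto simp: l_def u_def abs_le_iff)
            next
              assume i: "i = m"
              show ?thesis using i torus_angle_le(1)[OF less_imp_le[OF z(2)] less_imp_le[OF z(3)]] near[OF z(4)]
                unfolding q by (auto simp: l_def u_def abs_le_iff)
            next
              assume i: "i = Suc m"
              show ?thesis using i torus_angle_le(2)[OF less_imp_le[OF z(2)] less_imp_le[OF z(3)]] near[OF z(4)]
                unfolding q by (auto simp: l_def u_def abs_le_iff)
            qed
          qed (use ext in \<open>auto simp: extensional_def\<close>)
          moreover have "sqrt (gram_det (m + 2) (gram_coeff c (fst (param c z)))) \<le> C"
          proof -
            have "dist y0 (model_point m b z) \<le> \<rho>"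
              using R(3) dist1 dist_triangle[of y0 "model_point m b z" "fst w"] by linarith
            hence "fst (param c z) \<in> ?K" unfolding p(2) using model_point_in_E0 by auto
            from M[OF this] show ?thesis unfolding C_def by (intro real_sqrt_le_mono) linarith
          qed
          ultimately show ?thesis unfolding indicator_simps(1)[OF True] by (simp add: ennreal_leI)
        next
          case False
          show ?thesis unfolding indicator_simps(2)[OF False] by simp
        qed
      qed
      also have "\<dots> = ennreal C * (\<Prod>i<m + 2. ennreal (if l i \<le> u i then u i - l i else 0))"
        by (subst nn_integral_cmult_indicator[OF emeasure_box(2)]) (simp add: emeasure_box(1))
      also have "(\<Prod>i<m + 2. ennreal (if l i \<le> u i then u i - l i else 0)) = ennreal ((2 * R) ^ m * (16 * R)\<^sup>2)"
      proof -
        have "(\<Prod>i<m + 2. ennreal (if l i \<le> u i then u i - l i else 0)) =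
            (\<Prod>i<m. ennreal (2 * R)) * ennreal (16 * R) * ennreal (16 * R)"
          using R(1) by (simp add: numeral_2_eq_2 l_def u_def)
        also have "\<dots> = ennreal ((2 * R) ^ m * (16 * R)\<^sup>2)"
        proof -
          have R2: "0 \<le> 2 * R" "0 \<le> 16 * R" using R(1) by simp_all
          show ?thesis
            by (simp only: prod_constant card_lessThan ennreal_power[OF R2(1)] ennreal_mult'[OF zero_le_power[OF R2(1)]]
                ennreal_mult'[OF R2(2)] power2_eq_square) (simp only: mult.assoc)
        qed
        finally show ?thesis .
      qed
      also have "ennreal C * ennreal ((2 * R) ^ m * (16 * R)\<^sup>2) = ennreal (C * (2 ^ m * 16\<^sup>2) * R ^ (m + 2))"
        unfolding ennreal_mult'[OF C, symmetric] by (simp add: power_mult_distrib power_add power2_eq_square mult_ac)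
      finally show ?thesis .
    qed simp
  qed
qed

end

section \<open>The lift of the foliation\<close>

context torus_product_volume_measure
begin

section \<open>Finiteness and positivity of the total volume\<close>

lemma compact_product_manifold: "compact (product_manifold :: ('p \<times> (real ^ 'n)) set)"
  using manifold unfolding product_manifold_def closed_connected_riemannian_manifold_def
  by (intro compact_Times compact_cball) simp

lemma torus_product_subset: "torus_product \<subseteq> product_manifold"
  using torus_in_ball2 by (auto simp: product_manifold_def)

text \<open>By compactness finitely many coordinate balls of finite volume suffice.\<close>

lemma volume_finite: "emeasure \<mu> (space \<mu>) < \<infinity>"
proof -
  define \<U> where "\<U> = {U :: ('p \<times> (real ^ 'n)) set. open U \<and> emeasure \<mu> (U \<inter> torus_product) < \<infinity>}"
  have cov: "product_manifold \<subseteq> \<Union>\<U>"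
  proof
    fix x :: "'p \<times> (real ^ 'n)"
    obtain c where c: "c \<in> A" "fst x \<in> fst c" using charts_cover by metis
    obtain \<rho> where \<rho>: "\<rho> > 0" "cball (snd c (fst x)) \<rho> \<inter> E0 \<subseteq> snd c ` fst c"
      using chart_ball[OF c(1) open_UNIV c(2)] by auto
    obtain K where K: "K \<ge> 0" "\<And>w R. 0 < R \<Longrightarrow> R \<le> 1 / 4 \<Longrightarrow> dist (snd c (fst x)) (fst w) + R \<le> \<rho> \<Longrightarrow>
        emeasure \<mu> (coord_ball c w R \<inter> torus_product) \<le> ennreal (K * R ^ (m + 2))"
      using volume_coord_ball_le[OF c(1) \<rho>(2)] by metis
    let ?U = "coord_ball c (product_chart c x) (min (1 / 4) \<rho>)"
    have "emeasure \<mu> (?U \<inter> torus_product) \<le> ennreal (K * min (1 / 4) \<rho> ^ (m + 2))"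
      using \<rho>(1) by (intro K(2)) (auto simp: product_chart_def)
    hence "?U \<in> \<U>" using open_coord_ball[OF c(1)] by (auto simp: \<U>_def elim: le_less_trans)
    moreover have "x \<in> ?U" using c \<rho>(1) by (simp add: coord_ball_def)
    ultimately show "x \<in> \<Union>\<U>" by blast
  qed
  have op: "open U" if "U \<in> \<U>" for U using that by (simp add: \<U>_def)
  obtain \<U>' where \<U>': "\<U>' \<subseteq> \<U>" "finite \<U>'" "product_manifold \<subseteq> \<Union>\<U>'"
    by (rule compactE[OF compact_product_manifold cov op])
  have "space \<mu> \<subseteq> (\<Union>U\<in>\<U>'. U \<inter> torus_product)"
    using \<U>'(3) torus_product_subset by (auto simp: space_volume)
  hence "emeasure \<mu> (space \<mu>) \<le> emeasure \<mu> (\<Union>U\<in>\<U>'. U \<inter> torus_product)"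
    using \<U>' op by (intro emeasure_mono sets.finite_UN open_Int_in_sets_volume) auto
  also have "\<dots> \<le> (\<Sum>U\<in>\<U>'. emeasure \<mu> (U \<inter> torus_product))"
    using \<U>' op by (intro emeasure_subadditive_finite) (auto intro!: open_Int_in_sets_volume)
  also have "\<dots> < \<infinity>"
    using \<U>' by (auto simp: \<U>_def less_top)
  finally show ?thesis .
qed

text \<open>The normalization divides by the total mass. Some small coordinate box has positive
  Lebesgue measure and a density bounded below by a positive \<kappa>, by compactness and
  \<open>gram_coeff_pos\<close>.\<close>

lemma volume_pos: "emeasure \<mu> (space \<mu>) > 0"
proof -
  fix p0 :: 'p
  obtain c where c: "c \<in> A" "p0 \<in> fst c" using charts_cover by metis
  let ?y0 = "snd c p0"
  obtain \<rho> where \<rho>: "\<rho> > 0" "cball ?y0 \<rho> \<inter> E0 \<subseteq> snd c ` fst c"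
    using chart_ball[OF c(1) open_UNIV c(2)] by auto
  let ?K = "chart_inv c ` (cball ?y0 \<rho> \<inter> E0)"
  have K: "compact ?K" "?K \<subseteq> fst c" using compact_chart_ball[OF c(1) \<rho>(2)] .
  have "?y0 \<in> cball ?y0 \<rho> \<inter> E0" using \<rho>(1) chart_in_E0[OF c] by simp
  hence "?K \<noteq> {}" by blast
  then obtain p1 where p1: "p1 \<in> ?K"
      "\<forall>p\<in>?K. gram_det (m + 2) (gram_coeff c p1) \<le> gram_det (m + 2) (gram_coeff c p)"
    using continuous_attains_inf[OF K(1) _ continuous_on_subset[OF continuous_on_gram_coeff[OF c(1)] K(2)]] by blast
  define \<kappa> where "\<kappa> = sqrt (gram_det (m + 2) (gram_coeff c p1))"
  have "p1 \<in> fst c" using p1(1) K(2) by blast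
  hence \<kappa>: "\<kappa> > 0" using gram_coeff_pos[OF c(1)] by (simp add: \<kappa>_def)
  define R where "R = min \<rho> (1 / 4)"
  \<comment> \<open>Over a box of half side \<open>r\<close> the manifold coordinates move by at
    most \<open>m * r\<close> and the torus point by at most \<open>2 * r\<close>; with the
    denominator \<open>m + 3\<close> the sum stays strictly below \<open>R\<close>.\<close>
  define r where "r = R / (real m + 3)"
  have R: "R > 0" "R \<le> \<rho>" "R \<le> 1 / 4" using \<rho>(1) by (auto simp: R_def)
  have "(real m + 3) * r = R" by (simp add: r_def)
  moreover have r: "r > 0" using R(1) by (simp add: r_def)
  ultimately have mr: "real m * r + 2 * r < R" by (simp add: algebra_simps)
  let ?D = "coord_ball c (?y0, T (0, 0)) R \<inter> torus_product"
  define u where "u = (\<lambda>i. if i < m then ?y0 \<bullet> b i else 0)"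
  let ?B = "PiE {..<m + 2} (\<lambda>i. {u i - r..u i + r})"
  have DS: "?D \<in> sets \<mu>" using open_Int_in_sets_volume[OF open_coord_ball[OF c(1)]] .
  have sub: "fst y \<in> fst c \<and> norm (snd y - T (0, 0)) < 3 / 4" if "y \<in> ?D" for y
  proof -
    have "dist (product_chart c y) (?y0, T (0, 0)) < R" using that by (simp add: coord_ball_def dist_norm)
    from le_less_trans[OF dist_snd_le this] show ?thesis
      using that R(3) by (auto simp: coord_ball_def product_chart_def dist_norm)
  qed
  have inD: "model_point m b z \<in> snd c ` fst c \<and> \<bar>z m - 0\<bar> < pi \<and> \<bar>z (Suc m) - 0\<bar> < pi \<and> param c z \<in> ?D \<and>
      \<kappa> \<le> sqrt (gram_det (m + 2) (gram_coeff c (fst (param c z))))" if z: "z \<in> ?B" for z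
  proof -
    have zi: "\<bar>z i - u i\<bar> \<le> r" if "i < m + 2" for i
      using PiE_mem[OF z, of i] that by (auto simp: abs_le_iff)
    have zm: "\<bar>z m\<bar> \<le> r" "\<bar>z (Suc m)\<bar> \<le> r" using zi[of m] zi[of "Suc m"] by (simp_all add: u_def)
    have "model_point m b z - ?y0 = (\<Sum>i<m. (z i - u i) *\<^sub>R b i)"
    proof -
      have "?y0 = (\<Sum>i<m. u i *\<^sub>R b i)"
        using E0_expand[OF chart_in_E0[OF c]] by (simp add: u_def)
      hence "model_point m b z - ?y0 = (\<Sum>i<m. z i *\<^sub>R b i) - (\<Sum>i<m. u i *\<^sub>R b i)"
        by (simp only: model_point_def)
      thus ?thesis by (simp add: sum_subtractf scaleR_diff_left)
    qed
    hence "norm (model_point m b z - ?y0) \<le> (\<Sum>i<m. norm ((z i - u i) *\<^sub>R b i))"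
      by (simp only: norm_sum)
    also have "\<dots> \<le> (\<Sum>i<m. r)"
      using zi b_Basis by (intro sum_mono) auto
    finally have 1: "norm (model_point m b z - ?y0) \<le> real m * r" by simp
    have im: "model_point m b z \<in> cball ?y0 \<rho> \<inter> E0"
      using 1 mr r R(2) model_point_in_E0 by (auto simp: dist_norm norm_minus_commute)
    hence im': "model_point m b z \<in> snd c ` fst c" using \<rho>(2) by blast
    have p: "fst (param c z) = chart_inv c (model_point m b z)" "snd (param c z) = T (z m, z (Suc m))"
      by (simp_all add: torus_product_param_def chart_inv_def)
    have 2: "norm (T (z m, z (Suc m)) - T (0, 0)) \<le> 2 * r"
      using torus_cover_lipschitz[of "z m" "z (Suc m)" 0 0] zm by simp
    have "product_chart c (param c z) - (?y0, T (0, 0)) = (model_point m b z - ?y0, T (z m, z (Suc m)) - T (0, 0))"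
      using chart_chart_inv[OF c(1) im'] by (simp add: product_chart_def p)
    hence "norm (product_chart c (param c z) - (?y0, T (0, 0))) < R"
      using norm_Pair_le[of "model_point m b z - ?y0" "T (z m, z (Suc m)) - T (0, 0)"] 1 2 mr by simp
    moreover have "fst (param c z) \<in> fst c" unfolding p by (rule chart_inv_in[OF c(1) im'])
    moreover have "param c z \<in> torus_product"
      unfolding mem_Times_iff p clifford_torus_eq_range by blast
    ultimately have inD: "param c z \<in> ?D" by (simp add: coord_ball_def)
    have "fst (param c z) \<in> ?K" unfolding p using im by blast
    hence "\<kappa> \<le> sqrt (gram_det (m + 2) (gram_coeff c (fst (param c z))))"
      unfolding \<kappa>_def using p1(2) by (intro real_sqrt_le_mono) blast
    moreover have "r < pi"
    proof -
      have "0 \<le> real m * r" using r by simp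
      thus ?thesis using mr r R(3) pi_gt3 by linarith
    qed
    ultimately show ?thesis using im' inD zm by simp
  qed
  have "0 < ennreal (\<kappa> * (2 * r) ^ (m + 2))" using \<kappa> r by simp
  also have "ennreal (\<kappa> * (2 * r) ^ (m + 2)) = ennreal \<kappa> * (\<Prod>i<m + 2. ennreal (2 * r))"
  proof -
    have "0 \<le> 2 * r" "0 \<le> \<kappa>" using r \<kappa> by simp_all
    thus ?thesis by (simp only: prod_constant card_lessThan ennreal_mult' [of \<kappa>] ennreal_power)
  qed
  also have "\<dots> = (\<integral>\<^sup>+z. ennreal \<kappa> * indicator ?B z \<partial>lebesgue_Rk (m + 2))"
    using r by (subst nn_integral_cmult_indicator[OF emeasure_box(2)]) (simp add: emeasure_box(1))
  also have "\<dots> \<le> (\<integral>\<^sup>+z. indicator {z. model_point m b z \<in> snd c ` fst c \<and>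
          \<bar>z m - 0\<bar> < pi \<and> \<bar>z (Suc m) - 0\<bar> < pi \<and> param c z \<in> ?D} z *
          ennreal (sqrt (gram_det (m + 2) (gram_coeff c (fst (param c z))))) \<partial>lebesgue_Rk (m + 2))"
  proof (rule nn_integral_mono)
    fix z :: "nat \<Rightarrow> real"
    show "ennreal \<kappa> * indicator ?B z \<le> indicator {z. model_point m b z \<in> snd c ` fst c \<and>
          \<bar>z m - 0\<bar> < pi \<and> \<bar>z (Suc m) - 0\<bar> < pi \<and> param c z \<in> ?D} z *
          ennreal (sqrt (gram_det (m + 2) (gram_coeff c (fst (param c z)))))"
    proof (cases "z \<in> ?B")
      case True
      from inD[OF this] show ?thesis using True by (simp add: ennreal_leI del: Int_iff)
    qed simp
  qed
  also have "\<dots> = emeasure \<mu> ?D" by (rule volume_chart[OF c(1) DS sub, symmetric])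
  also have "\<dots> \<le> emeasure \<mu> (space \<mu>)" by (rule emeasure_space)
  finally show ?thesis .
qed

lemma dim_E0: "dim E0 = m"
proof -
  have inj: "inj_on b {..<m}" and sub: "b ` {..<m} \<subseteq> Basis"
    using manifold by (auto simp: closed_connected_riemannian_manifold_def model_frame_def)
  have "independent (b ` {..<m})" using independent_mono[OF independent_Basis sub] .
  hence "dim (b ` {..<m}) = card (b ` {..<m})" by (rule dim_eq_card_independent)
  thus ?thesis using inj by (simp add: model_space_def card_image)
qed

lemma Suc_m_le: "m + 1 \<le> DIM('e \<times> (real ^ 'n))"
proof -
  have "m \<le> DIM('e)" using dim_subset_UNIV[of E0] dim_E0 by simp
  thus ?thesis using card_ge_4 by simp
qed

text \<open>Parametrizes the coordinate plane of the foliation by a fixed space, injectively and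
  continuously in \<open>q\<close>, as \<open>continuous_on_subspace_dist_image\<close>
  requires.\<close>

definition leaf_map :: "real \<Rightarrow> real ^ 'n \<Rightarrow> ('e \<times> real) \<Rightarrow>\<^sub>L ('e \<times> (real ^ 'n))" where
  "leaf_map s q = Blinfun (\<lambda>u. (fst u, snd u *\<^sub>R leaf_direction s q))"

lemma leaf_map_apply: "blinfun_apply (leaf_map s q) u = (fst u, snd u *\<^sub>R leaf_direction s q)"
proof -
  have "bounded_linear (\<lambda>u :: 'e \<times> real. (fst u, snd u *\<^sub>R leaf_direction s q))"
    by (intro bounded_linear_Pair bounded_linear_fst
        bounded_linear_compose[OF bounded_linear_scaleR_left bounded_linear_snd])
  thus ?thesis by (simp add: leaf_map_def bounded_linear_Blinfun_apply)
qed

definition leaf_plane :: "real \<Rightarrow> real ^ 'n \<Rightarrow> ('e \<times> (real ^ 'n)) set" where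
  "leaf_plane s q = leaf_map s q ` (E0 \<times> UNIV)"

lemma leaf_plane_eq: "leaf_plane s q = E0 \<times> range (\<lambda>a. a *\<^sub>R leaf_direction s q)"
proof -
  have "leaf_plane s q = (\<lambda>u. (fst u, snd u *\<^sub>R leaf_direction s q)) ` (E0 \<times> UNIV)"
    by (simp add: leaf_plane_def leaf_map_apply)
  also have "\<dots> = E0 \<times> range (\<lambda>a. a *\<^sub>R leaf_direction s q)" by force
  finally show ?thesis .
qed

lemma leaf_map_inj: "q \<in> clifford_torus e \<Longrightarrow> leaf_map s q u = 0 \<Longrightarrow> u = 0"
  using leaf_direction_nonzero by (auto simp: leaf_map_apply zero_prod_def prod_eq_iff)

lemma subspace_leaf_plane: "subspace (leaf_plane s q)"
  unfolding leaf_plane_def by (intro subspace_blinfun_image subspace_Times subspace_E0 subspace_UNIV)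

lemma dim_leaf_plane: "q \<in> clifford_torus e \<Longrightarrow> dim (leaf_plane s q) = m + 1"
proof -
  assume q: "q \<in> clifford_torus e"
  have lin: "linear (blinfun_apply (leaf_map s q))" by (rule bounded_linear.linear[OF blinfun.bounded_linear_right])
  have "inj (blinfun_apply (leaf_map s q))"
    unfolding linear_injective_0[OF lin] using leaf_map_inj[OF q] by blast
  hence "inj_on (blinfun_apply (leaf_map s q)) (span (E0 \<times> UNIV))" by (rule inj_on_subset) simp
  hence "dim (leaf_plane s q) = dim (E0 \<times> (UNIV :: real set))"
    unfolding leaf_plane_def by (rule dim_image_eq[OF lin])
  thus ?thesis by (simp add: dim_Times subspace_E0 dim_E0)
qed

lemma continuous_on_leaf_plane:
  assumes "subspace Q"
  shows "continuous_on torus_product (\<lambda>y. subspace_dist (leaf_plane s (snd y)) Q)"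
  unfolding leaf_plane_def
proof (rule continuous_on_subspace_dist_image[OF _ _ assms])
  show "subspace (E0 \<times> (UNIV :: real set))" by (intro subspace_Times subspace_E0 subspace_UNIV)
  show "continuous_on torus_product (\<lambda>y. leaf_map s (snd y))"
  proof (rule continuous_on_blinfun_componentwise)
    fix u :: "'e \<times> real"
    have "continuous_on torus_product (\<lambda>y :: 'p \<times> (real ^ 'n). leaf_direction s (snd y))"
      by (rule continuous_on_compose2[OF continuous_on_leaf_direction[of UNIV]]) (auto intro!: continuous_intros)
    thus "continuous_on torus_product (\<lambda>y. blinfun_apply (leaf_map s (snd y)) u)"
      unfolding leaf_map_apply by (intro continuous_intros)
  qed
  fix y :: "'p \<times> (real ^ 'n)" and u assume "y \<in> torus_product" "blinfun_apply (leaf_map s (snd y)) u = 0"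
  thus "u = 0" using leaf_map_inj[of "snd y" s u] by auto
qed

context
  fixes F s
  assumes F: "F = {(\<lambda>r. T (r, s * r + t)) | t. True}"
begin

definition lift :: "'p \<times> (real ^ 'n) \<Rightarrow> ('p \<times> (real ^ 'n)) \<times> ('p, 'e, 'n) product_tvec set" where
  "lift y = (y, tangent_space m b A (fst y) \<times> foliation_tangent F (snd y))"

text \<open>In every chart the tangent space of the manifold becomes all of \<open>E0\<close>, so
  the coordinates of the plane depend on the torus point alone.\<close>

lemma lift_coords:
  assumes y: "y \<in> torus_product" and c: "c \<in> A" "fst y \<in> fst c"
  shows "tvec_coords c ` snd (lift y) = leaf_plane s (snd y)"
    "snd (lift y) = coords_inv c y ` leaf_plane s (snd y)"
proof -
  have ft: "foliation_tangent F (snd y) = range (\<lambda>a. a *\<^sub>R leaf_direction s (snd y))"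
    by (rule foliation_tangent_eq[OF F]) (use y in auto)
  have "tvec_coords c ` snd (lift y) = ((\<lambda>v. v c) ` tangent_space m b A (fst y)) \<times> foliation_tangent F (snd y)"
    by (force simp: tvec_coords_def[abs_def] lift_def)
  thus 1: "tvec_coords c ` snd (lift y) = leaf_plane s (snd y)"
    by (simp only: tangent_space_apply_image[OF c] ft leaf_plane_eq)
  have "coords_inv c y (tvec_coords c v) = v" if "v \<in> snd (lift y)" for v
    using that by (intro coords_inv_tvec_coords[OF c]) (auto simp: lift_def product_tangent_space_def)
  hence "coords_inv c y ` tvec_coords c ` snd (lift y) = snd (lift y)" unfolding image_image by simp
  thus "snd (lift y) = coords_inv c y ` leaf_plane s (snd y)" unfolding 1 by simp
qed

lemma lift_in_bundle:
  assumes y: "y \<in> torus_product"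
  shows "lift y \<in> grassmann_bundle m b A (m + 1)"
proof -
  obtain c where c: "c \<in> A" "fst y \<in> fst c" using charts_cover by metis
  have "(y, coords_inv c y ` leaf_plane s (snd y)) \<in> grassmann_bundle m b A (m + 1)"
  proof (rule grassmann_bundleI[OF _ c subspace_leaf_plane])
    show "y \<in> product_manifold" using y torus_product_subset by blast
    show "leaf_plane s (snd y) \<subseteq> E1" by (auto simp: leaf_plane_eq)
    show "dim (leaf_plane s (snd y)) = m + 1" by (rule dim_leaf_plane) (use y in auto)
  qed
  moreover have "lift y = (y, coords_inv c y ` leaf_plane s (snd y))"
    using lift_coords(2)[OF y c] by (simp add: prod_eq_iff) (simp add: lift_def)
  ultimately show ?thesis by simp
qed

text \<open>Checked on the generating sets of the topology; it makes the lift Borel measurable,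
  which the integral against the pushforward requires.\<close>

lemma continuous_map_lift: "continuous_map (top_of_set torus_product) (grassmann_topology m b A (m + 1)) lift"
  unfolding grassmann_topology_def
proof (rule continuous_on_generated_topo)
  let ?G = "grassmann_bundle m b A (m + 1) :: (('p \<times> (real ^ 'n)) \<times> _) set"
  let ?gens = "{{\<xi> \<in> ?G. fst \<xi> \<in> N \<and> fst (fst \<xi>) \<in> fst c \<and> subspace_dist (tvec_coords c ` snd \<xi>) Q < \<epsilon>} | N c Q \<epsilon>.
      open N \<and> c \<in> A \<and> subspace Q \<and> \<epsilon> > 0}"
  have "\<Union>?gens = ?G"
    using topspace_grassmann_topology[of "m + 1"] unfolding grassmann_topology_def topology_generated_by_topspace .
  thus "lift ` topspace (top_of_set torus_product) \<subseteq> \<Union>?gens" using lift_in_bundle by auto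
  fix U assume "U \<in> ?gens"
  then obtain N c Q \<epsilon> where U: "U = {\<xi> \<in> ?G. fst \<xi> \<in> N \<and> fst (fst \<xi>) \<in> fst c \<and> subspace_dist (tvec_coords c ` snd \<xi>) Q < \<epsilon>}"
    and N: "open N" "c \<in> A" "subspace Q" by blast
  have "openin (top_of_set torus_product) (torus_product \<inter> (\<lambda>y. subspace_dist (leaf_plane s (snd y)) Q) -` {..<\<epsilon>})"
    by (rule continuous_openin_preimage_gen[OF continuous_on_leaf_plane[OF N(3)]]) simp
  moreover have "openin (top_of_set torus_product) (torus_product \<inter> (N \<inter> fst c \<times> UNIV))"
    using N open_chart[OF N(2)] by (intro openin_open_Int open_Int open_Times open_UNIV)
  ultimately have "openin (top_of_set torus_product)
      ((torus_product \<inter> (\<lambda>y. subspace_dist (leaf_plane s (snd y)) Q) -` {..<\<epsilon>}) \<inter> (torus_product \<inter> (N \<inter> fst c \<times> UNIV)))"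
    by (rule openin_Int)
  moreover have "lift -` U \<inter> torus_product =
      (torus_product \<inter> (\<lambda>y. subspace_dist (leaf_plane s (snd y)) Q) -` {..<\<epsilon>}) \<inter> (torus_product \<inter> (N \<inter> fst c \<times> UNIV))"
  proof (rule Set.set_eqI)
    fix y
    have f: "fst (lift y) = y" by (simp add: lift_def)
    show "y \<in> lift -` U \<inter> torus_product \<longleftrightarrow> y \<in> (torus_product \<inter> (\<lambda>y. subspace_dist (leaf_plane s (snd y)) Q) -` {..<\<epsilon>}) \<inter> (torus_product \<inter> (N \<inter> fst c \<times> UNIV))"
    proof (cases "y \<in> torus_product \<and> fst y \<in> fst c")
      case True
      thus ?thesis using lift_in_bundle[of y] lift_coords(1)[of y c] N(2) by (simp add: U f mem_Times_iff conj_commute)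
    next
      case False
      thus ?thesis by (auto simp: U f mem_Times_iff)
    qed
  qed
  ultimately show "openin (top_of_set torus_product) (lift -` U \<inter> topspace (top_of_set torus_product))"
    by simp
qed

lemma measurable_lift: "lift \<in> measurable \<mu> (grassmann_borel m b A (m + 1))"
  unfolding grassmann_borel_def
proof (rule measurable_measure_of)
  show "{U. openin (grassmann_topology m b A (m + 1)) U} \<subseteq> Pow (grassmann_bundle m b A (m + 1) :: (('p \<times> (real ^ 'n)) \<times> _) set)"
    using openin_subset topspace_grassmann_topology by blast
  show "lift \<in> space \<mu> \<rightarrow> grassmann_bundle m b A (m + 1)" using lift_in_bundle by (auto simp: space_volume)
  fix U :: "(('p \<times> (real ^ 'n)) \<times> _) set" assume "U \<in> {U. openin (grassmann_topology m b A (m + 1)) U}"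
  hence "openin (top_of_set torus_product) {y \<in> topspace (top_of_set torus_product). lift y \<in> U}"
    using continuous_map_lift by (intro openin_continuous_map_preimage) auto
  then obtain O' where O': "open O'" "{y \<in> torus_product. lift y \<in> U} = torus_product \<inter> O'"
    by (auto simp: openin_open)
  have "lift -` U \<inter> space \<mu> = {y \<in> torus_product. lift y \<in> U}" unfolding space_volume by blast
  also have "\<dots> = O' \<inter> torus_product" unfolding O'(2) by (rule Int_commute)
  finally show "lift -` U \<inter> space \<mu> \<in> sets \<mu>" using open_Int_in_sets_volume[OF O'(1)] by (simp only:)
qed

lemma the_inv_into_lift: "y \<in> torus_product \<Longrightarrow> the_inv_into (foliation_lift m b A e F) fst y = lift y"
proof (rule the_inv_into_f_eq)
  show "inj_on fst (foliation_lift m b A e F)"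
    by (rule inj_on_inverseI[where g = lift]) (auto simp: foliation_lift_def lift_def)
qed (auto simp: lift_def foliation_lift_def)

text \<open>The projection undoes the lift: the weight of the varifold is the normalized
  volume.\<close>

lemma integral_foliation_varifold:
  assumes f: "continuous_on UNIV (f :: 'p \<times> (real ^ 'n) \<Rightarrow> real)"
  shows "(LINT \<xi>|foliation_varifold m b A e F \<mu>. f (fst \<xi>)) = (LINT y|normalized_measure \<mu>. f y)"
proof -
  let ?N = "normalized_measure \<mu>"
  have N: "space ?N = space \<mu>" "sets ?N = sets \<mu>" by (simp_all add: normalized_measure_def space_scale_measure)
  have "lift \<in> measurable ?N (grassmann_borel m b A (m + 1))"
    using measurable_lift measurable_cong_sets[OF N(2) refl] by blast
  hence meas: "the_inv_into (foliation_lift m b A e F) fst \<in> measurable ?N (grassmann_borel m b A (m + 1))"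
    by (subst measurable_cong[of _ _ lift]) (auto simp: N space_volume the_inv_into_lift)
  have fm: "(\<lambda>\<xi>. f (fst \<xi>)) \<in> borel_measurable (grassmann_borel m b A (m + 1))"
  proof (rule borel_measurableI)
    fix S :: "real set" assume "open S"
    hence op: "openin (grassmann_topology m b A (m + 1)) {\<xi> \<in> topspace (grassmann_topology m b A (m + 1)). f (fst \<xi>) \<in> S}"
      using continuous_map_grassmann_base[OF f, of "m + 1"] by (intro openin_continuous_map_preimage) auto
    have eq: "{\<xi> \<in> topspace (grassmann_topology m b A (m + 1)). f (fst \<xi>) \<in> S} =
        (\<lambda>\<xi>. f (fst \<xi>)) -` S \<inter> space (grassmann_borel m b A (m + 1))"
      unfolding topspace_grassmann_topology space_grassmann_borel by blast
    show "(\<lambda>\<xi>. f (fst \<xi>)) -` S \<inter> space (grassmann_borel m b A (m + 1)) \<in> sets (grassmann_borel m b A (m + 1))"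
      using sets_grassmann_borel[OF op] unfolding eq .
  qed
  have "(LINT \<xi>|foliation_varifold m b A e F \<mu>. f (fst \<xi>)) =
      (LINT y|?N. f (fst (the_inv_into (foliation_lift m b A e F) fst y)))"
    unfolding foliation_varifold_def by (rule integral_distr[OF meas fm])
  also have "\<dots> = (LINT y|?N. f y)"
    by (rule Bochner_Integration.integral_cong) (auto simp: N space_volume the_inv_into_lift lift_def)
  finally show ?thesis .
qed

end

end

section \<open>Covers by sets of small volume\<close>

text \<open>\<open>measure_of\<close> falls back to the zero measure if the given set function is
  not a measure. One set \<open>S'\<close> of nonzero measure excludes the fallback, and then outer
  measure and measure agree on all measurable sets.\<close>

lemma hausdorff_outer_eq_emeasure:
  assumes "S \<in> sets (hausdorff_measure X d k)" "emeasure (hausdorff_measure X d k) S' \<noteq> 0"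
  shows "hausdorff_outer X d k S = emeasure (hausdorff_measure X d k) S"
proof -
  let ?L = "lambda_system X (Pow X) (hausdorff_outer X d k)"
  have L: "?L \<subseteq> Pow X" by (auto simp: lambda_system_def)
  have "measure_space X (sigma_sets X ?L) (hausdorff_outer X d k)"
    using assms(2) unfolding hausdorff_measure_def emeasure_measure_of_conv by (simp split: if_splits)
  moreover have "S \<in> sigma_sets X ?L"
    using assms(1) L unfolding hausdorff_measure_def by (simp add: sets_measure_of_conv)
  ultimately show ?thesis unfolding hausdorff_measure_def emeasure_measure_of_conv by simp
qed

text \<open>Finiteness makes \<open>+ 1\<close> a strict increase, so some cover beats this bound of
  the infimum.\<close>

lemma hausdorff_cover:
  assumes fin: "hausdorff_outer X d k S < \<infinity>" and \<delta>: "\<delta> > 0"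
  obtains C :: "nat \<Rightarrow> 'x set" where "S \<subseteq> (\<Union>i. C i)" "\<And>i. C i \<subseteq> X" "\<And>i. ediam d (C i) \<le> ennreal \<delta>"
    "(\<Sum>i. if C i = {} then 0 else ennreal (unit_ball_vol (real k)) * (ediam d (C i) / 2) ^ k) \<le> hausdorff_outer X d k S + 1"
proof -
  let ?H = "hausdorff_outer X d k S"
  have "hausdorff_premeasure X d k \<delta> S \<le> ?H"
    unfolding hausdorff_outer_def using \<delta> by (intro SUP_upper) simp
  also have "?H < ?H + 1" using fin by (cases ?H) (auto simp: ennreal_plus[symmetric] ennreal_less_iff simp del: ennreal_plus)
  finally obtain C :: "nat \<Rightarrow> 'x set" where C: "S \<subseteq> (\<Union>i. C i)" "\<forall>i. C i \<subseteq> X \<and> ediam d (C i) \<le> ennreal \<delta>"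
      "(\<Sum>i. if C i = {} then 0 else ennreal (unit_ball_vol (real k)) * (ediam d (C i) / 2) ^ k) < ?H + 1"
    unfolding hausdorff_premeasure_def INF_less_iff by blast
  show ?thesis by (rule that[OF C(1) _ _ less_imp_le[OF C(3)]]) (use C(2) in blast)+
qed

lemma ediam_ge: "x \<in> C \<Longrightarrow> y \<in> C \<Longrightarrow> ennreal (d x y) \<le> ediam d C"
  unfolding ediam_def by (rule SUP_upper2[of "(x, y)"]) auto

context torus_product_volume_measure
begin

definition small_bump :: "('p \<times> (real ^ 'n)) set \<Rightarrow> real \<Rightarrow> ('p \<times> (real ^ 'n) \<Rightarrow> real) \<Rightarrow> bool" where
  "small_bump C v \<beta> \<longleftrightarrow> continuous_on UNIV \<beta> \<and> (\<forall>y. 0 \<le> \<beta> y \<and> \<beta> y \<le> 1) \<and> (\<forall>y\<in>C. \<beta> y = 1) \<and>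
     (\<integral>\<^sup>+y. ennreal (\<beta> y) \<partial>\<mu>) \<le> ennreal v"

text \<open>A tent function, equal to 1 up to radius \<open>R\<close> and to 0 from radius
  \<open>2 * R\<close> on. It is continuous on the chart domain and vanishes off the compact
  coordinate ball; these two open sets cover the space.\<close>

lemma chart_bump:
  assumes c: "c \<in> A" and w: "cball (fst w) (2 * R) \<inter> E0 \<subseteq> snd c ` fst c" and R: "R > 0"
  defines "\<beta> \<equiv> \<lambda>y. if fst y \<in> fst c then max 0 (min 1 (2 - norm (product_chart c y - w) / R)) else 0"
  shows "continuous_on UNIV \<beta>" "\<And>y. 0 \<le> \<beta> y \<and> \<beta> y \<le> 1"
    "\<And>y. fst y \<in> fst c \<Longrightarrow> norm (product_chart c y - w) \<le> R \<Longrightarrow> \<beta> y = 1"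
    "(\<integral>\<^sup>+y. ennreal (\<beta> y) \<partial>\<mu>) \<le> emeasure \<mu> (coord_ball c w (2 * R) \<inter> torus_product)"
proof -
  let ?K = "chart_inv c ` (cball (fst w) (2 * R) \<inter> E0)"
  let ?U = "fst c \<times> (UNIV :: (real ^ 'n) set)" and ?V = "(- ?K) \<times> (UNIV :: (real ^ 'n) set)"
  have K: "compact ?K" "?K \<subseteq> fst c" using compact_chart_ball[OF c w] .
  have out: "\<beta> y = 0" if "\<not> (fst y \<in> fst c \<and> norm (product_chart c y - w) < 2 * R)" for y
  proof (cases "fst y \<in> fst c")
    case True
    hence "2 - norm (product_chart c y - w) / R \<le> 0" using that R by (simp add: field_simps)
    thus ?thesis by (simp add: \<beta>_def)
  qed (simp add: \<beta>_def)
  have "continuous_on ?U (\<lambda>y. max 0 (min 1 (2 - norm (product_chart c y - w) / R)))"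
  proof -
    have "continuous_on ?U (product_chart c)"
      unfolding product_chart_def
      by (intro continuous_intros continuous_on_compose2[OF continuous_on_chart[OF c]]) auto
    thus ?thesis using R by (intro continuous_intros) auto
  qed
  hence 1: "continuous_on ?U \<beta>" by (rule continuous_on_eq) (auto simp: \<beta>_def)
  have "continuous_on ?V (\<lambda>y. 0 :: real)" by simp
  hence 2: "continuous_on ?V \<beta>"
  proof (rule continuous_on_eq)
    fix y assume y: "y \<in> ?V"
    have "\<not> (fst y \<in> fst c \<and> norm (product_chart c y - w) < 2 * R)"
    proof
      assume a: "fst y \<in> fst c \<and> norm (product_chart c y - w) < 2 * R"
      have "dist (fst w) (fst (product_chart c y)) \<le> dist w (product_chart c y)" by (rule dist_fst_le)
      hence "snd c (fst y) \<in> cball (fst w) (2 * R)"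
        using a by (simp add: product_chart_def dist_norm norm_minus_commute)
      hence "fst y \<in> ?K" using a in_chart_ball_iff[OF c w] by blast
      thus False using y by auto
    qed
    from out[OF this] show "0 = \<beta> y" by simp
  qed
  have "open ?U" "open ?V"
    using open_chart[OF c] compact_imp_closed[OF K(1)] by (auto intro!: open_Times open_Compl)
  hence "continuous_on (?U \<union> ?V) \<beta>" using 1 2 by (intro continuous_on_open_Un)
  moreover have "?U \<union> ?V = UNIV" using K(2) by auto
  ultimately show "continuous_on UNIV \<beta>" by simp
  show b01: "0 \<le> \<beta> y \<and> \<beta> y \<le> 1" for y by (simp add: \<beta>_def)
  show "\<beta> y = 1" if "fst y \<in> fst c" "norm (product_chart c y - w) \<le> R" for y
  proof -
    have "norm (product_chart c y - w) / R \<le> 1" using that(2) R by simp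
    thus ?thesis using that(1) by (simp add: \<beta>_def)
  qed
  let ?D = "coord_ball c w (2 * R) \<inter> torus_product"
  have "(\<integral>\<^sup>+y. ennreal (\<beta> y) \<partial>\<mu>) \<le> (\<integral>\<^sup>+y. indicator ?D y \<partial>\<mu>)"
  proof (rule nn_integral_mono)
    fix y assume y: "y \<in> space \<mu>"
    show "ennreal (\<beta> y) \<le> indicator ?D y"
    proof (cases "y \<in> ?D")
      case True
      thus ?thesis using b01[of y] by (simp add: indicator_def del: Int_iff)
    next
      case False
      hence "\<not> (fst y \<in> fst c \<and> norm (product_chart c y - w) < 2 * R)"
        using y by (auto simp: coord_ball_def space_volume)
      from out[OF this] show ?thesis by simp
    qed
  qed
  also have "\<dots> = emeasure \<mu> ?D"
    by (rule nn_integral_indicator) (rule open_Int_in_sets_volume[OF open_coord_ball[OF c]])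
  finally show "(\<integral>\<^sup>+y. ennreal (\<beta> y) \<partial>\<mu>) \<le> emeasure \<mu> ?D" .
qed

abbreviation rdist :: "'p \<times> (real ^ 'n) \<Rightarrow> 'p \<times> (real ^ 'n) \<Rightarrow> real" where
  "rdist \<equiv> riemannian_distance A h g"

text \<open>A set that meets \<open>W\<close> and has small diameter \<open>D\<close> lies in a
  coordinate ball of radius \<open>C1 * D\<close> about any of its points in \<open>W\<close>, and
  \<open>chart_bump\<close> is used at twice a slightly larger radius.\<close>

lemma small_bump_local:
  fixes x0 :: "'p \<times> (real ^ 'n)"
  shows "\<exists>W K \<delta>. open W \<and> x0 \<in> W \<and> K \<ge> 0 \<and> \<delta> > 0 \<and> (\<forall>C \<epsilon>. C \<subseteq> product_manifold \<longrightarrow> C \<inter> W \<noteq> {} \<longrightarrow>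
     ediam rdist C \<le> ennreal \<delta> \<longrightarrow> \<epsilon> > 0 \<longrightarrow> (\<exists>\<beta>. small_bump C (K * enn2real (ediam rdist C) ^ (m + 2) + \<epsilon>) \<beta>))"
proof -
  obtain c where c: "c \<in> A" "fst x0 \<in> fst c" using charts_cover by metis
  obtain \<rho> where \<rho>: "\<rho> > 0" "cball (snd c (fst x0)) \<rho> \<inter> E0 \<subseteq> snd c ` fst c"
    using chart_ball[OF c(1) open_UNIV c(2)] by auto
  obtain \<delta>1 C1 where d1: "\<delta>1 > 0" "C1 > 0"
    "\<And>x y. x \<in> product_manifold \<Longrightarrow> y \<in> product_manifold \<Longrightarrow> fst x \<in> fst c \<Longrightarrow>
       norm (product_chart c x - product_chart c x0) < \<rho> / 4 \<Longrightarrow> rdist x y < \<delta>1 \<Longrightarrow>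
       fst y \<in> fst c \<and> norm (product_chart c x - product_chart c y) \<le> C1 * rdist x y"
    using local_chart_estimate[OF c(1) \<rho>(2,1)] by metis
  obtain K1 where K1: "K1 \<ge> 0" "\<And>w R. 0 < R \<Longrightarrow> R \<le> 1 / 4 \<Longrightarrow> dist (snd c (fst x0)) (fst w) + R \<le> \<rho> \<Longrightarrow>
      emeasure \<mu> (coord_ball c w R \<inter> torus_product) \<le> ennreal (K1 * R ^ (m + 2))"
    using volume_coord_ball_le[OF c(1) \<rho>(2)] by metis
  \<comment> \<open>The bump has support radius at most \<open>2 * r\<close>: the bound 1 / 8 keeps
    it within the 1 / 4 of the volume estimate, and \<open>\<rho> / 4\<close> keeps the support,
    whose centre is within \<open>\<rho> / 4\<close> of \<open>x0\<close>, inside the ball of radius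
    \<rho>.\<close>
  define r where "r = min (1 / 8) (\<rho> / 4)"
  have r: "r > 0" "r \<le> 1 / 8" "r \<le> \<rho> / 4" using \<rho>(1) by (auto simp: r_def)
  \<comment> \<open>Half of \<open>r\<close> is granted to \<open>C1 * D\<close>, the other half to
    \<eta>.\<close>
  define \<delta> where "\<delta> = min (\<delta>1 / 2) (r / (2 * C1))"
  have \<delta>: "\<delta> > 0" "\<delta> < \<delta>1" "C1 * \<delta> \<le> r / 2"
  proof -
    show "\<delta> > 0" "\<delta> < \<delta>1" using d1 r by (auto simp: \<delta>_def min_less_iff_disj)
    have "C1 * \<delta> \<le> C1 * (r / (2 * C1))" using d1(2) by (intro mult_left_mono) (auto simp: \<delta>_def)
    thus "C1 * \<delta> \<le> r / 2" using d1(2) by simp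
  qed
  define W where "W = coord_ball c (product_chart c x0) (\<rho> / 4)"
  define K where "K = K1 * (2 * C1) ^ (m + 2)"
  have W: "open W" "x0 \<in> W"
    using c(2) \<rho>(1) by (simp_all only: W_def open_coord_ball[OF c(1)]) (simp add: coord_ball_def)
  have K: "K \<ge> 0" using K1(1) d1(2) by (simp add: K_def)
  have "\<exists>\<beta>. small_bump C (K * enn2real (ediam rdist C) ^ (m + 2) + \<epsilon>) \<beta>"
    if C: "C \<subseteq> product_manifold" "C \<inter> W \<noteq> {}" "ediam rdist C \<le> ennreal \<delta>" "\<epsilon> > 0" for C \<epsilon>
  proof -
    obtain x where x: "x \<in> C" "x \<in> W" using C(2) by blast
    have xc: "fst x \<in> fst c" "norm (product_chart c x - product_chart c x0) < \<rho> / 4"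
      using x(2) by (simp_all add: W_def coord_ball_def)
    define D where "D = enn2real (ediam rdist C)"
    have D: "0 \<le> D" "D \<le> \<delta>" "ediam rdist C = ennreal D"
    proof -
      have "ediam rdist C < top_class.top" using C(3) by (rule le_less_trans) simp
      thus 1: "ediam rdist C = ennreal D" by (simp add: D_def)
      show "0 \<le> D" by (simp add: D_def)
      show "D \<le> \<delta>" using C(3) \<delta>(1) unfolding 1 by (simp add: ennreal_le_iff)
    qed
    have close: "fst y \<in> fst c \<and> norm (product_chart c y - product_chart c x) \<le> C1 * D" if y: "y \<in> C" for y
    proof -
      have "ennreal (rdist x y) \<le> ennreal D" using ediam_ge[OF x(1) y, of rdist] D(3) by simp
      hence d: "rdist x y \<le> D" using D(1) by (simp add: ennreal_le_iff)
      hence "rdist x y < \<delta>1" using D(2) \<delta>(2) by linarith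
      moreover have "x \<in> product_manifold" "y \<in> product_manifold" using C(1) x(1) y by blast+
      ultimately have "fst y \<in> fst c \<and> norm (product_chart c x - product_chart c y) \<le> C1 * rdist x y"
        using d1(3) xc by blast
      moreover have "C1 * rdist x y \<le> C1 * D" using d d1(2) by simp
      ultimately show ?thesis by (simp add: norm_minus_commute)
    qed
    \<comment> \<open>The bump needs a positive radius even if \<open>D = 0\<close>, so the radius
      is enlarged by \<eta>. By continuity a small \<eta> costs less than \<epsilon> in the volume
      bound.\<close>
    define f where "f = (\<lambda>\<eta>. K1 * (2 * (C1 * D + \<eta>)) ^ (m + 2))"
    have "isCont f 0" unfolding f_def by (intro continuous_intros)
    moreover have f0: "f 0 = K * D ^ (m + 2)" by (simp add: f_def K_def power_mult_distrib mult_ac)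
    ultimately have "\<forall>\<^sub>F \<eta> in at 0. f \<eta> < K * D ^ (m + 2) + \<epsilon>"
      using C(4) unfolding isCont_def by (intro order_tendstoD(2)) auto
    then obtain \<eta>1 where \<eta>1: "\<eta>1 > 0" "\<And>\<eta>. \<eta> \<noteq> 0 \<Longrightarrow> \<bar>\<eta>\<bar> < \<eta>1 \<Longrightarrow> f \<eta> < K * D ^ (m + 2) + \<epsilon>"
      unfolding eventually_at by (auto simp: dist_real_def)
    define \<eta> where "\<eta> = min (\<eta>1 / 2) (r / 2)"
    have \<eta>: "\<eta> > 0" "\<eta> \<le> r / 2" "\<bar>\<eta>\<bar> < \<eta>1" using \<eta>1(1) r(1) by (auto simp: \<eta>_def)
    define R where "R = C1 * D + \<eta>"
    have CD: "0 \<le> C1 * D" "C1 * D \<le> r / 2"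
    proof -
      show "0 \<le> C1 * D" using D(1) d1(2) by simp
      have "C1 * D \<le> C1 * \<delta>" using D(2) d1(2) by simp
      thus "C1 * D \<le> r / 2" using \<delta>(3) by linarith
    qed
    have R: "R > 0" "R \<le> r" using CD \<eta> by (auto simp: R_def)
    let ?w = "product_chart c x"
    have dw: "dist (snd c (fst x0)) (fst ?w) < \<rho> / 4"
    proof -
      have "dist (fst (product_chart c x0)) (fst ?w) \<le> dist (product_chart c x0) ?w" by (rule dist_fst_le)
      also have "\<dots> < \<rho> / 4" using xc(2) by (simp add: dist_norm norm_minus_commute)
      finally show ?thesis by (simp add: product_chart_def)
    qed
    have "cball (fst ?w) (2 * R) \<subseteq> cball (snd c (fst x0)) \<rho>"
    proof
      fix z assume "z \<in> cball (fst ?w) (2 * R)"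
      thus "z \<in> cball (snd c (fst x0)) \<rho>"
        using dist_triangle[of "snd c (fst x0)" z "fst ?w"] dw R(2) r(3) \<rho>(1) by simp
    qed
    hence ball: "cball (fst ?w) (2 * R) \<inter> E0 \<subseteq> snd c ` fst c" using \<rho>(2) by blast
    note \<beta> = chart_bump[OF c(1) ball R(1)]
    have "emeasure \<mu> (coord_ball c ?w (2 * R) \<inter> torus_product) \<le> ennreal (K1 * (2 * R) ^ (m + 2))"
      using R r dw \<rho>(1) by (intro K1(2)) auto
    also have "\<dots> \<le> ennreal (K * D ^ (m + 2) + \<epsilon>)"
      using \<eta>1(2)[of \<eta>] \<eta> by (intro ennreal_leI) (simp add: f_def R_def)
    finally have "(\<integral>\<^sup>+y. ennreal (if fst y \<in> fst c then max 0 (min 1 (2 - norm (product_chart c y - ?w) / R)) else 0) \<partial>\<mu>)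
        \<le> ennreal (K * D ^ (m + 2) + \<epsilon>)"
      using \<beta>(4) by (rule order_trans[rotated])
    moreover have "(if fst y \<in> fst c then max 0 (min 1 (2 - norm (product_chart c y - ?w) / R)) else 0) = 1" if "y \<in> C" for y
      using close[OF that] \<eta>(1) by (intro \<beta>(3)) (auto simp: R_def)
    ultimately have "small_bump C (K * D ^ (m + 2) + \<epsilon>)
        (\<lambda>y. if fst y \<in> fst c then max 0 (min 1 (2 - norm (product_chart c y - ?w) / R)) else 0)"
      unfolding small_bump_def using \<beta>(1,2) by blast
    thus ?thesis unfolding D_def by blast
  qed
  thus ?thesis using W K \<delta>(1) by (intro exI[of _ W] exI[of _ K] exI[of _ \<delta>]) simp
qed

lemma small_bump_exists:
  obtains K \<delta> where "K \<ge> 0" "\<delta> > 0" "\<And>C \<epsilon>. C \<subseteq> product_manifold \<Longrightarrow> ediam rdist C \<le> ennreal \<delta> \<Longrightarrow> C \<noteq> {} \<Longrightarrow>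
     \<epsilon> > 0 \<Longrightarrow> \<exists>\<beta>. small_bump C (K * enn2real (ediam rdist C) ^ (m + 2) + \<epsilon>) \<beta>"
proof -
  define good where "good = (\<lambda>W K \<delta>. open W \<and> K \<ge> 0 \<and> \<delta> > (0 :: real) \<and> (\<forall>C \<epsilon>. C \<subseteq> product_manifold \<longrightarrow> C \<inter> W \<noteq> {} \<longrightarrow>
     ediam rdist C \<le> ennreal \<delta> \<longrightarrow> \<epsilon> > 0 \<longrightarrow> (\<exists>\<beta>. small_bump C (K * enn2real (ediam rdist C) ^ (m + 2) + \<epsilon>) \<beta>)))"
  define \<W> where "\<W> = {W. \<exists>K \<delta>. good W K \<delta>}"
  have cov: "product_manifold \<subseteq> \<Union>\<W>"
  proof
    fix x :: "'p \<times> (real ^ 'n)"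
    obtain W K \<delta> where "x \<in> W" "good W K \<delta>"
      using small_bump_local[of x] unfolding good_def by (elim exE conjE) blast
    thus "x \<in> \<Union>\<W>" unfolding \<W>_def by blast
  qed
  have op: "open W" if "W \<in> \<W>" for W using that by (auto simp: \<W>_def good_def)
  obtain \<W>' where \<W>': "\<W>' \<subseteq> \<W>" "finite \<W>'" "product_manifold \<subseteq> \<Union>\<W>'"
    by (rule compactE[OF compact_product_manifold cov op])
  have "\<forall>W\<in>\<W>'. \<exists>K. \<exists>\<delta>. good W K \<delta>" using \<W>'(1) unfolding \<W>_def by blast
  from bchoice[OF this] obtain Kf where "\<forall>W\<in>\<W>'. \<exists>\<delta>. good W (Kf W) \<delta>" ..
  from bchoice[OF this] obtain \<delta>f where g: "\<forall>W\<in>\<W>'. good W (Kf W) (\<delta>f W)" ..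
  define K where "K = (\<Sum>W\<in>\<W>'. Kf W)"
  \<comment> \<open>The inserted 1 keeps the minimum defined should the cover be empty.\<close>
  define \<delta> where "\<delta> = Min (insert 1 (\<delta>f ` \<W>'))"
  have K0: "Kf W \<ge> 0" "\<delta>f W > 0" if "W \<in> \<W>'" for W using g that by (auto simp: good_def)
  show ?thesis
  proof (rule that[of K \<delta>])
    show "K \<ge> 0" unfolding K_def using K0 by (intro sum_nonneg)
    show "\<delta> > 0" unfolding \<delta>_def using \<W>'(2) K0 by (subst Min_gr_iff) auto
    fix C :: "('p \<times> (real ^ 'n)) set" and \<epsilon> :: real
    assume C: "C \<subseteq> product_manifold" "ediam rdist C \<le> ennreal \<delta>" "C \<noteq> {}" "\<epsilon> > 0"
    then obtain W where W: "W \<in> \<W>'" "C \<inter> W \<noteq> {}" using \<W>'(3) by blast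
    have "\<delta> \<le> \<delta>f W" unfolding \<delta>_def using \<W>'(2) W(1) by (intro Min_le) auto
    hence "ediam rdist C \<le> ennreal (\<delta>f W)" using C(2) by (meson ennreal_leI order_trans)
    then obtain \<beta> where \<beta>: "small_bump C (Kf W * enn2real (ediam rdist C) ^ (m + 2) + \<epsilon>) \<beta>"
      using g W C unfolding good_def by meson
    have "Kf W \<le> K" unfolding K_def using W(1) \<W>'(2) K0 by (intro member_le_sum) auto
    hence "ennreal (Kf W * enn2real (ediam rdist C) ^ (m + 2) + \<epsilon>) \<le> ennreal (K * enn2real (ediam rdist C) ^ (m + 2) + \<epsilon>)"
      by (intro ennreal_leI add_right_mono mult_right_mono) auto
    hence "small_bump C (K * enn2real (ediam rdist C) ^ (m + 2) + \<epsilon>) \<beta>"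
      using \<beta> unfolding small_bump_def by (meson order_trans)
    thus "\<exists>\<beta>. small_bump C (K * enn2real (ediam rdist C) ^ (m + 2) + \<epsilon>) \<beta>" by blast
  qed
qed

text \<open>With \<open>D\<close> at most \<delta>, the volume bound \<open>K * D ^ (m + 2)\<close>
  is at most \<delta> times a multiple of the Hausdorff summand of order \<open>m + 1\<close>. The
  sum of these summands is bounded independently of \<delta>, so shrinking \<delta> makes the total
  small.\<close>

lemma small_bump_cover:
  assumes fin: "hausdorff_outer product_manifold rdist (m + 1) S < \<infinity>" and \<epsilon>: "\<epsilon> > 0"
  shows "\<exists>\<beta> :: nat \<Rightarrow> _. (\<forall>i. continuous_on UNIV (\<beta> i)) \<and> (\<forall>i y. 0 \<le> \<beta> i y \<and> \<beta> i y \<le> 1) \<and>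
     (\<forall>x\<in>S. \<exists>i. \<beta> i x = 1) \<and> (\<Sum>i. \<integral>\<^sup>+y. ennreal (\<beta> i y) \<partial>\<mu>) \<le> ennreal \<epsilon>"
proof -
  obtain K \<delta>0 where K: "K \<ge> 0" "\<delta>0 > 0" "\<And>C \<epsilon>. C \<subseteq> product_manifold \<Longrightarrow> ediam rdist C \<le> ennreal \<delta>0 \<Longrightarrow> C \<noteq> {} \<Longrightarrow>
     \<epsilon> > 0 \<Longrightarrow> \<exists>\<beta>. small_bump C (K * enn2real (ediam rdist C) ^ (m + 2) + \<epsilon>) \<beta>"
    using small_bump_exists by metis
  let ?k = "m + 1"
  define \<omega> where "\<omega> = unit_ball_vol (real ?k)"
  have \<omega>: "\<omega> > 0" by (simp add: \<omega>_def)
  define H where "H = enn2real (hausdorff_outer product_manifold rdist ?k S) + 1"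
  have H: "hausdorff_outer product_manifold rdist ?k S + 1 = ennreal H" "H \<ge> 0"
    using fin by (cases "hausdorff_outer product_manifold rdist ?k S"; simp add: H_def)+
  \<comment> \<open>Converts \<open>K * D ^ (m + 1)\<close> into the Hausdorff summand
    \<open>\<omega> * (D / 2) ^ (m + 1)\<close>.\<close>
  define q0 where "q0 = K * 2 ^ ?k / \<omega>"
  have q0: "q0 \<ge> 0" using K(1) \<omega> by (simp add: q0_def)
  \<comment> \<open>Makes the main part \<open>\<delta> * q0 * H\<close> at most
    \<open>\<epsilon> / 2\<close>; the summand 1 avoids a zero denominator.\<close>
  define \<delta> where "\<delta> = min \<delta>0 (\<epsilon> / (2 * (q0 * H + 1)))"
  have qH: "q0 * H + 1 > 0" using q0 H(2) by (simp add: add_nonneg_pos)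
  have \<delta>: "\<delta> > 0" "\<delta> \<le> \<delta>0" using K(2) \<epsilon> qH by (auto simp: \<delta>_def)
  have \<delta>H: "\<delta> * q0 * H \<le> \<epsilon> / 2"
  proof -
    have "\<delta> * (q0 * H + 1) \<le> \<epsilon> / (2 * (q0 * H + 1)) * (q0 * H + 1)"
      using qH by (intro mult_right_mono) (auto simp: \<delta>_def)
    also have "\<dots> = \<epsilon> / 2"
    proof -
      have "\<epsilon> / (2 * Q) * Q = \<epsilon> / 2" if "Q > 0" for Q using that by simp
      from this[OF qH] show ?thesis .
    qed
    finally show ?thesis using \<delta>(1) by (simp add: algebra_simps)
  qed
  obtain C where C: "S \<subseteq> (\<Union>i. C i)" "\<And>i. C i \<subseteq> product_manifold" "\<And>i. ediam rdist (C i) \<le> ennreal \<delta>"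
    "(\<Sum>i. if C i = {} then 0 else ennreal (unit_ball_vol (real ?k)) * (ediam rdist (C i) / 2) ^ ?k)
      \<le> hausdorff_outer product_manifold rdist ?k S + 1"
    by (rule hausdorff_cover[OF fin \<delta>(1)], rule that)
  define t where "t = (\<lambda>i. if C i = {} then 0 else ennreal (unit_ball_vol (real ?k)) * (ediam rdist (C i) / 2) ^ ?k)"
  \<comment> \<open>The other half of \<epsilon> is distributed geometrically over the errors of the
    single bumps.\<close>
  define \<epsilon>' where "\<epsilon>' = (\<lambda>i. \<epsilon> / 2 * (1 / 2) ^ Suc i)"
  have \<epsilon>': "\<epsilon>' i > 0" for i using \<epsilon> by (simp add: \<epsilon>'_def)
  have "\<forall>i. \<exists>\<beta>. continuous_on UNIV \<beta> \<and> (\<forall>y. 0 \<le> \<beta> y \<and> \<beta> y \<le> 1) \<and> (\<forall>y\<in>C i. \<beta> y = 1) \<and>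
      (\<integral>\<^sup>+y. ennreal (\<beta> y) \<partial>\<mu>) \<le> ennreal (\<delta> * q0) * t i + ennreal (\<epsilon>' i)"
  proof (rule allI, goal_cases)
    case (1 i)
    show ?case
  proof (cases "C i = {}")
    case True
    thus ?thesis by (intro exI[of _ "\<lambda>_. 0"]) simp
  next
    case False
    define D where "D = enn2real (ediam rdist (C i))"
    have "ediam rdist (C i) < top_class.top" using C(3)[of i] by (rule le_less_trans) simp
    hence D: "ediam rdist (C i) = ennreal D" "0 \<le> D" by (simp_all add: D_def)
    have D\<delta>: "D \<le> \<delta>" using C(3)[of i] \<delta>(1) unfolding D(1) by (simp add: ennreal_le_iff)
    have "ediam rdist (C i) \<le> ennreal \<delta>0" using C(3)[of i] \<delta>(2) by (meson ennreal_leI order_trans)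
    then obtain \<beta> where \<beta>: "small_bump (C i) (K * D ^ (m + 2) + \<epsilon>' i) \<beta>"
      using K(3)[OF C(2) _ False \<epsilon>'] unfolding D_def by blast
    have half: "ediam rdist (C i) / 2 = ennreal (D / 2)"
      unfolding D(1) using divide_ennreal[of D 2] D(2) by simp
    have "0 \<le> D / 2" "0 \<le> \<omega>" using D(2) \<omega> by simp_all
    hence t: "t i = ennreal (\<omega> * (D / 2) ^ ?k)"
      using False by (simp only: t_def \<omega>_def[symmetric] if_False half ennreal_power ennreal_mult'[of \<omega>])
    have "K * D ^ (m + 2) = K * D ^ ?k * D" by simp
    also have "\<dots> \<le> K * D ^ ?k * \<delta>" using D\<delta> D(2) K(1) by (intro mult_left_mono) auto
    also have "\<dots> = \<delta> * q0 * (\<omega> * (D / 2) ^ ?k)" using \<omega> by (simp add: q0_def power_divide)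
    finally have "ennreal (K * D ^ (m + 2) + \<epsilon>' i) \<le> ennreal (\<delta> * q0 * (\<omega> * (D / 2) ^ ?k) + \<epsilon>' i)"
      by (intro ennreal_leI) simp
    also have "\<dots> = ennreal (\<delta> * q0) * t i + ennreal (\<epsilon>' i)"
    proof -
      have nn: "0 \<le> \<delta> * q0" "0 \<le> \<omega> * (D / 2) ^ ?k" using \<delta>(1) q0 \<omega> D(2) by simp_all
      show ?thesis unfolding t ennreal_mult'[OF nn(1), symmetric]
        by (rule ennreal_plus[OF mult_nonneg_nonneg[OF nn] less_imp_le[OF \<epsilon>']])
    qed
    finally show ?thesis using \<beta> unfolding small_bump_def by (meson order_trans)
  qed
  qed
  from choice[OF this] obtain \<beta> where \<beta>: "\<forall>i. continuous_on UNIV (\<beta> i) \<and> (\<forall>y. 0 \<le> \<beta> i y \<and> \<beta> i y \<le> 1) \<and> (\<forall>y\<in>C i. \<beta> i y = 1) \<and>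
      (\<integral>\<^sup>+y. ennreal (\<beta> i y) \<partial>\<mu>) \<le> ennreal (\<delta> * q0) * t i + ennreal (\<epsilon>' i)" ..
  have "(\<Sum>i. \<integral>\<^sup>+y. ennreal (\<beta> i y) \<partial>\<mu>) \<le> (\<Sum>i. ennreal (\<delta> * q0) * t i + ennreal (\<epsilon>' i))"
    using \<beta> by (intro suminf_le) auto
  also have "\<dots> = (\<Sum>i. ennreal (\<delta> * q0) * t i) + (\<Sum>i. ennreal (\<epsilon>' i))"
    by (intro suminf_add[symmetric]) auto
  also have "(\<Sum>i. ennreal (\<delta> * q0) * t i) = ennreal (\<delta> * q0) * (\<Sum>i. t i)"
    by (rule ennreal_suminf_cmult)
  also have "(\<Sum>i. ennreal (\<epsilon>' i)) = ennreal (\<epsilon> / 2)"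
  proof (rule suminf_ennreal_eq)
    show "0 \<le> \<epsilon>' i" for i using \<epsilon>'[of i] by simp
    show "\<epsilon>' sums (\<epsilon> / 2)" using sums_mult[OF power_half_series, of "\<epsilon> / 2"] by (simp add: \<epsilon>'_def[abs_def])
  qed
  also have "ennreal (\<delta> * q0) * (\<Sum>i. t i) + ennreal (\<epsilon> / 2) \<le> ennreal (\<delta> * q0) * ennreal H + ennreal (\<epsilon> / 2)"
    using C(4) unfolding t_def[symmetric] H(1) by (intro add_right_mono mult_left_mono) auto
  also have "\<dots> = ennreal (\<delta> * q0 * H + \<epsilon> / 2)"
  proof -
    have nn: "0 \<le> \<delta> * q0" "0 \<le> \<delta> * q0 * H" using \<delta>(1) q0 H(2) by simp_all
    show ?thesis unfolding ennreal_mult'[OF nn(1), symmetric]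
      using nn(2) \<epsilon> by (intro ennreal_plus[symmetric]) auto
  qed
  also have "\<dots> \<le> ennreal \<epsilon>" using \<delta>H by (intro ennreal_leI) simp
  finally have "(\<Sum>i. \<integral>\<^sup>+y. ennreal (\<beta> i y) \<partial>\<mu>) \<le> ennreal \<epsilon>" .
  moreover have "\<forall>x\<in>S. \<exists>i. \<beta> i x = 1" using \<beta> C(1) by blast
  ultimately show ?thesis using \<beta> by (intro exI[of _ \<beta>]) blast
qed

end

section \<open>Non-rectifiability\<close>

context torus_product_volume_measure
begin

section \<open>The normalized volume measure\<close>

lemma emeasure_normalized: "emeasure (normalized_measure \<mu>) (space \<mu>) = 1"
  and nn_integral_normalized: "f \<in> borel_measurable \<mu> \<Longrightarrow>
    (\<integral>\<^sup>+y. f y \<partial>normalized_measure \<mu>) = inverse (emeasure \<mu> (space \<mu>)) * (\<integral>\<^sup>+y. f y \<partial>\<mu>)"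
proof -
  have "emeasure \<mu> (space \<mu>) \<noteq> 0" "emeasure \<mu> (space \<mu>) \<noteq> top_class.top"
    using volume_pos volume_finite by auto
  hence "emeasure \<mu> (space \<mu>) / emeasure \<mu> (space \<mu>) = 1" by (intro ennreal_divide_self) (auto simp: less_top)
  thus "emeasure (normalized_measure \<mu>) (space \<mu>) = 1"
    by (simp add: normalized_measure_def divide_ennreal_def mult.commute)
  show "f \<in> borel_measurable \<mu> \<Longrightarrow>
    (\<integral>\<^sup>+y. f y \<partial>normalized_measure \<mu>) = inverse (emeasure \<mu> (space \<mu>)) * (\<integral>\<^sup>+y. f y \<partial>\<mu>)"
    unfolding normalized_measure_def by (rule nn_integral_scale_measure)
qed

lemma space_normalized: "space (normalized_measure \<mu>) = space \<mu>" "sets (normalized_measure \<mu>) = sets \<mu>"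
  by (simp_all add: normalized_measure_def space_scale_measure)

lemma finite_measure_normalized: "finite_measure (normalized_measure \<mu>)"
  by (rule finite_measureI) (simp add: space_normalized emeasure_normalized)

lemma measure_normalized: "measure (normalized_measure \<mu>) (space (normalized_measure \<mu>)) = 1"
  by (simp add: measure_def space_normalized emeasure_normalized)

lemma borel_measurable_volume:
  assumes "continuous_on UNIV (f :: 'p \<times> (real ^ 'n) \<Rightarrow> real)"
  shows "f \<in> borel_measurable \<mu>"
proof -
  have "f \<in> borel_measurable (restrict_space borel torus_product)"
    by (rule measurable_restrict_space1[OF borel_measurable_continuous_onI[OF assms]])
  thus ?thesis using measurable_cong_sets[OF sets_volume refl] by blast
qed

lemma integrable_normalized:
  assumes f: "continuous_on UNIV (f :: 'p \<times> (real ^ 'n) \<Rightarrow> real)" and b: "\<And>y. \<bar>f y\<bar> \<le> B"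
  shows "integrable (normalized_measure \<mu>) f"
proof -
  interpret finite_measure "normalized_measure \<mu>" by (rule finite_measure_normalized)
  have "f \<in> borel_measurable (normalized_measure \<mu>)"
    using borel_measurable_volume[OF f] measurable_cong_sets[OF space_normalized(2) refl] by blast
  thus ?thesis using b by (intro integrable_const_bound[of _ B]) auto
qed

lemma integral_normalized_le_half:
  assumes f: "continuous_on UNIV (f :: 'p \<times> (real ^ 'n) \<Rightarrow> real)" and nn: "\<And>y. 0 \<le> f y"
    and le: "(\<integral>\<^sup>+y. ennreal (f y) \<partial>\<mu>) \<le> ennreal (enn2real (emeasure \<mu> (space \<mu>)) / 2)"
  shows "(LINT y|normalized_measure \<mu>. f y) \<le> 1 / 2"
proof -
  define v where "v = enn2real (emeasure \<mu> (space \<mu>))"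
  have v: "emeasure \<mu> (space \<mu>) = ennreal v" "v > 0"
    using volume_pos volume_finite by (auto simp: v_def enn2real_positive_iff less_top)
  have fm: "f \<in> borel_measurable \<mu>" by (rule borel_measurable_volume[OF f])
  have fm': "f \<in> borel_measurable (normalized_measure \<mu>)"
    using fm measurable_cong_sets[OF space_normalized(2) refl] by blast
  have "(\<integral>\<^sup>+y. ennreal (f y) \<partial>normalized_measure \<mu>) = inverse (ennreal v) * (\<integral>\<^sup>+y. ennreal (f y) \<partial>\<mu>)"
    using fm by (subst nn_integral_normalized) (simp_all add: v(1))
  also have "\<dots> \<le> inverse (ennreal v) * ennreal (v / 2)"
    using le by (intro mult_left_mono) (auto simp: v_def)
  also have "\<dots> = ennreal (1 / 2)"
    using v(2) by (simp add: inverse_ennreal ennreal_mult[symmetric] del: ennreal_half)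
  finally have "enn2real (\<integral>\<^sup>+y. ennreal (f y) \<partial>normalized_measure \<mu>) \<le> 1 / 2"
    by (rule enn2real_leI[rotated]) simp
  thus ?thesis using fm' nn by (subst integral_eq_nn_integral) auto
qed

lemma varifold_foliation: "varifold m b A (m + 1) (foliation_varifold m b A e F \<mu>)"
  unfolding varifold_def
proof (intro conjI)
  let ?f = "the_inv_into (foliation_lift m b A e F) fst"
  let ?V = "foliation_varifold m b A e F \<mu>"
  have V: "?V = distr (normalized_measure \<mu>) (grassmann_borel m b A (m + 1)) ?f"
    by (simp add: foliation_varifold_def)
  show "space ?V = grassmann_bundle m b A (m + 1)" by (simp add: V space_grassmann_borel)
  show "sets ?V = sets (grassmann_borel m b A (m + 1))" by (simp add: V)
  \<comment> \<open>The mass of \<open>distr\<close> is either that of a preimage or the default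
    value 0; both are at most the mass of the normalized volume.\<close>
  have "emeasure ?V (space ?V) \<le> emeasure (normalized_measure \<mu>) (space (normalized_measure \<mu>))"
    unfolding V distr_def emeasure_measure_of_conv by (auto intro: emeasure_space)
  also have "\<dots> = 1" by (simp add: space_normalized emeasure_normalized)
  finally show "finite_measure ?V" by (intro finite_measureI) (auto simp: top_unique)
qed

text \<open>The functions \<open>f j\<close> have integral at most 1 / 2 against the normalized
  volume, and they converge to 1 at every point of \<open>E\<close>. By the identity of weights and
  dominated convergence the total mass 1 would be at most 1 / 2.\<close>

lemma not_rectifiable_weight:
  fixes E :: "('p \<times> (real ^ 'n)) set" and \<theta> :: "'p \<times> (real ^ 'n) \<Rightarrow> real"
  defines "H \<equiv> product_hausdorff A h g (m + 1)"
  assumes E: "E \<in> sets H" and \<theta>: "\<And>x. x \<in> E \<Longrightarrow> \<theta> x > 0" "set_integrable H E \<theta>"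
    and weight: "\<And>f. continuous_on UNIV (f :: 'p \<times> (real ^ 'n) \<Rightarrow> real) \<Longrightarrow>
       (LINT y|normalized_measure \<mu>. f y) = (LINT x:E|H. f x * \<theta> x)"
  shows False
proof -
  interpret N: finite_measure "normalized_measure \<mu>" by (rule finite_measure_normalized)
  define G where "G = (\<lambda>x. indicator E x * \<theta> x)"
  have G: "integrable H G" using \<theta>(2) by (simp add: set_integrable_def G_def)
  have weight': "(LINT y|normalized_measure \<mu>. f y) = (LINT x|H. f x * G x)" if "continuous_on UNIV f" for f
    using weight[OF that] by (simp add: set_lebesgue_integral_def G_def mult_ac)
  have G1: "(LINT x|H. G x) = 1"
    using weight'[of "\<lambda>_. 1"] by (simp add: measure_normalized)
  \<comment> \<open>The density has integral 1, so the Hausdorff measure is not the zero measure;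
    this is the condition under which \<open>hausdorff_outer_eq_emeasure\<close> relates it to the
    outer measure.\<close>
  have H0: "emeasure H (space H) \<noteq> 0"
  proof
    assume "emeasure H (space H) = 0"
    hence "AE x in H. G x = 0" by (intro AE_I[of _ _ "space H"]) auto
    hence "(LINT x|H. G x) = 0" by (rule integral_eq_zero_AE)
    thus False using G1 by simp
  qed
  have EH: "E \<subseteq> space H" using sets.sets_into_space[OF E] .
  \<comment> \<open>The superlevel sets of the density for the levels \<open>1 / n\<close>, in the
    shape of Markov's inequality, which makes their measure finite. For \<open>n = 0\<close> the set
    is empty.\<close>
  define S where "S = (\<lambda>n :: nat. {x \<in> space H. 1 \<le> ennreal (real n) * ennreal (G x)})"
  have Gm[measurable]: "G \<in> borel_measurable H" using G by (rule borel_measurable_integrable)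
  have S: "S n \<in> sets H" for n unfolding S_def by measurable
  have fin: "hausdorff_outer product_manifold rdist (m + 1) (S n) < \<infinity>" for n
  proof -
    have "emeasure H (S n) \<le> ennreal (real n) * (\<integral>\<^sup>+x. ennreal (G x) * indicator (space H) x \<partial>H)"
      unfolding S_def by (rule nn_integral_Markov_inequality) measurable
    also have "(\<integral>\<^sup>+x. ennreal (G x) * indicator (space H) x \<partial>H) = (\<integral>\<^sup>+x. ennreal (G x) \<partial>H)"
      by (intro nn_integral_cong) (simp add: indicator_def)
    also have "ennreal (real n) * \<dots> < \<infinity>"
      using integrableD(2)[OF G] by (simp add: ennreal_mult_less_top less_top)
    finally show ?thesis
      using hausdorff_outer_eq_emeasure[OF S[of n, unfolded H_def] H0[unfolded H_def]] by (simp add: H_def)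
  qed
  have ES: "\<exists>n. x \<in> S n" if x: "x \<in> E" for x
  proof -
    have Gx: "G x = \<theta> x" "\<theta> x > 0" using x \<theta>(1) by (simp_all add: G_def)
    obtain n :: nat where "1 / \<theta> x \<le> real n" using real_arch_simple by blast
    hence "1 \<le> real n * G x" using Gx by (simp add: divide_le_eq)
    hence "ennreal 1 \<le> ennreal (real n * G x)" by (rule ennreal_leI)
    hence "1 \<le> ennreal (real n) * ennreal (G x)" by (simp add: ennreal_mult')
    thus ?thesis using x EH by (auto simp: S_def)
  qed
  define v where "v = enn2real (emeasure \<mu> (space \<mu>))"
  have v: "v > 0" using volume_pos volume_finite by (auto simp: v_def enn2real_positive_iff less_top)
  \<comment> \<open>The errors add up to half of the total volume, which becomes 1 / 2 after
    normalization.\<close>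
  define \<epsilon> where "\<epsilon> = (\<lambda>n :: nat. v / 2 * (1 / 2) ^ Suc n)"
  have \<epsilon>: "\<epsilon> n > 0" for n using v by (simp add: \<epsilon>_def)
  have "\<forall>n. \<exists>\<beta>. (\<forall>i. continuous_on UNIV (\<beta> i)) \<and> (\<forall>i y. 0 \<le> \<beta> i y \<and> \<beta> i y \<le> 1) \<and>
     (\<forall>x\<in>S n. \<exists>i. \<beta> i x = 1) \<and> (\<Sum>i. \<integral>\<^sup>+y. ennreal (\<beta> i y) \<partial>\<mu>) \<le> ennreal (\<epsilon> n)"
    by (intro allI small_bump_cover[OF fin \<epsilon>])
  from choice[OF this] obtain \<beta> :: "nat \<Rightarrow> nat \<Rightarrow> 'p \<times> (real ^ 'n) \<Rightarrow> real" where
    \<beta>: "\<forall>n. (\<forall>i. continuous_on UNIV (\<beta> n i)) \<and> (\<forall>i y. 0 \<le> \<beta> n i y \<and> \<beta> n i y \<le> 1) \<and>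
     (\<forall>x\<in>S n. \<exists>i. \<beta> n i x = 1) \<and> (\<Sum>i. \<integral>\<^sup>+y. ennreal (\<beta> n i y) \<partial>\<mu>) \<le> ennreal (\<epsilon> n)" ..
  have \<beta>c: "continuous_on UNIV (\<beta> n i)" and \<beta>0: "0 \<le> \<beta> n i y" for n i y using \<beta> by simp_all
  \<comment> \<open>Finite sums stay continuous. Truncating them at 1 leaves the value 1 wherever
    some bump with indices up to \<open>j\<close> equals 1, and provides the bound for dominated
    convergence.\<close>
  define s where "s = (\<lambda>j y. \<Sum>n\<le>j. \<Sum>i\<le>j. \<beta> n i y)"
  define f where "f = (\<lambda>j y. min 1 (s j y))"
  have sc: "continuous_on UNIV (s j)" for j
    unfolding s_def by (intro continuous_on_sum \<beta>c)
  have fc: "continuous_on UNIV (f j)" for j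
    unfolding f_def by (intro continuous_intros sc)
  have s0: "0 \<le> s j y" for j y unfolding s_def by (intro sum_nonneg \<beta>0)
  have f01: "0 \<le> f j y" "f j y \<le> 1" for j y using s0[of j y] by (auto simp: f_def)
  have f_le: "(\<integral>\<^sup>+y. ennreal (f j y) \<partial>\<mu>) \<le> ennreal (v / 2)" for j
  proof -
    have "(\<integral>\<^sup>+y. ennreal (f j y) \<partial>\<mu>) \<le> (\<integral>\<^sup>+y. (\<Sum>n\<le>j. \<Sum>i\<le>j. ennreal (\<beta> n i y)) \<partial>\<mu>)"
    proof (rule nn_integral_mono)
      fix y
      have "ennreal (f j y) \<le> ennreal (s j y)" by (intro ennreal_leI) (simp add: f_def)
      also have "\<dots> = (\<Sum>n\<le>j. \<Sum>i\<le>j. ennreal (\<beta> n i y))"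
        unfolding s_def by (simp add: sum_ennreal sum_nonneg \<beta>0)
      finally show "ennreal (f j y) \<le> (\<Sum>n\<le>j. \<Sum>i\<le>j. ennreal (\<beta> n i y))" .
    qed
    also have "\<dots> = (\<Sum>n\<le>j. \<Sum>i\<le>j. \<integral>\<^sup>+y. ennreal (\<beta> n i y) \<partial>\<mu>)"
    proof -
      have [measurable]: "\<beta> n i \<in> borel_measurable \<mu>" for n i by (rule borel_measurable_volume[OF \<beta>c])
      show ?thesis by (simp add: nn_integral_sum)
    qed
    also have "\<dots> \<le> (\<Sum>n\<le>j. ennreal (\<epsilon> n))"
    proof (rule sum_mono)
      fix n
      have "(\<Sum>i\<le>j. \<integral>\<^sup>+y. ennreal (\<beta> n i y) \<partial>\<mu>) \<le> (\<Sum>i. \<integral>\<^sup>+y. ennreal (\<beta> n i y) \<partial>\<mu>)"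
        by (rule sum_le_suminf) auto
      also have "\<dots> \<le> ennreal (\<epsilon> n)" using \<beta> by blast
      finally show "(\<Sum>i\<le>j. \<integral>\<^sup>+y. ennreal (\<beta> n i y) \<partial>\<mu>) \<le> ennreal (\<epsilon> n)" .
    qed
    also have "\<dots> = ennreal (\<Sum>n\<le>j. \<epsilon> n)" using \<epsilon> by (intro sum_ennreal) (simp add: less_imp_le)
    also have "\<dots> \<le> ennreal (v / 2)"
    proof (rule ennreal_leI)
      have sums: "\<epsilon> sums (v / 2)" using sums_mult[OF power_half_series, of "v / 2"] by (simp add: \<epsilon>_def[abs_def])
      show "(\<Sum>n\<le>j. \<epsilon> n) \<le> v / 2"
        using sum_le_suminf[OF sums_summable[OF sums], of "{..j}"] \<epsilon> sums_unique[OF sums] by (simp add: less_imp_le)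
    qed
    finally show ?thesis .
  qed
  have half: "(LINT y|normalized_measure \<mu>. f j y) \<le> 1 / 2" for j
    by (rule integral_normalized_le_half[OF fc f01(1) f_le[unfolded v_def]])
  text \<open>A function that is not integrable has integral 0 by convention, so the identity for the
    test function \<open>1 + f j\<close>, whose integral is positive, yields integrability without any knowledge
    on the measurability of continuous functions for the Hausdorff measure.\<close>
  have int: "integrable H (\<lambda>x. f j x * G x)" for j
  proof -
    have c1: "continuous_on UNIV (\<lambda>y. 1 + f j y)" by (intro continuous_intros fc)
    have "integrable (normalized_measure \<mu>) (f j)"
      by (rule integrable_normalized[OF fc, of _ 1]) (use f01 in auto)
    hence "(LINT y|normalized_measure \<mu>. 1 + f j y) = 1 + (LINT y|normalized_measure \<mu>. f j y)"
      by (simp add: measure_normalized)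
    moreover have "(LINT y|normalized_measure \<mu>. f j y) \<ge> 0" using f01(1) by (intro integral_nonneg_AE) auto
    ultimately have "(LINT x|H. (1 + f j x) * G x) \<noteq> 0"
      using weight'[OF c1] by linarith
    hence "integrable H (\<lambda>x. (1 + f j x) * G x)" using not_integrable_integral_eq by blast
    hence "integrable H (\<lambda>x. (1 + f j x) * G x - G x)" using G by (rule Bochner_Integration.integrable_diff)
    thus ?thesis by (simp add: algebra_simps)
  qed
  have lim: "(\<lambda>j. f j x * G x) \<longlonglongrightarrow> G x" for x
  proof (cases "x \<in> E")
    case True
    then obtain n where "x \<in> S n" using ES by blast
    then obtain i where i: "\<beta> n i x = 1" using \<beta> by blast
    have "f j x = 1" if "j \<ge> max n i" for j
    proof -
      have "1 = \<beta> n i x" using i by simp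
      also have "\<dots> \<le> (\<Sum>i\<le>j. \<beta> n i x)" using that by (intro member_le_sum \<beta>0) auto
      also have "\<dots> \<le> s j x" unfolding s_def using that by (intro member_le_sum sum_nonneg \<beta>0) auto
      finally show ?thesis by (simp add: f_def)
    qed
    hence "\<forall>\<^sub>F j in sequentially. f j x * G x = G x"
      unfolding eventually_sequentially by (intro exI[of _ "max n i"]) simp
    thus ?thesis by (rule tendsto_eventually)
  qed (simp add: G_def)
  have "(\<lambda>j. LINT x|H. f j x * G x) \<longlonglongrightarrow> (LINT x|H. G x)"
  proof (rule integral_dominated_convergence[where w = "\<lambda>x. \<bar>G x\<bar>"])
    show "integrable H (\<lambda>x. \<bar>G x\<bar>)" using G by (rule integrable_abs)
    show "(\<lambda>x. f j x * G x) \<in> borel_measurable H" for j using int by (rule borel_measurable_integrable)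
    show "AE x in H. norm (f j x * G x) \<le> \<bar>G x\<bar>" for j
      using f01 by (intro AE_I2) (simp add: abs_mult mult_left_le_one_le)
  qed (use lim in auto)
  moreover have "(LINT x|H. f j x * G x) \<le> 1 / 2" for j
    using half[of j] weight'[OF fc[of j]] by simp
  ultimately have "(LINT x|H. G x) \<le> 1 / 2" by (intro LIMSEQ_le_const2) auto
  thus False using G1 by simp
qed

text \<open>The defining identity of rectifiability, restricted to test functions of the base point,
  is the identity of weights that \<open>not_rectifiable_weight\<close> refutes.\<close>

lemma not_rectifiable_foliation:
  assumes F: "F = {(\<lambda>r. T (r, s * r + t)) | t. True}"
  shows "\<not> rectifiable_varifold m b A h g (m + 1) (foliation_varifold m b A e F \<mu>)"
proof
  assume "rectifiable_varifold m b A h g (m + 1) (foliation_varifold m b A e F \<mu>)"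
  then obtain E \<theta> P where E: "E \<in> sets (product_hausdorff A h g (m + 1))" "\<forall>x\<in>E. \<theta> x > 0"
      "set_integrable (product_hausdorff A h g (m + 1)) E \<theta>"
    and V: "\<forall>\<phi>. continuous_compact_support (grassmann_topology m b A (m + 1)) \<phi> \<longrightarrow>
           (LINT \<xi>|foliation_varifold m b A e F \<mu>. \<phi> \<xi>) = (LINT x:E|product_hausdorff A h g (m + 1). \<phi> (x, P x) * \<theta> x)"
    unfolding rectifiable_varifold_def by (elim exE conjE) (rule that)
  have "(LINT y|normalized_measure \<mu>. f y) = (LINT x:E|product_hausdorff A h g (m + 1). f x * \<theta> x)"
    if f: "continuous_on UNIV f" for f :: "'p \<times> (real ^ 'n) \<Rightarrow> real"
    using V[rule_format, OF continuous_compact_support_base[OF Suc_m_le f]]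
      integral_foliation_varifold[OF F f] by simp
  thus False using not_rectifiable_weight[OF E(1) _ E(3)] E(2) by blast
qed

end

theorem fact2:
  fixes m :: nat
    and b :: "nat \<Rightarrow> 'e::euclidean_space"
    and A :: "('p::{t2_space,second_countable_topology}, 'e) chart set"
    and h :: "'p \<Rightarrow> ('p, 'e) tvec \<Rightarrow> ('p, 'e) tvec \<Rightarrow> real"
    and g :: "('n::finite) ball_metric"
    and e :: "nat \<Rightarrow> 'n"
    and F :: "(real \<Rightarrow> real ^ 'n) set"
    and \<mu> :: "('p \<times> (real ^ 'n)) measure"
  assumes "closed_connected_riemannian_manifold m b A h"
    and "CARD('n) \<ge> 4"
    and "bij_betw e {1..CARD('n)} UNIV"
    and "riemannian_metric_on_ball g"
    and "induces_flat_torus_metric e g"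
    and "norm_is_convex_distance_function g"
    and "irrational_geodesic_foliation e F"
    and "hessian_condition e g F"
    and "second_fundamental_form_condition e g F"
    and "torus_product_volume m b A h g e \<mu>"
  shows "varifold m b A (m + 1) (foliation_varifold m b A e F \<mu>) \<and>
    \<not> rectifiable_varifold m b A h g (m + 1) (foliation_varifold m b A e F \<mu>)"
proof -
  interpret torus_product_volume_measure m b A h g e \<mu>
    by unfold_locales (use assms in simp_all)
  obtain s where "F = {(\<lambda>r. torus_cover e (r, s * r + t)) | t. True}"
    using assms(7) unfolding irrational_geodesic_foliation_def by blast
  thus ?thesis using varifold_foliation not_rectifiable_foliation by blast
qed

end
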